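(* Let $f\in L^2(\mathcal F_0^{\infty})$ belong to the Gordin class $\mathcal G$, and let $\tilde g, h$ be the elements of its decomposition $f-\mathbb E f=\tilde g+h\circ\tau^{-1}-h$. Put $S_N=\sum_{n=0}^N (f-\mathbb E f)\circ\tau^n$. Then a) $\displaystyle \lim_{N\to\infty}\frac{1}{\sqrt N}\|S_N\|_{L^2}=\|\tilde g\|_{L^2}$; b) $\displaystyle \limsup_{N\to\infty}\frac{|S_N|}{\sqrt{2N\log\log N}}=\|\tilde g\|_{L^2}$ almost surely.
   Context: Let $(E,\mathcal E,\mu)$ be a probability space and $(\Omega,\mathcal A,\mathbb P)=(E^{\mathbb Z},\mathcal E^{\otimes\mathbb Z},\mu^{\otimes\mathbb Z})$ with coordinate maps $X_n:\Omega\to E$, $n\in\mathbb Z$. The shift to the right $\tau$ is the automorphism of $(\Omega,\mathcal A,\mathbb P)$ defined by $X_n\circ\tau=X_{n-1}$ for all $n\in\mathbb Z$. Put $\mathcal F_m^{\infty}=\sigma(X_k,\ k\ge m)$. The operator $T$ is defined on $L^1(\mathcal F_0^\infty,\mathbb P)$ by $Tf=\mathbb E[f\mid\mathcal F_1^\infty]\circ\tau$. A function $f\in L^2(\mathcal F_0^\infty)$ belongs to the Gordin class $\mathcal G$ if $\sum_{n=0}^N T^n(f-\mathbb E f)$ remains bounded in $L^2$ as $N\to\infty$ (equivalently: converges weakly in $L^2$; equivalently: converges in $L^2$; equivalently: $f-\mathbb E f=(I-T)g$ for some $g\in L^2(\mathcal F_0^\infty)$). It is equivalent that $f$ admits a (necessarily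 unique) decomposition $f-\mathbb E f=\tilde g+h\circ\tau^{-1}-h$ with $\tilde g,h\in L^2(\mathcal F_0^\infty)$, $\mathbb E(\tilde g\mid\mathcal F_1^\infty)=0$ and $\mathbb E h=0$. *)

theory Defs
  imports "HOL-Probability.Probability"
begin

definition path_space :: "'e measure \<Rightarrow> (int \<Rightarrow> 'e) measure"
  where "path_space M = PiM UNIV (\<lambda>_::int. M)"

definition coord :: "int \<Rightarrow> (int \<Rightarrow> 'e) \<Rightarrow> 'e"
  where "coord n \<omega> = \<omega> n"

text \<open>The shift to the right, characterised by \<open>coord n \<circ> right_shift = coord (n - 1)\<close>;
  it is a bijection, so its inverse is the library's \<open>inv right_shift\<close>.\<close>

definition right_shift :: "(int \<Rightarrow> 'e) \<Rightarrow> (int \<Rightarrow> 'e)"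
  where "right_shift \<omega> = (\<lambda>n. \<omega> (n - 1))"

lemma coord_right_shift: "coord n \<circ> right_shift = coord (n - 1)"
  by (auto simp: coord_def right_shift_def)

lemma bij_right_shift: "bij (right_shift :: (int \<Rightarrow> 'e) \<Rightarrow> (int \<Rightarrow> 'e))"
  by (rule o_bij[where g = "\<lambda>\<omega> n. \<omega> (n + 1)"]) (auto simp: right_shift_def)

definition future :: "'e measure \<Rightarrow> int \<Rightarrow> (int \<Rightarrow> 'e) measure"
  where "future M m = sigma (space (path_space M))
    {coord k -` A \<inter> space (path_space M) | k A. m \<le> k \<and> A \<in> sets M}"

text \<open>Without this, \<open>real_cond_exp\<close> given \<open>future M m\<close> would be a default value.\<close>

lemma subalgebra_future: "subalgebra (path_space M) (future M m)"
proof -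
  have "coord k -` A \<inter> space (path_space M) \<in> sets (path_space M)" if "A \<in> sets M" for k A
  proof -
    have "coord k \<in> measurable (path_space M) M"
      unfolding coord_def [abs_def] path_space_def by simp
    then show ?thesis using that by (rule measurable_sets)
  qed
  then have "sigma_sets (space (path_space M))
      {coord k -` A \<inter> space (path_space M) | k A. m \<le> k \<and> A \<in> sets M} \<subseteq> sets (path_space M)"
    by (intro sets.sigma_sets_subset) auto
  moreover have "{coord k -` A \<inter> space (path_space M) | k A. m \<le> k \<and> A \<in> sets M}
      \<subseteq> Pow (space (path_space M))"
    by auto
  ultimately show ?thesis
    unfolding subalgebra_def future_def by (simp add: space_measure_of sets_measure_of)
qed

text \<open>Elements of \<open>L\<^sup>2\<close> are represented by functions, so equalities between them are
  stated almost everywhere.\<close>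

definition L2 :: "'a measure \<Rightarrow> 'a measure \<Rightarrow> ('a \<Rightarrow> real) set"
  where "L2 P F = {f \<in> borel_measurable F. integrable P (\<lambda>\<omega>. (f \<omega>)\<^sup>2)}"

definition L2_seminorm :: "'a measure \<Rightarrow> ('a \<Rightarrow> real) \<Rightarrow> real"
  where "L2_seminorm P f = sqrt (\<integral>\<omega>. (f \<omega>)\<^sup>2 \<partial>P)"

definition centered :: "'a measure \<Rightarrow> ('a \<Rightarrow> real) \<Rightarrow> ('a \<Rightarrow> real)"
  where "centered P f = (\<lambda>\<omega>. f \<omega> - (\<integral>\<omega>'. f \<omega>' \<partial>P))"

definition transfer :: "'e measure \<Rightarrow> ((int \<Rightarrow> 'e) \<Rightarrow> real) \<Rightarrow> ((int \<Rightarrow> 'e) \<Rightarrow> real)"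
  where "transfer M f = real_cond_exp (path_space M) (future M 1) f \<circ> right_shift"

text \<open>For a probability space \<open>M\<close>, \<open>transfer M\<close> maps \<open>L2 (path_space M) (future M 0)\<close> to itself, so all the
  seminorms below are those of square integrable functions.\<close>

definition gordin_class :: "'e measure \<Rightarrow> ((int \<Rightarrow> 'e) \<Rightarrow> real) set"
  where "gordin_class M = {f \<in> L2 (path_space M) (future M 0).
    bdd_above (range (\<lambda>N. L2_seminorm (path_space M)
      (\<lambda>\<omega>. \<Sum>n\<le>N. (transfer M ^^ n) (centered (path_space M) f) \<omega>)))}"

definition gordin_decomposition ::
    "'e measure \<Rightarrow> ((int \<Rightarrow> 'e) \<Rightarrow> real) \<Rightarrow> ((int \<Rightarrow> 'e) \<Rightarrow> real) \<Rightarrow> ((int \<Rightarrow> 'e) \<Rightarrow> real) \<Rightarrow> bool"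
  where "gordin_decomposition M f g h \<longleftrightarrow>
    g \<in> L2 (path_space M) (future M 0) \<and>
    h \<in> L2 (path_space M) (future M 0) \<and>
    (AE \<omega> in path_space M. real_cond_exp (path_space M) (future M 1) g \<omega> = 0) \<and>
    (\<integral>\<omega>. h \<omega> \<partial>path_space M) = 0 \<and>
    (AE \<omega> in path_space M.
      centered (path_space M) f \<omega> = g \<omega> + h (inv right_shift \<omega>) - h \<omega>)"

definition birkhoff_sum :: "'e measure \<Rightarrow> ((int \<Rightarrow> 'e) \<Rightarrow> real) \<Rightarrow> nat \<Rightarrow> (int \<Rightarrow> 'e) \<Rightarrow> real"
  where "birkhoff_sum M f N \<omega> =
    (\<Sum>n\<le>N. centered (path_space M) f ((right_shift ^^ n) \<omega>))"

end

theory Submission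
  imports Defs "HOL-Real_Asymp.Real_Asymp"
begin

text \<open>
The decomposition writes the centered \<open>f\<close> as \<open>g\<close> plus a coboundary.  Summed along the orbit of the shift,
the coboundary telescopes to the difference of two translates of \<open>h\<close>, which is bounded in \<open>L\<^sup>2\<close> and
almost surely of smaller order than \<open>sqrt (N * ln (ln N))\<close>.  So both claims are claims about the
translates of \<open>g\<close>.  These are stationary martingale differences for the increasing algebras
\<open>future M (1 - n)\<close>.  They are orthogonal, which gives the growth of the norm.  What has to be proved is
the law of the iterated logarithm for them, assuming no more than a finite second moment.

The upper half (\<open>LIL_upper\<close>) holds for martingale differences in general, provided that the averages
of the conditional variances are asymptotically at most \<open>\<sigma>\<^sup>2\<close>.  The variables are truncated from above
at a small multiple of \<open>sqrt (n / ln (ln n))\<close>.  The truncated variables have nonpositive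
conditional means, so suitable exponentials of their sums are supermartingales, and a maximal inequality
and the Borel--Cantelli lemma along a geometric sequence give the sharp constant.  The part removed
is negligible: its normalized expectations are summable exactly because the second moment is finite
(\<open>excess_negligible\<close>).  For the shift the condition on the conditional variances is the ergodic theorem
(\<open>ergodic_averages_le\<close>), derived from Garsia's maximal inequality and the triviality of invariant events.

For the lower half, \<open>g\<close> is approximated in \<open>L\<^sup>2\<close> by bounded martingale differences depending on finitely
many coordinates (\<open>bounded_window_mart_diff_dense\<close>).  The upper half, applied to the difference, shows that
the approximation error is small on the scale of the law.  For the approximating functions, sums over
blocks of times separated by fixed gaps are independent.  The central limit theorem bounds from below the
probability that one block exceeds a large multiple of its standard deviation.  Requiring this of a
number of blocks proportional to the iterated logarithm yields independent events whose probabilities have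
a divergent sum, and on these events the sums reach nearly the full scale (\<open>LIL_lower_window\<close>).
\<close>

section \<open>Scales and truncation levels\<close>

definition lil_scale :: "real \<Rightarrow> real"
  where "lil_scale x = sqrt (2 * x * ln (ln x))"

text \<open>The truncation levels are smaller than the scale \<open>sqrt (2 * x * ln (ln x))\<close> by a factor of order
\<open>ln (ln x)\<close>.  They are low enough for the exponential moments at the parameter
\<open>sqrt (ln (ln x) / x)\<close>, which the law of the iterated logarithm calls for, to stay bounded, and high
enough for the part above them to be negligible when only second moments are finite.\<close>

definition trunc_level :: "real \<Rightarrow> real"
  where "trunc_level x = sqrt (x / ln (ln x))"

text \<open>Iterated logarithms are used only from \<open>27\<close> on; there \<open>ln (ln x)\<close> is at least \<open>1\<close> because
\<open>exp 1 \<le> 3\<close> and \<open>27 = 3 ^ 3\<close>.\<close>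

lemma ln_ln_ge_1:
  assumes "27 \<le> (x::real)"
  shows "3 \<le> ln x" "1 \<le> ln (ln x)"
proof -
  have ln3: "1 \<le> ln (3::real)"
    using exp_le by (simp add: ln_ge_iff)
  have "3 \<le> 3 * ln (3::real)" using ln3 by simp
  also have "\<dots> = ln (3 ^ 3)" by (subst ln_realpow) auto
  also have "\<dots> \<le> ln x" using assms by (subst ln_le_cancel_iff) auto
  finally show *: "3 \<le> ln x" .
  have "ln 3 \<le> ln (ln x)" using * by (subst ln_le_cancel_iff) auto
  with ln3 show "1 \<le> ln (ln x)" by simp
qed

lemma ln_ln_mono: "27 \<le> x \<Longrightarrow> x \<le> y \<Longrightarrow> ln (ln x) \<le> ln (ln (y::real))"
  using ln_ln_ge_1[of x] ln_ln_ge_1[of y] by (simp)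

lemma lil_scale_mono: "27 \<le> x \<Longrightarrow> x \<le> y \<Longrightarrow> lil_scale x \<le> lil_scale y"
  using ln_ln_mono[of x y] ln_ln_ge_1[of x] ln_ln_ge_1[of y]
  unfolding lil_scale_def by (intro real_sqrt_le_mono mult_mono) auto

lemma lil_scale_pos: "27 \<le> x \<Longrightarrow> 0 < lil_scale x"
  using ln_ln_ge_1[of x] unfolding lil_scale_def by simp

lemma trunc_level_deriv:
  assumes "27 \<le> (x::real)"
  shows "(trunc_level has_real_derivative
    (1 - 1 / (ln (ln x) * ln x)) / (2 * sqrt (x * ln (ln x)))) (at x)"
proof -
  have L: "3 \<le> ln x" "1 \<le> ln (ln x)" using ln_ln_ge_1[OF assms] by auto
  have x: "x > 0" using assms by simp
  have *: "inverse (sqrt (x / ln (ln x))) / 2 * ((ln (ln x) - x * (inverse (ln x) * inverse x)) / (ln (ln x) * ln (ln x)))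
      = (1 - 1 / (ln (ln x) * ln x)) / (2 * sqrt (x * ln (ln x)))"
  proof -
    have a: "sqrt (x / ln (ln x)) = sqrt (x * ln (ln x)) / ln (ln x)"
      using L x by (simp add: real_sqrt_divide real_sqrt_mult field_simps)
    show ?thesis unfolding a using L x by (simp add: field_simps)
  qed
  have "((\<lambda>x. sqrt (x / ln (ln x))) has_real_derivative
    inverse (sqrt (x / ln (ln x))) / 2 * ((ln (ln x) - x * (inverse (ln x) * inverse x)) / (ln (ln x) * ln (ln x)))) (at x)"
    using L x assms by (auto intro!: derivative_eq_intros simp: field_simps)
  then show ?thesis unfolding * unfolding trunc_level_def[abs_def] .
qed

text \<open>The derivative of the truncation level is of order \<open>1 / sqrt (x * ln (ln x))\<close>.  Hence a sum of
reciprocals of the scale is dominated by a telescoping sum of truncation levels.\<close>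

lemma trunc_level_increment:
  assumes "27 \<le> (x::real)"
  shows "1 / lil_scale (x + 1) \<le> 4 * (trunc_level (x + 1) - trunc_level x)"
proof -
  have "\<exists>z>x. z < x + 1 \<and> trunc_level (x + 1) - trunc_level x
     = (x + 1 - x) * ((1 - 1 / (ln (ln z) * ln z)) / (2 * sqrt (z * ln (ln z))))"
    by (rule MVT2) (use assms in \<open>auto intro!: trunc_level_deriv\<close>)
  then obtain z where z: "x < z" "z < x + 1"
    and eq: "trunc_level (x + 1) - trunc_level x = (1 - 1 / (ln (ln z) * ln z)) / (2 * sqrt (z * ln (ln z)))"
    by auto
  have L: "3 \<le> ln z" "1 \<le> ln (ln z)" using ln_ln_ge_1[of z] z assms by auto
  have "1 * 3 \<le> ln (ln z) * ln z" using L by (intro mult_mono) auto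
  then have *: "1 / 2 \<le> 1 - 1 / (ln (ln z) * ln z)" by (simp add: field_simps)
  have le: "sqrt (z * ln (ln z)) \<le> lil_scale (x + 1)"
    unfolding lil_scale_def using L ln_ln_mono[of z "x + 1"] z assms
    by (intro real_sqrt_le_mono mult_mono) auto
  have pos: "0 < sqrt (z * ln (ln z))" using L z assms by simp
  have "1 / lil_scale (x + 1) \<le> 1 / sqrt (z * ln (ln z))"
    using le pos by (intro divide_left_mono mult_pos_pos) linarith+
  also have "\<dots> = 4 * ((1/2) / (2 * sqrt (z * ln (ln z))))" by simp
  also have "\<dots> \<le> 4 * ((1 - 1 / (ln (ln z) * ln z)) / (2 * sqrt (z * ln (ln z))))"
    by (intro mult_left_mono divide_right_mono) (use pos * in auto)
  finally show ?thesis unfolding eq .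
qed

lemma trunc_level_mono:
  assumes "27 \<le> (x::real)" "x \<le> y" shows "trunc_level x \<le> trunc_level y"
proof (rule DERIV_nonneg_imp_nondecreasing[OF assms(2)])
  fix z assume z: "x \<le> z" "z \<le> y"
  have L: "3 \<le> ln z" "1 \<le> ln (ln z)" using ln_ln_ge_1[of z] z assms by auto
  have "1 * 3 \<le> ln (ln z) * ln z" using L by (intro mult_mono) auto
  then have "0 \<le> 1 - 1 / (ln (ln z) * ln z)" by (simp add: field_simps)
  moreover have "0 \<le> z * ln (ln z)" using L z assms by simp
  ultimately have "0 \<le> (1 - 1 / (ln (ln z) * ln z)) / (2 * sqrt (z * ln (ln z)))"
    by (intro divide_nonneg_nonneg) auto
  with trunc_level_deriv[of z] z assms
  show "\<exists>d. (trunc_level has_real_derivative d) (at z) \<and> 0 \<le> d" by (auto intro!: exI)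
qed

text \<open>Each summand is at most \<open>y\<close> times the reciprocal scale and vanishes once the truncation level exceeds
\<open>y / e\<close>; the reciprocals up to that time add up to a multiple of \<open>y / e\<close>.  Since the bound is quadratic
in \<open>y\<close>, a finite second moment makes the total normalized excess integrable.\<close>

lemma sum_excess_le:
  assumes y: "0 \<le> y" and e: "0 < e"
  shows "(\<Sum>n<N. max 0 (y - e * trunc_level (real n + 28)) / lil_scale (real n + 28)) \<le> 4 * y\<^sup>2 / e"
proof -
  define b where "b n = trunc_level (real n + 27)" for n
  have bSuc: "b (Suc n) = trunc_level (real n + 28)" for n
    unfolding b_def by (simp add: algebra_simps)
  have bmono: "b n \<le> b (Suc n)" for n
    using trunc_level_mono[of "real n + 27" "real n + 28"] unfolding b_def by (simp add: algebra_simps)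
  have b0: "0 \<le> b n" for n
    unfolding b_def trunc_level_def using ln_ln_ge_1[of "real n + 27"] by simp
  \<comment> \<open>Levels increase, so those below \<open>y / e\<close> form an initial segment and their increments telescope.\<close>
  have tele: "(\<Sum>n<N. if b (Suc n) < y / e then b (Suc n) - b n else 0) \<le> min (b N) (y / e)" for N
  proof (induction N)
    case 0
    then show ?case using b0[of 0] y e by simp
  next
    case (Suc N)
    then show ?case using bmono[of N] by (auto simp: min_def split: if_splits)
  qed
  have "(\<Sum>n<N. max 0 (y - e * trunc_level (real n + 28)) / lil_scale (real n + 28))
      \<le> (\<Sum>n<N. 4 * y * (if b (Suc n) < y / e then b (Suc n) - b n else 0))"
  proof (rule sum_mono)
    fix n
    have pos: "0 < lil_scale (real n + 28)" by (rule lil_scale_pos) simp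
    have inc: "1 / lil_scale (real n + 28) \<le> 4 * (b (Suc n) - b n)"
      using trunc_level_increment[of "real n + 27"] unfolding b_def by (simp add: algebra_simps)
    show "max 0 (y - e * trunc_level (real n + 28)) / lil_scale (real n + 28)
      \<le> 4 * y * (if b (Suc n) < y / e then b (Suc n) - b n else 0)"
    proof (cases "b (Suc n) < y / e")
      case True
      have "max 0 (y - e * trunc_level (real n + 28)) \<le> y"
        using y e b0[of "Suc n"] unfolding bSuc by simp
      then have "max 0 (y - e * trunc_level (real n + 28)) / lil_scale (real n + 28) \<le> y * (1 / lil_scale (real n + 28))"
        using pos by (simp add: divide_right_mono)
      also have "\<dots> \<le> y * (4 * (b (Suc n) - b n))" using inc y by (rule mult_left_mono)
      finally show ?thesis using True by (simp add: mult.assoc mult.left_commute)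
    next
      case False
      then show ?thesis using e unfolding bSuc by (simp add: field_simps)
    qed
  qed
  also have "\<dots> = 4 * y * (\<Sum>n<N. if b (Suc n) < y / e then b (Suc n) - b n else 0)"
    by (simp add: sum_distrib_left)
  also have "\<dots> \<le> 4 * y * (y / e)"
    using tele[of N] y by (intro mult_left_mono) auto
  finally show ?thesis by (simp add: power2_eq_square)
qed

lemma kronecker_nonneg:
  fixes a B :: "nat \<Rightarrow> real"
  assumes a: "\<And>i. 0 \<le> a i" and B: "\<And>i. 0 < B i" "incseq B" "filterlim B at_top sequentially"
    and s: "summable (\<lambda>i. a i / B i)"
  shows "(\<lambda>n. (\<Sum>i<n. a i) / B n) \<longlonglongrightarrow> 0"
proof (rule LIMSEQ_I)
  fix r :: real assume r: "0 < r"
  define S where "S n = (\<Sum>i<n. a i / B i)" for n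
  have "Cauchy S" unfolding S_def
    using s by (simp add: summable_LIMSEQ convergent_Cauchy convergentI[OF summable_LIMSEQ[OF s]])
  then obtain m where m: "\<And>n. m \<le> n \<Longrightarrow> \<bar>S n - S m\<bar> < r / 2"
    using r unfolding Cauchy_altdef2 dist_real_def by (metis half_gt_zero)
  have "(\<lambda>n. (\<Sum>i<m. a i) / B n) \<longlonglongrightarrow> 0"
    using B(3) by (intro tendsto_divide_0[OF tendsto_const] filterlim_at_top_imp_at_infinity)
  then have "\<forall>\<^sub>F n in sequentially. \<bar>(\<Sum>i<m. a i) / B n\<bar> < r / 2"
    using r by (auto dest: tendstoD[of _ _ _ "r/2"] simp: dist_real_def)
  then obtain n0 where n0: "\<And>n. n0 \<le> n \<Longrightarrow> \<bar>(\<Sum>i<m. a i) / B n\<bar> < r / 2"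
    by (auto simp: eventually_sequentially)
  show "\<exists>no. \<forall>n\<ge>no. norm ((\<Sum>i<n. a i) / B n - 0) < r"
  proof (intro exI[of _ "max m n0"] allI impI)
    fix n assume n: "max m n0 \<le> n"
    have Bn: "0 < B n" by (rule B)
    have sp: "(\<Sum>i<n. a i) = (\<Sum>i<m. a i) + (\<Sum>i=m..<n. a i)"
      using n sum.atLeastLessThan_concat[of 0 m n a] by (simp add: atLeast0LessThan)
    have "(\<Sum>i=m..<n. a i) / B n = (\<Sum>i=m..<n. a i / B n)" by (simp add: sum_divide_distrib)
    also have "\<dots> \<le> (\<Sum>i=m..<n. a i / B i)"
      using B(1) a B(2) by (intro sum_mono divide_left_mono) (auto simp: incseq_def)
    also have "\<dots> = S n - S m"
      using n sum.atLeastLessThan_concat[of 0 m n "\<lambda>i. a i / B i"] unfolding S_def by (simp add: atLeast0LessThan)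
    also have "\<dots> < r / 2" using m[of n] n by linarith
    finally have 1: "(\<Sum>i=m..<n. a i) / B n < r / 2" .
    have 2: "(\<Sum>i<m. a i) / B n < r / 2" using n0[of n] n abs_ge_self[of "(\<Sum>i<m. a i) / B n"] by linarith
    have "0 \<le> (\<Sum>i<n. a i) / B n" using a Bn by (simp add: sum_nonneg)
    moreover have "(\<Sum>i<n. a i) / B n < r" using 1 2 unfolding sp add_divide_distrib by linarith
    ultimately show "norm ((\<Sum>i<n. a i) / B n - 0) < r" by simp
  qed
qed

text \<open>Only the upper truncation enters the exponential: for negative arguments \<open>exp x \<le> 1 + x + x\<^sup>2 / 2\<close> holds
without any bound on \<open>x\<close>.  The linear term on the right is the untruncated one, whose conditional mean
is zero for a martingale difference.\<close>

lemma exp_min_le: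
  fixes l y a K :: real
  assumes l: "0 \<le> l" and a: "0 \<le> a" and K: "exp (l * a) \<le> K"
  shows "exp (l * min y a) \<le> 1 + l * y + l\<^sup>2 * K / 2 * y\<^sup>2"
proof -
  have K1: "1 \<le> K"
    using K a l one_le_exp_iff[of "l * a"] mult_nonneg_nonneg[OF l a] by linarith
  have pos: "exp x \<le> 1 + x + exp x / 2 * x\<^sup>2" if "0 \<le> x" for x :: real
  proof -
    obtain t where t: "\<bar>t\<bar> \<le> \<bar>x\<bar>" "exp x = (\<Sum>m<2. x ^ m / fact m) + exp t / fact 2 * x ^ 2"
      using Maclaurin_exp_le[of x 2] by blast
    have "exp t \<le> exp x" using t(1) that by simp
    then have "exp t / 2 * x\<^sup>2 \<le> exp x / 2 * x\<^sup>2" by (intro mult_right_mono) auto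
    moreover have "exp x = 1 + x + exp t / 2 * x\<^sup>2"
      using t(2) by (simp add: numeral_2_eq_2)
    ultimately show ?thesis by linarith
  qed
  have neg: "exp x \<le> 1 + x + x\<^sup>2 / 2" if "x \<le> 0" for x :: real
  proof -
    have "(\<lambda>x::real. 1 + x + x\<^sup>2 / 2 - exp x) x \<ge> (\<lambda>x::real. 1 + x + x\<^sup>2 / 2 - exp x) 0"
    proof (rule DERIV_nonpos_imp_nonincreasing[OF that])
      fix z :: real
      have "((\<lambda>x. 1 + x + x\<^sup>2 / 2 - exp x) has_real_derivative (1 + z - exp z)) (at z)"
        by (auto intro!: derivative_eq_intros)
      moreover have "1 + z - exp z \<le> 0" using exp_ge_add_one_self[of z] by simp
      ultimately show "\<exists>y. ((\<lambda>x. 1 + x + x\<^sup>2 / 2 - exp x) has_real_derivative y) (at z) \<and> y \<le> 0"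
        by blast
    qed
    then show ?thesis by simp
  qed
  define x where "x = l * min y a"
  have xy: "x \<le> l * y" unfolding x_def using l by (intro mult_left_mono) auto
  have xK: "exp x \<le> 1 + x + K / 2 * x\<^sup>2"
  proof (cases "0 \<le> x")
    case True
    have "x \<le> l * a" unfolding x_def using l by (intro mult_left_mono) auto
    then have "exp x \<le> K" using K by (meson exp_le_cancel_iff order_trans)
    then have "exp x / 2 * x\<^sup>2 \<le> K / 2 * x\<^sup>2" by (intro mult_right_mono) auto
    with pos[OF True] show ?thesis by simp
  next
    case False
    have "1 / 2 * x\<^sup>2 \<le> K / 2 * x\<^sup>2" using K1 by (intro mult_right_mono) auto
    with neg[of x] False show ?thesis by linarith
  qed
  have "(min y a)\<^sup>2 \<le> y\<^sup>2"
    using a by (auto simp: min_def power2_eq_square intro!: mult_mono)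
  then have "l\<^sup>2 * (min y a)\<^sup>2 \<le> l\<^sup>2 * y\<^sup>2" by (rule mult_left_mono) simp
  then have "x\<^sup>2 \<le> l\<^sup>2 * y\<^sup>2" unfolding x_def by (simp add: power_mult_distrib)
  then have "K / 2 * x\<^sup>2 \<le> K / 2 * (l\<^sup>2 * y\<^sup>2)" using K1 by (intro mult_left_mono) auto
  with xK xy show ?thesis unfolding x_def by (simp add: algebra_simps)
qed

section \<open>An exponential maximal inequality for martingale differences\<close>

lemma (in prob_space) maximal_inequality:
  fixes W :: "nat \<Rightarrow> 'a \<Rightarrow> real"
  assumes G: "\<And>n. subalgebra M (G n)" and G_mono: "\<And>n. sets (G n) \<subseteq> sets (G (Suc n))"
    and W: "\<And>n. W n \<in> borel_measurable (G n)" "\<And>n. integrable M (W n)" "\<And>n \<omega>. 0 \<le> W n \<omega>"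
    and super: "\<And>n C. C \<in> sets (G n) \<Longrightarrow> (\<integral>\<omega>. W (Suc n) \<omega> * indicator C \<omega> \<partial>M) \<le> (\<integral>\<omega>. W n \<omega> * indicator C \<omega> \<partial>M)"
  shows "c * prob {\<omega> \<in> space M. \<exists>n\<le>N. c \<le> W n \<omega>} \<le> (\<integral>\<omega>. W 0 \<omega> \<partial>M)"
proof -
  define B where "B n = {\<omega> \<in> space M. \<exists>j\<le>n. c \<le> W j \<omega>}" for n
  have spG: "space (G n) = space M" for n using G[of n] by (simp add: subalgebra_def)
  have G_mono': "sets (G j) \<subseteq> sets (G n)" if "j \<le> n" for j n
    using G_mono that by (rule lift_Suc_mono_le)
  have Wm: "W j \<in> borel_measurable (G n)" if "j \<le> n" for j n
    using measurable_from_subalg[OF _ W(1)[of j], of "G n"] G_mono'[OF that] spG by (auto simp: subalgebra_def)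
  have BG: "B n \<in> sets (G n)" for n
  proof -
    have "B n = (\<Union>j\<in>{..n}. {\<omega> \<in> space (G n). c \<le> W j \<omega>})" unfolding B_def spG by auto
    also have "\<dots> \<in> sets (G n)"
      using Wm by (intro sets.finite_UN) (auto intro!: borel_measurable_le)
    finally show ?thesis .
  qed
  have GM: "A \<in> sets M" if "A \<in> sets (G n)" for A n using G[of n] that by (auto simp: subalgebra_def)
  have BM[measurable]: "B n \<in> sets M" for n using BG GM by blast
  have Bc: "space M - B n \<in> sets (G n)" for n using BG[of n] spG[of n] by (metis sets.compl_sets)
  have int: "integrable M (\<lambda>\<omega>. W j \<omega> * indicator A \<omega>)" if "A \<in> sets M" for j A
    using W(2)[of j] that by (rule integrable_real_mult_indicator[rotated])
  \<comment> \<open>Stopping \<open>W\<close> when it first reaches \<open>c\<close> keeps the mean below the initial one.\<close>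
  have "c * prob (B n) + (\<integral>\<omega>. W n \<omega> * indicator (space M - B n) \<omega> \<partial>M) \<le> (\<integral>\<omega>. W 0 \<omega> \<partial>M)" for n
  proof (induction n)
    case 0
    have "c * prob (B 0) = (\<integral>\<omega>. c * indicator (B 0) \<omega> \<partial>M)" by simp
    also have "\<dots> \<le> (\<integral>\<omega>. W 0 \<omega> * indicator (B 0) \<omega> \<partial>M)"
    proof (rule integral_mono)
      show "integrable M (\<lambda>\<omega>. c * indicator (B 0) \<omega>)"
        by (intro integrable_mult_right integrable_real_indicator BM) (simp add: less_top[symmetric])
    qed (rule int[OF BM], auto simp: B_def indicator_def)
    finally have "c * prob (B 0) + (\<integral>\<omega>. W 0 \<omega> * indicator (space M - B 0) \<omega> \<partial>M)
       \<le> (\<integral>\<omega>. W 0 \<omega> * indicator (B 0) \<omega> \<partial>M) + (\<integral>\<omega>. W 0 \<omega> * indicator (space M - B 0) \<omega> \<partial>M)" by simp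
    also have "\<dots> = (\<integral>\<omega>. W 0 \<omega> * indicator (B 0) \<omega> + W 0 \<omega> * indicator (space M - B 0) \<omega> \<partial>M)"
      by (intro Bochner_Integration.integral_add[symmetric] int) auto
    also have "\<dots> = (\<integral>\<omega>. W 0 \<omega> \<partial>M)"
      by (intro Bochner_Integration.integral_cong) (auto simp: indicator_def)
    finally show ?case .
  next
    case (Suc n)
    let ?D = "B (Suc n) - B n"
    have sub: "B n \<subseteq> B (Suc n)" unfolding B_def using le_SucI by blast
    have D: "?D \<subseteq> {\<omega> \<in> space M. c \<le> W (Suc n) \<omega>}"
      unfolding B_def by (auto simp: le_Suc_eq)
    have "prob (B (Suc n)) = prob (B n) + prob ?D"
      using finite_measure_Diff[of "B (Suc n)" "B n"] sub by simp
    moreover have "c * prob ?D \<le> (\<integral>\<omega>. W (Suc n) \<omega> * indicator ?D \<omega> \<partial>M)"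
    proof -
      have "c * prob ?D = (\<integral>\<omega>. c * indicator ?D \<omega> \<partial>M)" by simp
      also have "\<dots> \<le> (\<integral>\<omega>. W (Suc n) \<omega> * indicator ?D \<omega> \<partial>M)"
      proof (rule integral_mono)
        show "integrable M (\<lambda>\<omega>. c * indicator ?D \<omega>)"
          by (intro integrable_mult_right integrable_real_indicator sets.Diff BM) (simp add: less_top[symmetric])
      qed (rule int[OF sets.Diff[OF BM BM]], use D in \<open>auto simp: indicator_def\<close>)
      finally show ?thesis .
    qed
    moreover have "(\<integral>\<omega>. W (Suc n) \<omega> * indicator ?D \<omega> \<partial>M) + (\<integral>\<omega>. W (Suc n) \<omega> * indicator (space M - B (Suc n)) \<omega> \<partial>M)
       = (\<integral>\<omega>. W (Suc n) \<omega> * indicator ?D \<omega> + W (Suc n) \<omega> * indicator (space M - B (Suc n)) \<omega> \<partial>M)"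
      by (intro Bochner_Integration.integral_add[symmetric] int) auto
    moreover have "\<dots> = (\<integral>\<omega>. W (Suc n) \<omega> * indicator (space M - B n) \<omega> \<partial>M)"
      using sub by (intro Bochner_Integration.integral_cong) (auto simp: indicator_def)
    moreover have "\<dots> \<le> (\<integral>\<omega>. W n \<omega> * indicator (space M - B n) \<omega> \<partial>M)" by (rule super[OF Bc])
    ultimately show ?case using Suc by (simp add: distrib_left)
  qed
  moreover have "0 \<le> (\<integral>\<omega>. W N \<omega> * indicator (space M - B N) \<omega> \<partial>M)"
    by (intro integral_nonneg_AE AE_I2) (simp add: W(3))
  ultimately have "c * prob (B N) \<le> (\<integral>\<omega>. W 0 \<omega> \<partial>M)" by (meson add_increasing2 dual_order.refl order_trans add_le_cancel_left le_add_same_cancel1)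
  then show ?thesis unfolding B_def .
qed

text \<open>The index is chosen so that \<open>G n\<close> is the information available before \<open>Y n\<close> is observed.\<close>

locale mart_diff = prob_space +
  fixes G :: "nat \<Rightarrow> 'a measure" and Y :: "nat \<Rightarrow> 'a \<Rightarrow> real"
  assumes subalg: "\<And>n. subalgebra M (G n)"
    and incr: "\<And>n. sets (G n) \<subseteq> sets (G (Suc n))"
    and adapted: "\<And>n. Y n \<in> borel_measurable (G (Suc n))"
    and square_integrable: "\<And>n. integrable M (\<lambda>\<omega>. (Y n \<omega>)\<^sup>2)"
    and mean_zero: "\<And>n. AE \<omega> in M. real_cond_exp M (G n) (Y n) \<omega> = 0"
begin

definition cond_var :: "nat \<Rightarrow> 'a \<Rightarrow> real"
  where "cond_var n = real_cond_exp M (G n) (\<lambda>\<omega>. (Y n \<omega>)\<^sup>2)"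

lemma space_G: "space (G n) = space M" using subalg[of n] by (simp add: subalgebra_def)

lemma incr_le: "j \<le> n \<Longrightarrow> sets (G j) \<subseteq> sets (G n)"
  using incr by (rule lift_Suc_mono_le)

lemma measurable_G_mono: "j \<le> n \<Longrightarrow> f \<in> borel_measurable (G j) \<Longrightarrow> f \<in> borel_measurable (G n)"
  by (rule measurable_from_subalg[of "G n" "G j"]) (use incr_le in \<open>auto simp: subalgebra_def space_G\<close>)

lemma measurable_G: "f \<in> borel_measurable (G j) \<Longrightarrow> f \<in> borel_measurable M"
  by (rule measurable_from_subalg[OF subalg])

lemma sigma_finite_subalgebra_G: "sigma_finite_subalgebra M (G n)"
  by (rule finite_measure_subalgebra_is_sigma_finite, unfold_locales) (rule subalg)

lemma Y_measurable[measurable]: "Y n \<in> borel_measurable M"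
  using adapted by (rule measurable_G)

lemma Y_integrable: "integrable M (Y n)"
  using square_integrable_imp_integrable[OF Y_measurable square_integrable] .

lemma cond_var_measurable[measurable]: "cond_var n \<in> borel_measurable M" "cond_var n \<in> borel_measurable (G n)"
  unfolding cond_var_def by simp_all

lemma cond_var_nonneg: "AE \<omega> in M. 0 \<le> cond_var n \<omega>"
  unfolding cond_var_def by (rule sigma_finite_subalgebra.real_cond_exp_pos[OF sigma_finite_subalgebra_G]) auto

text \<open>Cutting off only the large positive values makes the conditional means nonpositive, so the
exponentials form a supermartingale without recentering, and the maximal inequality applies to them.
The compensator involves the conditional variances of the original variables.\<close>

lemma truncated_exponential_bound:
  assumes l: "0 \<le> l" and a: "\<And>i. 0 \<le> a i" and K: "\<And>i. i < N \<Longrightarrow> exp (l * a i) \<le> K"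
  shows "prob {\<omega> \<in> space M. \<exists>n\<le>N. c \<le> l * (\<Sum>i<n. min (Y i \<omega>) (a i)) - l\<^sup>2 * K / 2 * (\<Sum>i<n. cond_var i \<omega>)}
    \<le> exp (- c)"
proof -
  \<comment> \<open>Setting the levels to \<open>0\<close> from \<open>N\<close> on and raising \<open>K\<close> to at least \<open>1\<close> makes the bound hold at every index.\<close>
  define K' where "K' = max 1 K"
  define b where "b i = (if i < N then a i else 0)" for i
  have b: "0 \<le> b i" "exp (l * b i) \<le> K'" for i
    using a[of i] K[of i] unfolding b_def K'_def by auto
  define t where "t = l\<^sup>2 * K' / 2"
  have t0: "0 \<le> t" unfolding t_def K'_def by simp
  define W where "W n \<omega> = exp (l * (\<Sum>i<n. min (Y i \<omega>) (b i)) - t * (\<Sum>i<n. cond_var i \<omega>))" for n \<omega>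
  have W_G: "W n \<in> borel_measurable (G n)" for n
  proof -
    have 1: "Y i \<in> borel_measurable (G n)" if "i < n" for i
      using measurable_G_mono[OF _ adapted[of i], of n] that by auto
    have 2: "cond_var i \<in> borel_measurable (G n)" if "i < n" for i
      using measurable_G_mono[OF _ cond_var_measurable(2)[of i], of n] that by auto
    have "(\<lambda>\<omega>. \<Sum>i<n. min (Y i \<omega>) (b i)) \<in> borel_measurable (G n)"
      using 1 by (intro borel_measurable_sum borel_measurable_min) auto
    moreover have "(\<lambda>\<omega>. \<Sum>i<n. cond_var i \<omega>) \<in> borel_measurable (G n)"
      using 2 by (intro borel_measurable_sum) auto
    ultimately show ?thesis unfolding W_def[abs_def] by measurable
  qed
  have W_M[measurable]: "W n \<in> borel_measurable M" for n using W_G by (rule measurable_G)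
  have cv: "AE \<omega> in M. \<forall>i. 0 \<le> cond_var i \<omega>" using cond_var_nonneg by (simp add: AE_all_countable)
  have W_bd: "AE \<omega> in M. norm (W n \<omega>) \<le> exp (l * (\<Sum>i<n. b i))" for n
    using cv
  proof eventually_elim
    case (elim \<omega>)
    have "l * (\<Sum>i<n. min (Y i \<omega>) (b i)) \<le> l * (\<Sum>i<n. b i)"
      using l by (intro mult_left_mono sum_mono) auto
    moreover have "0 \<le> t * (\<Sum>i<n. cond_var i \<omega>)" using elim t0 by (intro mult_nonneg_nonneg sum_nonneg) auto
    ultimately show ?case unfolding W_def by simp
  qed
  have W_int: "integrable M (W n)" for n by (rule integrable_const_bound[OF W_bd]) simp
  have super: "(\<integral>\<omega>. W (Suc n) \<omega> * indicator C \<omega> \<partial>M) \<le> (\<integral>\<omega>. W n \<omega> * indicator C \<omega> \<partial>M)"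
    if C: "C \<in> sets (G n)" for n C
  proof -
    have CM[measurable]: "C \<in> sets M" using C subalg[of n] by (auto simp: subalgebra_def)
    interpret sigma_finite_subalgebra M "G n" by (rule sigma_finite_subalgebra_G)
    \<comment> \<open>\<open>H\<close> collects what is known before \<open>Y n\<close>, and \<open>E\<close> is the new factor.\<close>
    define E where "E \<omega> = exp (l * min (Y n \<omega>) (b n))" for \<omega>
    define H where "H \<omega> = W n \<omega> * exp (- t * cond_var n \<omega>) * indicator C \<omega>" for \<omega>
    have E_M[measurable]: "E \<in> borel_measurable M" unfolding E_def[abs_def] by measurable
    have H_G: "H \<in> borel_measurable (G n)"
      unfolding H_def[abs_def] using W_G[of n] C cond_var_measurable(2)[of n] by measurable
    have H_M[measurable]: "H \<in> borel_measurable M" using H_G by (rule measurable_G)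
    have H0: "0 \<le> H \<omega>" for \<omega> unfolding H_def W_def by simp
    have E_int: "integrable M E"
      using l by (intro integrable_const_bound[where B="exp (l * b n)"] AE_I2) (auto simp: E_def intro!: mult_left_mono)
    have eq: "W (Suc n) \<omega> * indicator C \<omega> = H \<omega> * E \<omega>" for \<omega>
      unfolding W_def H_def E_def by (simp add: exp_add[symmetric] exp_diff[symmetric] algebra_simps)
    have HE_int: "integrable M (\<lambda>\<omega>. H \<omega> * E \<omega>)"
      unfolding eq[symmetric] by (rule integrable_real_mult_indicator[OF CM W_int])
    have le: "AE \<omega> in M. real_cond_exp M (G n) E \<omega> \<le> exp (t * cond_var n \<omega>)"
    proof -
      let ?f = "\<lambda>\<omega>. 1 + l * Y n \<omega>" and ?q = "\<lambda>\<omega>. t * (Y n \<omega>)\<^sup>2"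
      have i1: "integrable M (\<lambda>\<omega>. l * Y n \<omega>)" "integrable M (\<lambda>\<omega>. 1::real)" using Y_integrable by auto
      then have i2: "integrable M ?f" by auto
      have i3: "integrable M ?q" using square_integrable by auto
      have "AE \<omega> in M. real_cond_exp M (G n) E \<omega> \<le> real_cond_exp M (G n) (\<lambda>\<omega>. ?f \<omega> + ?q \<omega>) \<omega>"
      proof (rule real_cond_exp_mono[OF AE_I2 E_int])
        show "E \<omega> \<le> ?f \<omega> + ?q \<omega>" for \<omega>
          unfolding E_def t_def by (rule exp_min_le[OF l b])
      qed (use i2 i3 in auto)
      moreover note real_cond_exp_add[OF i2 i3]
      moreover note real_cond_exp_add[OF i1(2,1)]
      moreover note real_cond_exp_cmult[OF Y_integrable[of n], of l]
      moreover note real_cond_exp_cmult[OF square_integrable[of n], of t]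
      moreover note mean_zero[of n]
      moreover have "AE \<omega> in M. real_cond_exp M (G n) (\<lambda>\<omega>. 1::real) \<omega> = 1"
        by (rule real_cond_exp_F_meas) auto
      ultimately show ?thesis
      proof eventually_elim
        case (elim \<omega>)
        then have "real_cond_exp M (G n) E \<omega> \<le> 1 + t * cond_var n \<omega>" by (simp add: cond_var_def)
        also have "\<dots> \<le> exp (t * cond_var n \<omega>)" by (rule exp_ge_add_one_self)
        finally show ?case .
      qed
    qed
    have "(\<integral>\<omega>. W (Suc n) \<omega> * indicator C \<omega> \<partial>M) = (\<integral>\<omega>. H \<omega> * real_cond_exp M (G n) E \<omega> \<partial>M)"
      unfolding eq by (rule real_cond_exp_intg(2)[OF HE_int H_G E_M, symmetric])
    also have "\<dots> \<le> (\<integral>\<omega>. W n \<omega> * indicator C \<omega> \<partial>M)"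
    proof (rule integral_mono_AE)
      show "integrable M (\<lambda>\<omega>. H \<omega> * real_cond_exp M (G n) E \<omega>)"
        by (rule real_cond_exp_intg(1)[OF HE_int H_G E_M])
      show "integrable M (\<lambda>\<omega>. W n \<omega> * indicator C \<omega>)"
        by (rule integrable_real_mult_indicator[OF CM W_int])
      show "AE \<omega> in M. H \<omega> * real_cond_exp M (G n) E \<omega> \<le> W n \<omega> * indicator C \<omega>"
        using le
      proof eventually_elim
        case (elim \<omega>)
        have "H \<omega> * real_cond_exp M (G n) E \<omega> \<le> H \<omega> * exp (t * cond_var n \<omega>)"
          using elim H0 by (rule mult_left_mono)
        also have "\<dots> = W n \<omega> * indicator C \<omega>" unfolding H_def by (simp add: exp_minus field_simps)
        finally show ?case .
      qed
    qed
    finally show ?thesis .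
  qed
  have "exp c * prob {\<omega> \<in> space M. \<exists>n\<le>N. exp c \<le> W n \<omega>} \<le> (\<integral>\<omega>. W 0 \<omega> \<partial>M)"
    by (rule maximal_inequality[of G, OF subalg incr W_G W_int _ super]) (auto simp: W_def)
  also have "\<dots> = 1" unfolding W_def by (simp add: prob_space)
  finally have 1: "prob {\<omega> \<in> space M. \<exists>n\<le>N. exp c \<le> W n \<omega>} \<le> exp (- c)"
    by (simp add: exp_minus field_simps)
  show ?thesis
  proof (cases "N = 0")
    case True
    show ?thesis
    proof (cases "c \<le> 0")
      case True
      then have "1 \<le> exp (- c)" by simp
      then show ?thesis by (meson order_trans prob_le_1)
    qed (use True in simp)
  next
    case False
    then have K1: "1 \<le> K"
      using K[of 0] a[of 0] l one_le_exp_iff[of "l * a 0"] mult_nonneg_nonneg[of l "a 0"]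
      by linarith
    then have "K' = K" unfolding K'_def by simp
    have "c \<le> l * (\<Sum>i<n. min (Y i \<omega>) (a i)) - l\<^sup>2 * K / 2 * (\<Sum>i<n. cond_var i \<omega>) \<longleftrightarrow> exp c \<le> W n \<omega>"
      if "n \<le> N" for n \<omega>
    proof -
      have "(\<Sum>i<n. min (Y i \<omega>) (a i)) = (\<Sum>i<n. min (Y i \<omega>) (b i))"
        using that by (intro sum.cong) (auto simp: b_def)
      then show ?thesis unfolding W_def t_def \<open>K' = K\<close> by simp
    qed
    then have "{\<omega> \<in> space M. \<exists>n\<le>N. c \<le> l * (\<Sum>i<n. min (Y i \<omega>) (a i)) - l\<^sup>2 * K / 2 * (\<Sum>i<n. cond_var i \<omega>)}
      = {\<omega> \<in> space M. \<exists>n\<le>N. exp c \<le> W n \<omega>}" by auto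
    with 1 show ?thesis by simp
  qed
qed

end

section \<open>The upper half of the law of the iterated logarithm\<close>

lemma ex_power_interval:
  fixes r x :: real
  assumes r: "1 < r" and x: "r ^ k0 \<le> x"
  shows "\<exists>k\<ge>k0. r ^ k \<le> x \<and> x < r ^ Suc k"
proof -
  obtain m where "x < r ^ m" using real_arch_pow[OF r] by blast
  define n where "n = (LEAST m. x < r ^ m)"
  have n: "x < r ^ n" unfolding n_def by (rule LeastI) fact
  have "n \<noteq> 0" using n order_trans[OF one_le_power[of r k0] x] r by (intro notI) auto
  then obtain k where k: "n = Suc k" by (cases n) auto
  have "\<not> x < r ^ k" using not_less_Least[of k "\<lambda>m. x < r ^ m"] k unfolding n_def by auto
  then have "r ^ k \<le> x" by simp
  moreover have "k0 \<le> k"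
  proof (rule ccontr)
    assume "\<not> k0 \<le> k"
    then have "r ^ n \<le> r ^ k0" using r k by (intro power_increasing) auto
    with n x show False by simp
  qed
  ultimately show ?thesis using n k by auto
qed

text \<open>By identical distribution the excesses of \<open>Z n\<close> over its level have the same mean as those of \<open>Z 0\<close>, so
the expected sum of the normalized excesses is at most a multiple of the second moment of \<open>Z 0\<close>.
The series therefore converges almost surely, and Kronecker's lemma turns this into the claim.\<close>

lemma (in prob_space) excess_negligible:
  assumes Z[measurable]: "\<And>n. Z n \<in> borel_measurable M"
    and distr: "\<And>n. distr M borel (Z n) = distr M borel (Z 0)"
    and sq: "integrable M (\<lambda>\<omega>. (Z 0 \<omega>)\<^sup>2)" and e: "0 < (e::real)"
  shows "AE \<omega> in M. (\<lambda>n. (\<Sum>i<n. max 0 (Z i \<omega> - e * trunc_level (real i + 28))) / lil_scale (real n + 28)) \<longlonglongrightarrow> 0"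
proof -
  define t where "t n y = max 0 (y - e * trunc_level (real n + 28)) / lil_scale (real n + 28)" for n y
  have pos: "0 < lil_scale (real n + 28)" for n by (rule lil_scale_pos) simp
  have t0: "0 \<le> t n y" for n y unfolding t_def using pos[of n] by simp
  have t_meas[measurable]: "t n \<in> borel_measurable borel" for n unfolding t_def[abs_def] by measurable
  have swap: "(\<integral>\<^sup>+\<omega>. ennreal (t n (Z n \<omega>)) \<partial>M) = (\<integral>\<^sup>+\<omega>. ennreal (t n (Z 0 \<omega>)) \<partial>M)" for n
  proof -
    have "(\<integral>\<^sup>+\<omega>. ennreal (t n (Z n \<omega>)) \<partial>M) = (\<integral>\<^sup>+y. ennreal (t n y) \<partial>distr M borel (Z n))"
      by (rule nn_integral_distr[symmetric]) auto
    also have "\<dots> = (\<integral>\<^sup>+y. ennreal (t n y) \<partial>distr M borel (Z 0))" by (simp only: distr[of n])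
    also have "\<dots> = (\<integral>\<^sup>+\<omega>. ennreal (t n (Z 0 \<omega>)) \<partial>M)" by (rule nn_integral_distr) auto
    finally show ?thesis .
  qed
  have "(\<integral>\<^sup>+\<omega>. (\<Sum>n. ennreal (t n (Z n \<omega>))) \<partial>M) = (\<Sum>n. \<integral>\<^sup>+\<omega>. ennreal (t n (Z n \<omega>)) \<partial>M)"
    by (rule nn_integral_suminf) auto
  also have "\<dots> = (\<Sum>n. \<integral>\<^sup>+\<omega>. ennreal (t n (Z 0 \<omega>)) \<partial>M)" by (simp only: swap)
  also have "\<dots> = (\<integral>\<^sup>+\<omega>. (\<Sum>n. ennreal (t n (Z 0 \<omega>))) \<partial>M)"
    by (rule nn_integral_suminf[symmetric]) auto
  also have "\<dots> \<le> (\<integral>\<^sup>+\<omega>. ennreal (4 * (Z 0 \<omega>)\<^sup>2 / e) \<partial>M)"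
  proof (intro nn_integral_mono suminf_le_const)
    fix \<omega> n
    have "(\<Sum>i<n. t i (Z 0 \<omega>)) \<le> (\<Sum>i<n. t i \<bar>Z 0 \<omega>\<bar>)"
      unfolding t_def using pos by (intro sum_mono divide_right_mono) (auto intro: less_imp_le)
    also have "\<dots> \<le> 4 * (Z 0 \<omega>)\<^sup>2 / e"
      using sum_excess_le[of "\<bar>Z 0 \<omega>\<bar>" e n] e unfolding t_def by simp
    finally show "(\<Sum>i<n. ennreal (t i (Z 0 \<omega>))) \<le> ennreal (4 * (Z 0 \<omega>)\<^sup>2 / e)"
      using t0 by (simp add: sum_ennreal ennreal_leI)
  qed auto
  also have "\<dots> < \<infinity>"
  proof -
    have "integrable M (\<lambda>\<omega>. 4 * (Z 0 \<omega>)\<^sup>2 / e)" using sq by auto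
    then show ?thesis using e by (simp add: nn_integral_eq_integral)
  qed
  finally have fin: "(\<integral>\<^sup>+\<omega>. (\<Sum>n. ennreal (t n (Z n \<omega>))) \<partial>M) \<noteq> \<infinity>" by simp
  have "AE \<omega> in M. (\<Sum>n. ennreal (t n (Z n \<omega>))) \<noteq> \<infinity>"
    by (rule nn_integral_PInf_AE[OF _ fin]) measurable
  then show ?thesis
  proof eventually_elim
    case (elim \<omega>)
    then have "summable (\<lambda>n. t n (Z n \<omega>))"
      using t0 by (intro summable_suminf_not_top) auto
    then show ?case unfolding t_def
    proof (rule kronecker_nonneg[rotated -1])
      show "incseq (\<lambda>n. lil_scale (real n + 28))"
        by (auto simp: incseq_def intro!: lil_scale_mono)
      show "filterlim (\<lambda>n. lil_scale (real n + 28)) at_top sequentially"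
        unfolding lil_scale_def by real_asymp
    qed (use pos in auto)
  qed
qed

context mart_diff
begin

text \<open>On the block of times between \<open>r ^ k\<close> and \<open>r ^ Suc k\<close>, the exponential bound with the parameter
\<open>sqrt (2 * ln (ln (r ^ k)) / r ^ k) / s\<close> gives a probability of order \<open>k powr - (1 + \<eta>)\<close> to an
exceedance, which is summable.  The ratio \<open>r = 1 + \<eta> / 4\<close> and the truncation constant \<open>e\<close> are chosen so
that the blocks and the truncation each cost a factor of at most \<open>r\<close>, and \<open>r * r \<le> 1 + \<eta>\<close>.\<close>

lemma truncated_sums_upper:
  assumes s: "0 < s" and eta: "0 < \<eta>" "\<eta> \<le> 1" and e: "e = s * ln (1 + \<eta> / 4) / 3"
  shows "AE \<omega> in M. (\<forall>\<^sub>F n in sequentially. (\<Sum>i<n. cond_var i \<omega>) \<le> s\<^sup>2 * real n) \<longrightarrow>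
    (\<forall>\<^sub>F n in sequentially. (\<Sum>i<n. min (Y i \<omega>) (e * trunc_level (real i + 28))) \<le> (1 + \<eta>) * s * lil_scale (real n))"
proof -
  define r where "r = 1 + \<eta> / 4"
  have r: "1 < r" "r \<le> 2" using eta unfolding r_def by auto
  have rr: "r * r \<le> 1 + \<eta>"
  proof -
    have "\<eta> * \<eta> \<le> \<eta>" using eta mult_left_mono[of \<eta> 1 \<eta>] by simp
    moreover have "r * r = 1 + \<eta> / 2 + \<eta> * \<eta> / 16" unfolding r_def by (simp add: field_simps)
    ultimately show ?thesis using eta by linarith
  qed
  have e0: "0 < e" unfolding e using s eta by simp
  define x where "x k = r ^ k" for k
  define L where "L k = ln (ln (x k))" for k
  define l where "l k = sqrt (2 * L k / x k) / s" for k
  define N where "N k = nat \<lfloor>r * x k\<rfloor>" for k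
  define a where "a i = e * trunc_level (real i + 28)" for i :: nat
  have a0: "0 \<le> a i" for i
    unfolding a_def trunc_level_def using e0 ln_ln_ge_1[of "real i + 28"] by simp
  define U where "U n \<omega> = (\<Sum>i<n. min (Y i \<omega>) (a i))" for n \<omega>
  define Q where "Q n \<omega> = (\<Sum>i<n. cond_var i \<omega>)" for n \<omega>
  define E where "E k = {\<omega> \<in> space M. \<exists>n\<le>N k. (1 + \<eta>) * L k \<le> l k * U n \<omega> - (l k)\<^sup>2 * r / 2 * Q n \<omega>}" for k
  have [measurable]: "U n \<in> borel_measurable M" "Q n \<in> borel_measurable M" for n
    unfolding U_def[abs_def] Q_def[abs_def] by measurable
  have [measurable]: "E k \<in> sets M" for k unfolding E_def by measurable
  have "filterlim x at_top sequentially"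
    unfolding x_def[abs_def] using r(1) by real_asymp
  then have ev: "\<forall>\<^sub>F k in sequentially. 28 \<le> x k" by (simp add: filterlim_at_top)
  have PE: "prob (E k) \<le> exp (- ((1 + \<eta>) * L k))" if xk: "28 \<le> x k" for k
    unfolding E_def U_def Q_def
  proof (rule truncated_exponential_bound[OF _ a0])
    have Lk: "1 \<le> L k" unfolding L_def using ln_ln_ge_1[of "x k"] xk by simp
    show l0: "0 \<le> l k" unfolding l_def using s Lk xk by simp
    fix i assume i: "i < N k"
    have "real i \<le> r * x k" using i xk r unfolding N_def by linarith
    then have "trunc_level (real i + 28) \<le> trunc_level (r * x k + 28)"
      by (intro trunc_level_mono) auto
    also have "\<dots> \<le> sqrt (4 * x k / L k)"
    proof -
      have "x k \<le> r * x k + 28" using r xk mult_right_mono[of 1 r "x k"] by linarith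
      then have LL: "L k \<le> ln (ln (r * x k + 28))" unfolding L_def using xk by (intro ln_ln_mono) auto
      have "r * x k + 28 \<le> 4 * x k"
      proof -
        have "r * x k \<le> 2 * x k" using r xk by (intro mult_right_mono) auto
        then show ?thesis using xk by linarith
      qed
      then show ?thesis
        unfolding trunc_level_def using LL Lk xk r
        by (intro real_sqrt_le_mono frac_le) auto
    qed
    finally have "l k * a i \<le> l k * (e * sqrt (4 * x k / L k))"
      unfolding a_def using e0 l0 by (intro mult_left_mono) auto
    also have "\<dots> = e / s * (sqrt (2 * L k / x k) * sqrt (4 * x k / L k))"
      unfolding l_def by simp
    also have "sqrt (2 * L k / x k) * sqrt (4 * x k / L k) = sqrt 8"
      unfolding real_sqrt_mult[symmetric] using Lk xk by simp
    also have "e / s * sqrt 8 \<le> e / s * 3"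
      using e0 s by (intro mult_left_mono real_le_lsqrt) auto
    also have "\<dots> = ln r" unfolding e r_def using s by simp
    finally have "exp (l k * a i) \<le> exp (ln r)" by simp
    then show "exp (l k * a i) \<le> r" using r by simp
  qed
  have summ: "summable (\<lambda>k. prob (E k))"
  proof (rule summable_comparison_test_ev)
    show "\<forall>\<^sub>F k in sequentially. norm (prob (E k)) \<le> ln r powr (- (1 + \<eta>)) * real k powr (- (1 + \<eta>))"
      using ev eventually_gt_at_top[of 0]
    proof eventually_elim
      case (elim k)
      have "ln (x k) = real k * ln r" unfolding x_def using r by (simp add: ln_realpow)
      moreover have "0 < ln (x k)" using elim by simp
      ultimately have "exp (- ((1 + \<eta>) * L k)) = (real k * ln r) powr (- (1 + \<eta>))"
        unfolding L_def powr_def using elim r by (simp add: algebra_simps)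
      also have "\<dots> = ln r powr (- (1 + \<eta>)) * real k powr (- (1 + \<eta>))"
        using r by (simp add: powr_mult)
      finally show ?case using PE[of k] elim by simp
    qed
    show "summable (\<lambda>k. ln r powr (- (1 + \<eta>)) * real k powr (- (1 + \<eta>)))"
      using eta by (intro summable_mult) (simp add: summable_real_powr_iff)
  qed
  have "AE \<omega> in M. \<forall>\<^sub>F k in sequentially. \<omega> \<in> space M - E k"
    by (rule borel_cantelli_AE1) (use summ in \<open>auto simp: less_top[symmetric]\<close>)
  then show ?thesis
  proof eventually_elim
    case (elim \<omega>)
    show ?case
    proof
      assume "\<forall>\<^sub>F n in sequentially. (\<Sum>i<n. cond_var i \<omega>) \<le> s\<^sup>2 * real n"
      then obtain n0 where n0: "\<And>n. n0 \<le> n \<Longrightarrow> Q n \<omega> \<le> s\<^sup>2 * real n"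
        unfolding Q_def by (auto simp: eventually_sequentially)
      obtain k0 where k0: "\<And>k. k0 \<le> k \<Longrightarrow> \<omega> \<in> space M - E k" "\<And>k. k0 \<le> k \<Longrightarrow> 28 \<le> x k"
        using eventually_conj[OF elim ev] unfolding eventually_sequentially by auto
      have "\<forall>\<^sub>F n in sequentially. x k0 \<le> real n \<and> n0 \<le> n"
        using filterlim_real_sequentially eventually_ge_at_top[of n0]
        unfolding filterlim_at_top by (intro eventually_conj) auto
      then show "\<forall>\<^sub>F n in sequentially. (\<Sum>i<n. min (Y i \<omega>) (e * trunc_level (real i + 28))) \<le> (1 + \<eta>) * s * lil_scale (real n)"
      proof eventually_elim
        case (elim n)
        then obtain k where k: "k0 \<le> k" "x k \<le> real n" "real n < r * x k"
          using ex_power_interval[OF r(1), of k0 "real n"] unfolding x_def by auto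
        have xk: "28 \<le> x k" using k0(2)[OF k(1)] .
        have Lk: "1 \<le> L k" unfolding L_def using ln_ln_ge_1[of "x k"] xk by simp
        have l0: "0 < l k" unfolding l_def using s Lk xk by simp
        have "n \<le> N k" unfolding N_def using k(3) by linarith
        then have "l k * U n \<omega> < (1 + \<eta>) * L k + (l k)\<^sup>2 * r / 2 * Q n \<omega>"
          using k0(1)[OF k(1)] unfolding E_def by force
        also have "(l k)\<^sup>2 * r / 2 * Q n \<omega> \<le> (l k)\<^sup>2 * r / 2 * (s\<^sup>2 * (r * x k))"
        proof (rule mult_left_mono)
          have "Q n \<omega> \<le> s\<^sup>2 * real n" using n0 elim by simp
          also have "\<dots> \<le> s\<^sup>2 * (r * x k)" using k by (intro mult_left_mono) auto
          finally show "Q n \<omega> \<le> s\<^sup>2 * (r * x k)" .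
        qed (use r in auto)
        also have "(l k)\<^sup>2 * r / 2 * (s\<^sup>2 * (r * x k)) = (r * r) * L k"
          unfolding l_def using s Lk xk by (simp add: power_divide field_simps)
        also have "(r * r) * L k \<le> (1 + \<eta>) * L k" using rr Lk by (intro mult_right_mono) auto
        finally have lU: "l k * U n \<omega> < 2 * (1 + \<eta>) * L k" by (simp add: algebra_simps)
        have "2 * L k / l k = s * lil_scale (x k)"
        proof -
          define q where "q = sqrt (2 * L k / x k)"
          have q: "0 < q" "x k * q * q = 2 * L k" unfolding q_def using Lk xk by (auto simp: mult.assoc)
          have "sqrt (2 * x k * L k) = sqrt ((x k)\<^sup>2 * (2 * L k / x k))"
            using xk by (simp add: power2_eq_square field_simps)
          also have "\<dots> = x k * q"
            unfolding real_sqrt_mult q_def using xk by simp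
          finally have "lil_scale (x k) = x k * q" unfolding lil_scale_def L_def .
          then show ?thesis unfolding l_def q_def[symmetric] q(2)[symmetric] using s q(1) by simp
        qed
        then have "U n \<omega> < (1 + \<eta>) * (s * lil_scale (x k))"
        proof -
          assume eq: "2 * L k / l k = s * lil_scale (x k)"
          have "U n \<omega> < 2 * (1 + \<eta>) * L k / l k"
            using lU l0 by (simp add: pos_less_divide_eq mult.commute)
          also have "\<dots> = (1 + \<eta>) * (2 * L k / l k)" by simp
          finally show ?thesis unfolding eq .
        qed
        also have "\<dots> \<le> (1 + \<eta>) * (s * lil_scale (real n))"
          using eta s k xk by (intro mult_left_mono lil_scale_mono) auto
        finally show ?case unfolding U_def a_def by (simp add: mult.assoc)
      qed
    qed
  qed
qed

text \<open>The truncated sums obey the bound for every constant above \<open>\<sigma>\<close>, and what the truncation removes is of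
smaller order than the scale.\<close>

proposition LIL_upper:
  assumes distr: "\<And>n. distr M borel (Y n) = distr M borel (Y 0)"
    and s: "0 \<le> \<sigma>" "\<sigma> < c"
    and Q: "\<And>v. \<sigma>\<^sup>2 < v \<Longrightarrow> AE \<omega> in M. \<forall>\<^sub>F n in sequentially. (\<Sum>i<n. cond_var i \<omega>) \<le> v * real n"
  shows "AE \<omega> in M. \<forall>\<^sub>F n in sequentially. (\<Sum>i<n. Y i \<omega>) \<le> c * lil_scale (real n)"
proof -
  define s where "s = (\<sigma> + c) / 2"
  have s': "0 < s" "\<sigma> < s" "s < c" using s unfolding s_def by auto
  have "\<sigma>\<^sup>2 < s\<^sup>2" using s s' by (intro power_strict_mono) auto
  note Q' = Q[OF this]
  define \<eta> where "\<eta> = min 1 ((c / s - 1) / 2)"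
  have "1 < c / s" using s' by simp
  then have eta: "0 < \<eta>" "\<eta> \<le> 1" unfolding \<eta>_def by auto
  define d where "d = c - (1 + \<eta>) * s"
  have d: "0 < d"
  proof -
    have "(1 + \<eta>) * s \<le> (1 + (c / s - 1) / 2) * s"
      using s' min.cobounded2[of 1 "(c / s - 1) / 2"] unfolding \<eta>_def by (intro mult_right_mono add_left_mono) linarith+
    also have "\<dots> = (c + s) / 2" using s' by (simp add: field_simps)
    finally show ?thesis unfolding d_def using s' by simp
  qed
  define e where "e = s * ln (1 + \<eta> / 4) / 3"
  have e: "0 < e" unfolding e_def using s' eta by simp
  have lim: "(\<lambda>n. lil_scale (real n) / lil_scale (real n + 28)) \<longlonglongrightarrow> 1"
    unfolding lil_scale_def by real_asymp
  have "\<forall>\<^sub>F n in sequentially. 1 / 2 < lil_scale (real n) / lil_scale (real n + 28)"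
    using lim by (rule order_tendstoD) simp
  then have half: "\<forall>\<^sub>F n in sequentially. lil_scale (real n + 28) \<le> 2 * lil_scale (real n)"
  proof eventually_elim
    case (elim n)
    have "0 < lil_scale (real n + 28)" by (rule lil_scale_pos) simp
    with elim show ?case by (simp add: field_simps)
  qed
  show ?thesis
    using Q' truncated_sums_upper[OF s'(1) eta e_def] excess_negligible[of Y, OF Y_measurable distr square_integrable e]
  proof eventually_elim
    case (elim \<omega>)
    have U: "\<forall>\<^sub>F n in sequentially. (\<Sum>i<n. min (Y i \<omega>) (e * trunc_level (real i + 28))) \<le> (1 + \<eta>) * s * lil_scale (real n)"
      using elim by blast
    have R: "\<forall>\<^sub>F n in sequentially. (\<Sum>i<n. max 0 (Y i \<omega> - e * trunc_level (real i + 28))) / lil_scale (real n + 28) < d / 2"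
      using elim(3) by (rule order_tendstoD) (use d in simp)
    from U R half show ?case
    proof eventually_elim
      case (elim n)
      have pos: "0 < lil_scale (real n + 28)" by (rule lil_scale_pos) simp
      have "(\<Sum>i<n. max 0 (Y i \<omega> - e * trunc_level (real i + 28))) \<le> d / 2 * lil_scale (real n + 28)"
        using elim(2) pos by (simp add: field_simps)
      also have "\<dots> \<le> d / 2 * (2 * lil_scale (real n))" using elim(3) d by (intro mult_left_mono) auto
      finally have R: "(\<Sum>i<n. max 0 (Y i \<omega> - e * trunc_level (real i + 28))) \<le> d * lil_scale (real n)" by simp
      have "(\<Sum>i<n. Y i \<omega>) = (\<Sum>i<n. min (Y i \<omega>) (e * trunc_level (real i + 28)) + max 0 (Y i \<omega> - e * trunc_level (real i + 28)))"
        by (intro sum.cong) auto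
      also have "\<dots> \<le> (1 + \<eta>) * s * lil_scale (real n) + d * lil_scale (real n)"
        unfolding sum.distrib using elim(1) R by simp
      also have "\<dots> = c * lil_scale (real n)" unfolding d_def by (simp add: algebra_simps)
      finally show ?case .
    qed
  qed
qed

end

section \<open>The Bernoulli shift\<close>

text \<open>The algebras \<open>future M m\<close> are the case of the index set \<open>{m..}\<close>.  General index sets are needed because
independence comes from disjoint sets of coordinates.\<close>

definition coord_algebra :: "'e measure \<Rightarrow> int set \<Rightarrow> (int \<Rightarrow> 'e) measure"
  where "coord_algebra M K = sigma (space (path_space M))
    {coord k -` A \<inter> space (path_space M) | k A. k \<in> K \<and> A \<in> sets M}"

text \<open>One family covers the powers of the right shift and its inverse.\<close>

definition int_shift :: "int \<Rightarrow> (int \<Rightarrow> 'e) \<Rightarrow> (int \<Rightarrow> 'e)"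
  where "int_shift j \<omega> = (\<lambda>k. \<omega> (k - j))"

lemma right_shift_power: "(right_shift ^^ n) = int_shift (int n)"
proof (induction n)
  case 0
  then show ?case by (simp add: int_shift_def fun_eq_iff)
next
  case (Suc n)
  then show ?case by (simp add: int_shift_def fun_eq_iff right_shift_def algebra_simps)
qed

lemma right_shift_int_shift: "right_shift = int_shift 1"
  by (simp add: fun_eq_iff right_shift_def int_shift_def)

lemma int_shift_0[simp]: "int_shift 0 \<omega> = \<omega>"
  by (simp add: int_shift_def)

lemma int_shift_int_shift[simp]: "int_shift i (int_shift j \<omega>) = int_shift (i + j) \<omega>"
  by (simp add: int_shift_def algebra_simps)

lemma inv_right_shift: "inv right_shift = int_shift (- 1)"
proof
  fix \<omega> :: "int \<Rightarrow> 'e"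
  have "right_shift (int_shift (- 1) \<omega>) = \<omega>" by (simp add: right_shift_int_shift)
  then show "inv right_shift \<omega> = int_shift (- 1) \<omega>"
    by (metis bij_right_shift bij_is_inj inv_f_f)
qed

locale bernoulli_shift = prob_space M for M :: "'e measure"
begin

abbreviation "P \<equiv> path_space M"
abbreviation "F \<equiv> coord_algebra M"

sublocale P: prob_space "path_space M"
  unfolding path_space_def by (rule prob_space_PiM) (rule prob_space_axioms)

lemma future_eq: "future M m = F {m..}"
  unfolding future_def coord_algebra_def by (simp add: atLeast_def)

lemma space_P: "space P = {\<omega>. \<forall>k. \<omega> k \<in> space M}"
  unfolding path_space_def by (auto simp: space_PiM)

lemma space_F[simp]: "space (F K) = space P"
  unfolding coord_algebra_def by (rule space_measure_of_conv)

lemma sets_F: "sets (F K) = sigma_sets (space P) {coord k -` A \<inter> space P | k A. k \<in> K \<and> A \<in> sets M}"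
  unfolding coord_algebra_def by (rule sets_measure_of) auto

lemma coord_measurable_F: "k \<in> K \<Longrightarrow> coord k \<in> measurable (F K) M"
  by (rule measurableI) (auto simp: sets_F space_P coord_def intro!: sigma_sets.Basic)

lemma measurable_into_F:
  assumes "f \<in> space N \<rightarrow> space P" "\<And>k. k \<in> K \<Longrightarrow> (\<lambda>x. f x k) \<in> measurable N M"
  shows "f \<in> measurable N (F K)"
proof (rule measurable_sigma_sets[OF sets_F])
  show "{coord k -` A \<inter> space P | k A. k \<in> K \<and> A \<in> sets M} \<subseteq> Pow (space P)" by auto
  fix y assume "y \<in> {coord k -` A \<inter> space P | k A. k \<in> K \<and> A \<in> sets M}"
  then obtain k A where y: "y = coord k -` A \<inter> space P" "k \<in> K" "A \<in> sets M" by auto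
  have "f -` y \<inter> space N = (\<lambda>x. f x k) -` A \<inter> space N"
    using assms(1) unfolding y by (auto simp: coord_def)
  with measurable_sets[OF assms(2)[OF y(2)] y(3)] show "f -` y \<inter> space N \<in> sets N" by simp
qed (rule assms)

lemma sets_F_mono: "K \<subseteq> K' \<Longrightarrow> sets (F K) \<subseteq> sets (F K')"
  unfolding sets_F by (rule sigma_sets_mono') auto

lemma sets_F_UNIV: "sets (F UNIV) = sets P"
proof -
  have "sets P = sigma_sets (space P) {{f \<in> space P. f i \<in> A} | i A. i \<in> UNIV \<and> A \<in> sets M}"
    unfolding path_space_def sets_PiM_single by (simp add: space_PiM)
  also have "{{f \<in> space P. f i \<in> A} | i A. i \<in> UNIV \<and> A \<in> sets M}
      = {coord k -` A \<inter> space P | k A. k \<in> UNIV \<and> A \<in> sets M}"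
  proof -
    have "coord k -` A \<inter> space P = {f \<in> space P. f k \<in> A}" for k A by (auto simp: coord_def)
    then show ?thesis by simp
  qed
  finally show ?thesis unfolding sets_F ..
qed

lemma subalgebra_F: "subalgebra P (F K)"
  using sets_F_mono[of K UNIV] sets_F_UNIV by (auto simp: subalgebra_def)

lemma sets_F_P: "A \<in> sets (F K) \<Longrightarrow> A \<in> sets P"
  using subalgebra_F[of K] by (auto simp: subalgebra_def)

lemma measurable_F_P: "f \<in> measurable (F K) N \<Longrightarrow> f \<in> measurable P N"
  by (rule measurable_from_subalg[OF subalgebra_F])

lemma measurable_F_mono: "K \<subseteq> K' \<Longrightarrow> f \<in> measurable (F K) N \<Longrightarrow> f \<in> measurable (F K') N"
  by (rule measurable_from_subalg[of "F K'" "F K"]) (use sets_F_mono[of K K'] in \<open>auto simp: subalgebra_def\<close>)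

lemma sigma_finite_subalgebra_F: "sigma_finite_subalgebra P (F K)"
  by (rule finite_measure_subalgebra_is_sigma_finite, unfold_locales) (rule subalgebra_F)

lemma int_shift_space: "\<omega> \<in> space P \<Longrightarrow> int_shift j \<omega> \<in> space P"
  by (auto simp: space_P int_shift_def)

lemma int_shift_measurable_F:
  assumes "\<And>k. k \<in> K \<Longrightarrow> k - j \<in> K'"
  shows "int_shift j \<in> measurable (F K') (F K)"
proof (rule measurable_into_F)
  show "int_shift j \<in> space (F K') \<rightarrow> space P" by (auto intro: int_shift_space)
  fix k assume "k \<in> K"
  then show "(\<lambda>\<omega>. int_shift j \<omega> k) \<in> measurable (F K') M"
    using coord_measurable_F[OF assms, of k] by (simp add: int_shift_def coord_def[abs_def])
qed

lemma int_shift_measurable[measurable]: "int_shift j \<in> measurable P P"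
  using int_shift_measurable_F[of UNIV j UNIV] by (simp add: sets_F_UNIV cong: measurable_cong_sets)

lemma distr_int_shift: "distr P P (int_shift j) = P"
proof -
  have "distr (PiM UNIV (\<lambda>_::int. M)) (PiM UNIV (\<lambda>_. M)) (\<lambda>\<omega>. \<lambda>n\<in>UNIV. \<omega> (n - j)) = PiM UNIV (\<lambda>_. M)"
    by (rule distr_PiM_reindex) (auto intro: prob_space_axioms simp: inj_on_def)
  moreover have "(\<lambda>\<omega>. \<lambda>n\<in>UNIV. \<omega> (n - j)) = (int_shift j :: (int \<Rightarrow> 'e) \<Rightarrow> _)"
    by (simp add: fun_eq_iff int_shift_def)
  ultimately show ?thesis unfolding path_space_def by simp
qed

lemma integral_int_shift:
  fixes f :: "(int \<Rightarrow> 'e) \<Rightarrow> real"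
  assumes "f \<in> borel_measurable P"
  shows "(\<integral>\<omega>. f (int_shift j \<omega>) \<partial>P) = (\<integral>\<omega>. f \<omega> \<partial>P)"
  using integral_distr[OF int_shift_measurable[of j] assms] by (simp add: distr_int_shift)

lemma integrable_int_shift:
  fixes f :: "(int \<Rightarrow> 'e) \<Rightarrow> real"
  assumes "integrable P f"
  shows "integrable P (\<lambda>\<omega>. f (int_shift j \<omega>))"
  using integrable_distr[OF int_shift_measurable[of j], of f] assms by (simp add: distr_int_shift)

lemma AE_int_shift:
  assumes "AE \<omega> in P. Q \<omega>"
  shows "AE \<omega> in P. Q (int_shift j \<omega>)"
  by (rule AE_distrD[OF int_shift_measurable[of j]]) (subst distr_int_shift, rule assms)

lemma distr_comp_int_shift:
  assumes "f \<in> measurable P N"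
  shows "distr P N (\<lambda>\<omega>. f (int_shift j \<omega>)) = distr P N f"
  using distr_distr[OF assms int_shift_measurable[of j]] by (simp add: distr_int_shift comp_def)

lemma prob_int_shift:
  assumes "A \<in> sets P"
  shows "P.prob (int_shift j -` A \<inter> space P) = P.prob A"
  using measure_distr[OF int_shift_measurable[of j] assms] by (simp add: distr_int_shift)

lemma indep_coord_algebras:
  assumes "disjoint_family_on K J"
  shows "P.indep_sets (\<lambda>j. sets (F (K j))) J"
proof -
  have coord_m: "coord k \<in> measurable P M" for k
    using coord_measurable_F[of k UNIV] measurable_F_P by blast
  have coord_d: "distr P M (coord k) = M" for k
    unfolding path_space_def coord_def[abs_def] by (rule distr_PiM_component) (auto intro: prob_space_axioms)
  have "P.indep_vars (\<lambda>_. M) coord UNIV"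
  proof (subst P.indep_vars_iff_distr_eq_PiM')
    have "(\<lambda>\<omega>. \<lambda>i\<in>UNIV. coord i \<omega>) = (\<lambda>\<omega>. \<omega>)" by (simp add: coord_def fun_eq_iff)
    note eq = this
    show "distr P (PiM UNIV (\<lambda>i. M)) (\<lambda>\<omega>. \<lambda>i\<in>UNIV. coord i \<omega>) = PiM UNIV (\<lambda>i. distr P M (coord i))"
      unfolding coord_d eq by (simp only: path_space_def distr_id[unfolded id_def])
  qed (use coord_m in auto)
  then have ind: "P.indep_sets (\<lambda>i. {coord i -` A \<inter> space P | A. A \<in> sets M}) UNIV"
    unfolding P.indep_vars_def2 by simp
  have "P.indep_sets (\<lambda>j. sigma_sets (space P) (\<Union>i\<in>K j. {coord i -` A \<inter> space P | A. A \<in> sets M})) J"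
  proof (rule P.indep_sets_collect_sigma[OF _ _ assms])
    show "P.indep_sets (\<lambda>i. {coord i -` A \<inter> space P | A. A \<in> sets M}) (\<Union>j\<in>J. K j)"
      by (rule P.indep_sets_mono_index[OF _ ind]) simp
    show "Int_stable {coord i -` A \<inter> space P | A. A \<in> sets M}" for i
      unfolding Int_stable_def
    proof safe
      fix A B assume "A \<in> sets M" "B \<in> sets M"
      then show "\<exists>C. (coord i -` A \<inter> space P) \<inter> (coord i -` B \<inter> space P) = coord i -` C \<inter> space P \<and> C \<in> sets M"
        by (intro exI[of _ "A \<inter> B"]) auto
    qed
  qed
  moreover have "(\<Union>i\<in>L. {coord i -` A \<inter> space P | A. A \<in> sets M}) = {coord k -` A \<inter> space P | k A. k \<in> L \<and> A \<in> sets M}" for L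
    by auto
  ultimately show ?thesis unfolding sets_F by simp
qed

lemma prob_Int_F:
  assumes "A \<in> sets (F J)" "B \<in> sets (F K)" "J \<inter> K = {}"
  shows "P.prob (A \<inter> B) = P.prob A * P.prob B"
proof -
  have "disjoint_family_on (case_bool J K) UNIV"
    using assms(3) by (auto simp: disjoint_family_on_def split: bool.splits)
  from indep_coord_algebras[OF this]
  have "P.prob (\<Inter>j\<in>UNIV. case_bool A B j) = (\<Prod>j\<in>UNIV. P.prob (case_bool A B j))"
    by (rule P.indep_setsD) (use assms in \<open>auto split: bool.splits\<close>)
  then show ?thesis by (simp add: UNIV_bool Int_commute mult.commute)
qed

end

section \<open>Ergodicity\<close>

text \<open>The events that can be approximated contain the generating algebras and are closed under complements and,
since a countable union is almost exhausted by finitely many of its members, under countable unions.\<close>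

lemma (in prob_space) approx_by_generators:
  fixes A :: "nat \<Rightarrow> 'a set set"
  assumes alg: "\<And>m. sigma_algebra (space M) (A m)" and mono: "\<And>m. A m \<subseteq> A (Suc m)"
    and sub: "\<And>m. A m \<subseteq> events"
    and X: "X \<in> sigma_sets (space M) (\<Union>m. A m)" and e: "0 < (e::real)"
  shows "\<exists>m. \<exists>B\<in>A m. prob ((X - B) \<union> (B - X)) < e"
proof -
  have mono': "A i \<subseteq> A j" if "i \<le> j" for i j using mono that by (rule lift_Suc_mono_le)
  have ev: "B \<in> events" if "B \<in> A m" for B m using sub that by blast
  have sig: "sigma_sets (space M) (\<Union>m. A m) \<subseteq> events"
    using sub by (intro sets.sigma_sets_subset) auto
  from X e show ?thesis
  proof (induction X arbitrary: e rule: sigma_sets.induct)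
    case (Basic a)
    then obtain m where "a \<in> A m" by auto
    then show ?case using Basic(2) by (intro exI[of _ m] bexI[of _ a]) auto
  next
    case Empty
    have "{} \<in> A 0" using alg[of 0] by (simp add: sigma_algebra_def algebra_def ring_of_sets_def semiring_of_sets_def semiring_of_sets_axioms_def)
    then show ?case using Empty by (intro exI[of _ 0] bexI[of _ "{}"]) auto
  next
    case (Compl a)
    then obtain m B where B: "B \<in> A m" "prob ((a - B) \<union> (B - a)) < e" by blast
    have a: "a \<in> events" using Compl sig by blast
    have "space M - B \<in> A m" using B(1) alg[of m] by (metis algebra.compl_sets sigma_algebra_def)
    moreover have "prob ((space M - a - (space M - B)) \<union> (space M - B - (space M - a))) \<le> prob ((a - B) \<union> (B - a))"
      using a ev[OF B(1)] by (intro finite_measure_mono) auto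
    ultimately show ?case using B(2) by (intro exI[of _ m] bexI[of _ "space M - B"]) auto
  next
    case (Union a)
    have a: "a i \<in> events" for i using Union sig by blast
    have a'[measurable]: "(\<Union>i. a i) \<in> events" "(\<Union>i\<in>{..<n}. a i) \<in> events" for n using a by auto
    have "(\<lambda>n. prob (\<Union>i\<in>{..<n}. a i)) \<longlonglongrightarrow> prob (\<Union>n. \<Union>i\<in>{..<n}. a i)"
      by (rule finite_Lim_measure_incseq) (use a in \<open>auto 0 3 simp: incseq_def dest: less_le_trans\<close>)
    also have "(\<Union>n. \<Union>i\<in>{..<n}. a i) = (\<Union>i. a i)" by auto
    finally have "\<forall>\<^sub>F n in sequentially. prob (\<Union>i. a i) - e / 2 < prob (\<Union>i\<in>{..<n}. a i)"
      by (rule order_tendstoD) (use Union.prems in simp)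
    then obtain n where n: "prob (\<Union>i. a i) - e / 2 < prob (\<Union>i\<in>{..<n}. a i)"
      by (auto simp: eventually_sequentially)
    have n': "prob ((\<Union>i. a i) - (\<Union>i\<in>{..<n}. a i)) < e / 2"
      using n by (subst finite_measure_Diff) auto
    have "\<forall>i. \<exists>m B. B \<in> A m \<and> prob ((a i - B) \<union> (B - a i)) < e / (2 * (real n + 1))"
      using Union.IH[of "e / (2 * (real n + 1))"] Union.prems by (auto simp: Bex_def)
    then obtain m B where B: "\<And>i. B i \<in> A (m i)" "\<And>i. prob ((a i - B i) \<union> (B i - a i)) < e / (2 * (real n + 1))"
      by metis
    define k where "k = Max (m ` {..n})"
    have "B i \<in> A k" if "i < n" for i
      using B(1)[of i] mono'[of "m i" k] that unfolding k_def by (auto intro!: Max_ge)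
    then have BU: "(\<Union>i\<in>{..<n}. B i) \<in> A k"
      using alg[of k] by (intro ring_of_sets.finite_UN) (auto simp: sigma_algebra_def algebra_def)
    let ?S = "(\<Union>i. a i) - (\<Union>i\<in>{..<n}. B i) \<union> ((\<Union>i\<in>{..<n}. B i) - (\<Union>i. a i))"
    have "prob ?S \<le> prob (((\<Union>i. a i) - (\<Union>i\<in>{..<n}. a i)) \<union> (\<Union>i\<in>{..<n}. (a i - B i) \<union> (B i - a i)))"
      using a ev[OF B(1)] by (intro finite_measure_mono) auto
    also have "\<dots> \<le> prob ((\<Union>i. a i) - (\<Union>i\<in>{..<n}. a i)) + prob (\<Union>i\<in>{..<n}. (a i - B i) \<union> (B i - a i))"
      using a ev[OF B(1)] by (intro measure_Un_le) auto
    also have "prob (\<Union>i\<in>{..<n}. (a i - B i) \<union> (B i - a i)) \<le> (\<Sum>i<n. prob ((a i - B i) \<union> (B i - a i)))"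
      using a ev[OF B(1)] by (intro finite_measure_subadditive_finite) auto
    also have "\<dots> \<le> (\<Sum>i<n. e / (2 * (real n + 1)))"
      using B(2) by (intro sum_mono less_imp_le)
    also have "\<dots> \<le> e / 2" using Union.prems by (simp add: field_simps)
    finally have "prob ?S < e" using n' by simp
    then show ?case using BU by blast
  qed
qed

text \<open>Unfolding the recursion shows that this is the maximum over \<open>j \<le> n\<close> of the sums of \<open>\<phi>\<close> over the first \<open>j\<close>
points of the orbit.  The recursive form is exactly the identity on which Garsia's proof of the maximal
ergodic theorem rests.\<close>

primrec max_sum :: "((int \<Rightarrow> 'e) \<Rightarrow> real) \<Rightarrow> nat \<Rightarrow> (int \<Rightarrow> 'e) \<Rightarrow> real"
  where "max_sum \<phi> 0 \<omega> = 0"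
  | "max_sum \<phi> (Suc n) \<omega> = max 0 (\<phi> \<omega> + max_sum \<phi> n (int_shift 1 \<omega>))"

lemma max_sum_nonneg: "0 \<le> max_sum \<phi> n \<omega>"
  by (cases n) auto

lemma max_sum_mono: "max_sum \<phi> n \<omega> \<le> max_sum \<phi> (Suc n) \<omega>"
proof (induction n arbitrary: \<omega>)
  case 0
  then show ?case by simp
next
  case (Suc n)
  show ?case using Suc[of "int_shift 1 \<omega>"] by (subst (1 2) max_sum.simps(2)) (auto simp: max_def)
qed

lemma sum_le_max_sum: "(\<Sum>i<n. \<phi> (int_shift (int i) \<omega>)) \<le> max_sum \<phi> n \<omega>"
proof (induction n arbitrary: \<omega>)
  case 0
  then show ?case by simp
next
  case (Suc n)
  have "(\<Sum>i<Suc n. \<phi> (int_shift (int i) \<omega>)) = \<phi> \<omega> + (\<Sum>i<n. \<phi> (int_shift (int i) (int_shift 1 \<omega>)))"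
    by (subst sum.lessThan_Suc_shift) (simp add: add.commute)
  with Suc[of "int_shift 1 \<omega>"] show ?case by simp
qed

context bernoulli_shift
begin

lemma integrable_max_sum: "integrable P \<phi> \<Longrightarrow> integrable P (max_sum \<phi> n)"
proof (induction n)
  case 0
  then show ?case by (simp add: max_sum.simps(1)[abs_def])
next
  case (Suc n)
  have "integrable P (\<lambda>\<omega>. max_sum \<phi> n (int_shift 1 \<omega>))"
    by (rule integrable_int_shift) (rule Suc.IH[OF Suc.prems])
  then show ?case using Suc unfolding max_sum.simps(2)[abs_def] by (intro integrable_max integrable_add) auto
qed

text \<open>Where the maximum is positive, \<open>\<phi>\<close> is at least the maximum minus its translate by the shift; elsewhere
that difference is not positive.  Its integral vanishes because the shift preserves the measure.\<close>

lemma maximal_ergodic: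
  fixes \<phi> :: "(int \<Rightarrow> 'e) \<Rightarrow> real"
  assumes phi: "integrable P \<phi>"
    and pos: "AE \<omega> in P. \<exists>n. 0 < (\<Sum>i<n. \<phi> (int_shift (int i) \<omega>))"
  shows "0 \<le> (\<integral>\<omega>. \<phi> \<omega> \<partial>P)"
proof -
  have [measurable]: "\<phi> \<in> borel_measurable P" using phi by simp
  have [measurable]: "max_sum \<phi> n \<in> borel_measurable P" for n
    using integrable_max_sum[OF phi] by simp
  define D where "D n = {\<omega> \<in> space P. 0 < max_sum \<phi> n \<omega>}" for n
  have [measurable]: "D n \<in> sets P" for n unfolding D_def by measurable
  have ge: "0 \<le> (\<integral>\<omega>. indicator (D (Suc n)) \<omega> * \<phi> \<omega> \<partial>P)" for n
  proof -
    have i1: "integrable P (max_sum \<phi> (Suc n))" by (rule integrable_max_sum[OF phi])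
    have i2: "integrable P (\<lambda>\<omega>. max_sum \<phi> (Suc n) (int_shift 1 \<omega>))" by (rule integrable_int_shift[OF i1])
    have "0 = (\<integral>\<omega>. max_sum \<phi> (Suc n) \<omega> - max_sum \<phi> (Suc n) (int_shift 1 \<omega>) \<partial>P)"
      using i1 i2 integral_int_shift[of "max_sum \<phi> (Suc n)" 1] by (simp del: max_sum.simps)
    also have "\<dots> \<le> (\<integral>\<omega>. indicator (D (Suc n)) \<omega> * \<phi> \<omega> \<partial>P)"
    proof (rule integral_mono)
      show "integrable P (\<lambda>\<omega>. indicator (D (Suc n)) \<omega> * \<phi> \<omega>)"
        using integrable_mult_indicator[OF _ phi, of "D (Suc n)"] by simp
      fix \<omega> assume \<omega>: "\<omega> \<in> space P"
      show "max_sum \<phi> (Suc n) \<omega> - max_sum \<phi> (Suc n) (int_shift 1 \<omega>) \<le> indicator (D (Suc n)) \<omega> * \<phi> \<omega>"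
      proof (cases "\<omega> \<in> D (Suc n)")
        case True
        then have "max_sum \<phi> (Suc n) \<omega> = \<phi> \<omega> + max_sum \<phi> n (int_shift 1 \<omega>)"
          unfolding D_def by auto
        then show ?thesis using True max_sum_mono[of \<phi> n "int_shift 1 \<omega>"] by (simp del: max_sum.simps)
      next
        case False
        then have "max_sum \<phi> (Suc n) \<omega> = 0"
          using \<omega> max_sum_nonneg[of \<phi> "Suc n" \<omega>] unfolding D_def by (auto simp del: max_sum.simps)
        then show ?thesis using False max_sum_nonneg[of \<phi> "Suc n" "int_shift 1 \<omega>"] by (simp del: max_sum.simps)
      qed
    qed (use i1 i2 in \<open>simp_all del: max_sum.simps\<close>)
    finally show ?thesis .
  qed
  have mono: "max_sum \<phi> i \<omega> \<le> max_sum \<phi> j \<omega>" if "i \<le> j" for i j \<omega>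
    using max_sum_mono that by (rule lift_Suc_mono_le)
  have "(\<lambda>n. \<integral>\<omega>. indicator (D (Suc n)) \<omega> * \<phi> \<omega> \<partial>P) \<longlonglongrightarrow> (\<integral>\<omega>. \<phi> \<omega> \<partial>P)"
  proof (rule integral_dominated_convergence[where w="\<lambda>\<omega>. \<bar>\<phi> \<omega>\<bar>"])
    show "AE \<omega> in P. (\<lambda>n. indicator (D (Suc n)) \<omega> * \<phi> \<omega>) \<longlonglongrightarrow> \<phi> \<omega>"
      using pos AE_space
    proof eventually_elim
      case (elim \<omega>)
      then obtain m where m: "0 < (\<Sum>i<m. \<phi> (int_shift (int i) \<omega>))" by auto
      have "\<omega> \<in> D (Suc n)" if "m \<le> n" for n
        using m sum_le_max_sum[of \<phi> \<omega> m] mono[of m "Suc n" \<omega>] that elim unfolding D_def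
        by (auto simp del: max_sum.simps)
      then have "\<forall>\<^sub>F n in sequentially. indicator (D (Suc n)) \<omega> * \<phi> \<omega> = \<phi> \<omega>"
        by (auto simp: eventually_sequentially intro!: exI[of _ m])
      then show ?case by (rule tendsto_eventually)
    qed
  qed (use phi in \<open>auto simp: indicator_def\<close>)
  then show ?thesis by (rule LIMSEQ_le_const) (use ge in auto)
qed

lemma generated_by_finite_windows:
  fixes W :: "nat \<Rightarrow> int set"
  assumes W: "K \<subseteq> (\<Union>m. W m)" "\<And>m. W m \<subseteq> W (Suc m)" and A: "A \<in> sets (F K)" and e: "0 < e"
  shows "\<exists>m. \<exists>B\<in>sets (F (W m)). P.prob ((A - B) \<union> (B - A)) < e"
proof (rule P.approx_by_generators[OF _ _ _ _ e])
  show "sigma_algebra (space P) (sets (F (W m)))" for m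
    using sets.sigma_algebra_axioms[of "F (W m)"] by simp
  show "sets (F (W m)) \<subseteq> sets (F (W (Suc m)))" for m by (rule sets_F_mono[OF W(2)])
  show "sets (F (W m)) \<subseteq> sets P" for m using sets_F_P by blast
  have "sets (F K) \<subseteq> sigma_sets (space P) (\<Union>m. sets (F (W m)))"
    unfolding sets_F[of K]
  proof (rule sigma_sets_mono, safe)
    fix k X assume k: "k \<in> K" "X \<in> sets M"
    then obtain m where "k \<in> W m" using W(1) by auto
    then have "coord k -` X \<inter> space P \<in> sets (F (W m))"
      using measurable_sets[OF coord_measurable_F k(2), of k "W m"] by simp
    then show "coord k -` X \<inter> space P \<in> sigma_sets (space P) (\<Union>m. sets (F (W m)))" by blast
  qed
  with A show "A \<in> sigma_sets (space P) (\<Union>m. sets (F (W m)))" by blast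
qed

text \<open>Shifted far enough, an event depending on finitely many coordinates is independent of the original one.
An invariant event is approximated by such events and by their translates, hence is
independent of itself.\<close>

lemma invariant_0_1:
  assumes A[measurable]: "A \<in> sets P" and inv: "int_shift 1 -` A \<inter> space P = A"
  shows "P.prob A = 0 \<or> P.prob A = 1"
proof -
  have inv_n: "int_shift (int n) -` A \<inter> space P = A" for n
  proof (induction n)
    case 0
    then show ?case using sets.sets_into_space[OF A] by auto
  next
    case (Suc n)
    have "int_shift (int (Suc n)) -` A \<inter> space P = int_shift (int n) -` (int_shift 1 -` A \<inter> space P) \<inter> space P"
      by (auto simp: int_shift_space)
    with Suc show ?case by (simp only: inv)
  qed
  have "\<bar>P.prob A - P.prob A * P.prob A\<bar> \<le> 4 * e" if e: "0 < e" for e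
  proof -
    have "\<exists>m. \<exists>B\<in>sets (F {- int m..int m}). P.prob ((A - B) \<union> (B - A)) < e"
    proof (rule generated_by_finite_windows[where K=UNIV, OF _ _ _ e])
      have "x \<in> {- int (nat \<bar>x\<bar>)..int (nat \<bar>x\<bar>)}" for x :: int by auto
      then show "UNIV \<subseteq> (\<Union>m. {- int m..int m})" by blast
    qed (auto simp: sets_F_UNIV)
    then obtain m B where BF: "B \<in> sets (F {- int m..int m})" and AB: "P.prob ((A - B) \<union> (B - A)) < e"
      by auto
    have B[measurable]: "B \<in> sets P" using sets_F_P[OF BF] .
    let ?S = "int_shift (int (2 * m + 1))"
    define C where "C = ?S -` B \<inter> space P"
    have CF: "C \<in> sets (F {- int (3 * m + 1)..- int m - 1})"
    proof -
      have "?S \<in> measurable (F {- int (3 * m + 1)..- int m - 1}) (F {- int m..int m})"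
        by (rule int_shift_measurable_F) auto
      from measurable_sets[OF this BF] show ?thesis unfolding C_def by simp
    qed
    have C[measurable]: "C \<in> sets P" using sets_F_P[OF CF] .
    have PC: "P.prob C = P.prob B" unfolding C_def by (rule prob_int_shift[OF B])
    have BC: "P.prob (B \<inter> C) = P.prob B * P.prob B"
      using prob_Int_F[OF BF CF] PC by auto
    have AC: "P.prob ((A - C) \<union> (C - A)) < e"
    proof -
      have "(A - C) \<union> (C - A) = ?S -` ((A - B) \<union> (B - A)) \<inter> space P"
        using inv_n[of "2 * m + 1"] unfolding C_def by blast
      then show ?thesis using prob_int_shift[of "(A - B) \<union> (B - A)" "int (2 * m + 1)"] AB by simp
    qed
    have diff: "\<bar>P.prob X - P.prob Y\<bar> \<le> P.prob ((X - Y) \<union> (Y - X))" if [measurable]: "X \<in> sets P" "Y \<in> sets P" for X Y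
    proof -
      have "P.prob X \<le> P.prob (Y \<union> ((X - Y) \<union> (Y - X)))" by (rule P.finite_measure_mono) auto
      also have "\<dots> \<le> P.prob Y + P.prob ((X - Y) \<union> (Y - X))" by (rule measure_Un_le) auto
      finally have 1: "P.prob X - P.prob Y \<le> P.prob ((X - Y) \<union> (Y - X))" by simp
      have "P.prob Y \<le> P.prob (X \<union> ((X - Y) \<union> (Y - X)))" by (rule P.finite_measure_mono) auto
      also have "\<dots> \<le> P.prob X + P.prob ((X - Y) \<union> (Y - X))" by (rule measure_Un_le) auto
      finally show ?thesis using 1 by simp
    qed
    have "\<bar>P.prob A - P.prob (B \<inter> C)\<bar> \<le> P.prob ((A - B \<inter> C) \<union> (B \<inter> C - A))" by (rule diff) auto
    also have "\<dots> \<le> P.prob (((A - B) \<union> (B - A)) \<union> ((A - C) \<union> (C - A)))" by (rule P.finite_measure_mono) auto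
    also have "\<dots> \<le> P.prob ((A - B) \<union> (B - A)) + P.prob ((A - C) \<union> (C - A))" by (rule measure_Un_le) auto
    finally have 1: "\<bar>P.prob A - P.prob B * P.prob B\<bar> \<le> 2 * e" using AB AC unfolding BC by simp
    have d: "\<bar>P.prob B - P.prob A\<bar> \<le> e" using diff[OF B A] AB by (simp add: Un_commute)
    have "\<bar>P.prob B * P.prob B - P.prob A * P.prob A\<bar> = \<bar>P.prob B - P.prob A\<bar> * (P.prob B + P.prob A)"
    proof -
      have "P.prob B * P.prob B - P.prob A * P.prob A = (P.prob B - P.prob A) * (P.prob B + P.prob A)"
        by (simp add: algebra_simps)
      then show ?thesis by (simp add: abs_mult)
    qed
    also have "\<dots> \<le> e * 2"
      using d add_mono[OF P.prob_le_1[of B] P.prob_le_1[of A]] e by (intro mult_mono) (simp_all del: P.prob_le_1)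
    finally show ?thesis using 1 by linarith
  qed
  note close = this
  have "\<bar>P.prob A - P.prob A * P.prob A\<bar> \<le> 0"
  proof (rule field_le_epsilon)
    fix e :: real assume "0 < e"
    then show "\<bar>P.prob A - P.prob A * P.prob A\<bar> \<le> 0 + e" using close[of "e / 4"] by simp
  qed
  then have "P.prob A * (1 - P.prob A) = 0" by (simp add: algebra_simps)
  then show ?thesis by auto
qed

text \<open>This is the half of Birkhoff's theorem that controls the conditional variances.  If the averages
exceeded \<open>w\<close> infinitely often with positive probability, they would do so almost surely by ergodicity,
and the maximal ergodic theorem for \<open>V - w\<close> would give the integral of \<open>V\<close> a value of at least \<open>w\<close>.\<close>

lemma ergodic_averages_le:
  assumes V: "integrable P V" and v: "(\<integral>\<omega>. V \<omega> \<partial>P) < v"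
  shows "AE \<omega> in P. \<forall>\<^sub>F n in sequentially. (\<Sum>i<n. V (int_shift (int i) \<omega>)) \<le> v * real n"
proof -
  have [measurable]: "V \<in> borel_measurable P" using V by simp
  define S where "S n \<omega> = (\<Sum>i<n. V (int_shift (int i) \<omega>))" for n \<omega>
  have S_shift: "S (Suc n) \<omega> = V \<omega> + S n (int_shift 1 \<omega>)" for n \<omega>
    unfolding S_def by (subst sum.lessThan_Suc_shift) (simp add: add.commute)
  have [measurable]: "S n \<in> borel_measurable P" for n unfolding S_def[abs_def] by measurable
  define bad where "bad u \<omega> \<longleftrightarrow> (\<exists>\<^sub>F n in sequentially. u * real n < S n \<omega>)" for u \<omega>
  \<comment> \<open>Passing to the shifted point may lower the threshold \<open>u\<close> slightly, so single events \<open>bad u\<close> are replaced by their union over thresholds decreasing to \<open>w\<close>, which is invariant.\<close>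
  have linear: "\<forall>\<^sub>F n in sequentially. c \<le> a * real n" if "0 < a" for a c :: real
    using that by real_asymp
  have fwd: "bad u' (int_shift 1 \<omega>)" if "bad u \<omega>" "u' < u" for u u' \<omega>
    unfolding bad_def
  proof (rule ccontr)
    assume "\<not> (\<exists>\<^sub>F n in sequentially. u' * real n < S n (int_shift 1 \<omega>))"
    then have "\<forall>\<^sub>F n in sequentially. S n (int_shift 1 \<omega>) \<le> u' * real n"
      by (simp add: not_frequently not_less)
    moreover have "\<forall>\<^sub>F n in sequentially. V \<omega> - u \<le> (u - u') * real n"
      using that(2) by (intro linear) simp
    ultimately have "\<forall>\<^sub>F n in sequentially. S (Suc n) \<omega> \<le> u * real (Suc n)"
      by eventually_elim (simp add: S_shift algebra_simps)
    then have "\<forall>\<^sub>F n in sequentially. S n \<omega> \<le> u * real n"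
      by (simp only: eventually_sequentially_Suc[of "\<lambda>n. S n \<omega> \<le> u * real n"])
    with that(1) show False unfolding bad_def by (auto simp: frequently_def not_less)
  qed
  have bwd: "bad u' \<omega>" if "bad u (int_shift 1 \<omega>)" "u' < u" for u u' \<omega>
    unfolding bad_def
  proof (rule ccontr)
    assume "\<not> (\<exists>\<^sub>F n in sequentially. u' * real n < S n \<omega>)"
    then have "\<forall>\<^sub>F n in sequentially. S n \<omega> \<le> u' * real n"
      by (simp add: not_frequently not_less)
    then have "\<forall>\<^sub>F n in sequentially. S (Suc n) \<omega> \<le> u' * real (Suc n)"
      by (simp only: eventually_sequentially_Suc[of "\<lambda>n. S n \<omega> \<le> u' * real n"])
    moreover have "\<forall>\<^sub>F n in sequentially. u' - V \<omega> \<le> (u - u') * real n"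
      using that(2) by (intro linear) simp
    ultimately have "\<forall>\<^sub>F n in sequentially. S n (int_shift 1 \<omega>) \<le> u * real n"
      by eventually_elim (simp add: S_shift algebra_simps)
    with that(1) show False unfolding bad_def by (auto simp: frequently_def not_less)
  qed
  obtain w where w: "(\<integral>\<omega>. V \<omega> \<partial>P) < w" "w < v" using v dense by blast
  define A where "A = {\<omega> \<in> space P. \<exists>k::nat. bad (w + 1 / (real k + 1)) \<omega>}"
  have bad_meas[measurable]: "Measurable.pred P (bad u)" for u
    unfolding bad_def frequently_sequentially by measurable
  have A[measurable]: "A \<in> sets P" unfolding A_def by measurable
  have lt: "w + 1 / (real (Suc k) + 1) < w + 1 / (real k + 1)" for k by (simp add: field_simps)
  have "int_shift 1 -` A \<inter> space P = A"
    unfolding A_def using fwd[OF _ lt] bwd[OF _ lt] by (blast intro: int_shift_space)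
  from invariant_0_1[OF A this] have "P.prob A = 0"
  proof
    assume "P.prob A = 1"
    then have "AE \<omega> in P. \<omega> \<in> A" by (simp add: P.prob_eq_1)
    then have "AE \<omega> in P. \<exists>n. 0 < (\<Sum>i<n. V (int_shift (int i) \<omega>) - w)"
    proof eventually_elim
      case (elim \<omega>)
      then obtain k :: nat where "bad (w + 1 / (real k + 1)) \<omega>" unfolding A_def by auto
      then obtain n where n: "(w + 1 / (real k + 1)) * real n < S n \<omega>"
        unfolding bad_def using frequently_ex by blast
      have "w * real n \<le> (w + 1 / (real k + 1)) * real n" by (intro mult_right_mono) auto
      with n have "0 < (\<Sum>i<n. V (int_shift (int i) \<omega>) - w)"
        unfolding S_def by (simp add: sum_subtractf mult.commute)
      then show ?case ..
    qed
    then have "0 \<le> (\<integral>\<omega>. V \<omega> - w \<partial>P)" using V by (intro maximal_ergodic) auto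
    also have "\<dots> = (\<integral>\<omega>. V \<omega> \<partial>P) - w" using V by (simp add: P.prob_space)
    finally show ?thesis using w by simp
  qed
  then have "AE \<omega> in P. \<omega> \<notin> A" by (simp add: P.prob_eq_0)
  then show ?thesis using AE_space
  proof eventually_elim
    case (elim \<omega>)
    obtain k :: nat where k: "1 / (real k + 1) < v - w"
      using w reals_Archimedean[of "v - w"] by (auto simp: inverse_eq_divide add.commute)
    have "\<not> bad (w + 1 / (real k + 1)) \<omega>" using elim unfolding A_def by auto
    then have "\<forall>\<^sub>F n in sequentially. S n \<omega> \<le> (w + 1 / (real k + 1)) * real n"
      unfolding bad_def by (simp add: not_frequently not_less)
    then show ?case
    proof eventually_elim
      case (elim n)
      also have "(w + 1 / (real k + 1)) * real n \<le> v * real n" using k by (intro mult_right_mono) auto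
      finally show ?case unfolding S_def .
    qed
  qed
qed

section \<open>Conditional expectations and finitely many coordinates\<close>

lemma cond_exp_int_shift:
  assumes f: "integrable P f" and K: "\<And>k. k \<in> K \<Longrightarrow> k - j \<in> K'" "\<And>k. k \<in> K' \<Longrightarrow> k + j \<in> K"
  shows "AE \<omega> in P. real_cond_exp P (F K') (\<lambda>\<omega>. f (int_shift j \<omega>)) \<omega> = real_cond_exp P (F K) f (int_shift j \<omega>)"
proof -
  interpret F: sigma_finite_subalgebra P "F K" by (rule sigma_finite_subalgebra_F)
  interpret F': sigma_finite_subalgebra P "F K'" by (rule sigma_finite_subalgebra_F)
  have fm[measurable]: "f \<in> borel_measurable P" using f by simp
  show ?thesis
  proof (rule F'.real_cond_exp_charact)
    show "integrable P (\<lambda>\<omega>. f (int_shift j \<omega>))" by (rule integrable_int_shift[OF f])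
    show "integrable P (\<lambda>\<omega>. real_cond_exp P (F K) f (int_shift j \<omega>))"
      by (rule integrable_int_shift[OF F.real_cond_exp_int(1)[OF f]])
    have "int_shift j \<in> measurable (F K') (F K)" by (rule int_shift_measurable_F) (use K in auto)
    then show "(\<lambda>\<omega>. real_cond_exp P (F K) f (int_shift j \<omega>)) \<in> borel_measurable (F K')"
      by (rule measurable_compose) simp
    fix A assume A: "A \<in> sets (F K')"
    define A' where "A' = int_shift (- j) -` A \<inter> space P"
    have A'F: "A' \<in> sets (F K)"
    proof -
      have "int_shift (- j) \<in> measurable (F K) (F K')" by (rule int_shift_measurable_F) (use K in auto)
      from measurable_sets[OF this A] show ?thesis unfolding A'_def by simp
    qed
    have A'm[measurable]: "A' \<in> sets P" using sets_F_P[OF A'F] .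
    have ind: "indicator A \<omega> = (indicator A' (int_shift j \<omega>) :: real)" if "\<omega> \<in> space P" for \<omega>
      using that unfolding A'_def by (auto simp: indicator_def int_shift_space)
    have tr: "(\<integral>\<omega>\<in>A. q (int_shift j \<omega>) \<partial>P) = (\<integral>\<omega>\<in>A'. q \<omega> \<partial>P)" if [measurable]: "q \<in> borel_measurable P" for q :: "_ \<Rightarrow> real"
    proof -
      have "(\<integral>\<omega>\<in>A. q (int_shift j \<omega>) \<partial>P) = (\<integral>\<omega>. (\<lambda>\<omega>. indicator A' \<omega> * q \<omega>) (int_shift j \<omega>) \<partial>P)"
        unfolding set_lebesgue_integral_def by (rule Bochner_Integration.integral_cong) (auto simp: ind)
      also have "\<dots> = (\<integral>\<omega>. indicator A' \<omega> * q \<omega> \<partial>P)" by (rule integral_int_shift) measurable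
      finally show ?thesis unfolding set_lebesgue_integral_def by simp
    qed
    show "(\<integral>\<omega>\<in>A. f (int_shift j \<omega>) \<partial>P) = (\<integral>\<omega>\<in>A. real_cond_exp P (F K) f (int_shift j \<omega>) \<partial>P)"
      using F.real_cond_exp_intA[OF f A'F] by (simp add: tr)
  qed
qed

end

context bernoulli_shift
begin

lemma indep_var_F:
  assumes X: "X \<in> borel_measurable (F J)" and Y: "Y \<in> borel_measurable (F K)" and JK: "J \<inter> K = {}"
  shows "P.indep_var borel X borel Y"
  unfolding P.indep_var_eq
proof (intro conjI)
  show "X \<in> borel_measurable P" "Y \<in> borel_measurable P"
    using X Y by (auto intro: measurable_F_P)
  have subX: "sigma_sets (space P) {X -` A \<inter> space P | A. A \<in> sets borel} \<subseteq> sets (F J)"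
    using sets.sigma_sets_subset[of "{X -` A \<inter> space P | A. A \<in> sets borel}" "F J"]
      measurable_sets[OF X] by auto
  have subY: "sigma_sets (space P) {Y -` A \<inter> space P | A. A \<in> sets borel} \<subseteq> sets (F K)"
    using sets.sigma_sets_subset[of "{Y -` A \<inter> space P | A. A \<in> sets borel}" "F K"]
      measurable_sets[OF Y] by auto
  show "P.indep_set (sigma_sets (space P) {X -` A \<inter> space P | A. A \<in> sets borel})
     (sigma_sets (space P) {Y -` A \<inter> space P | A. A \<in> sets borel})"
  proof (rule P.indep_setI)
    show "sigma_sets (space P) {X -` A \<inter> space P | A. A \<in> sets borel} \<subseteq> sets P"
      using subX sets_F_P by blast
    show "sigma_sets (space P) {Y -` A \<inter> space P | A. A \<in> sets borel} \<subseteq> sets P"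
      using subY sets_F_P by blast
  qed (use subX subY prob_Int_F[OF _ _ JK] in blast)
qed

text \<open>Over the intersection of an event in the coordinates \<open>J\<close> with one in \<open>H\<close>, both integrals factorize by
independence, and such intersections generate the larger algebra.  The lemma is what makes the conditional
expectation of a function of finitely many coordinates again such a function.\<close>

lemma cond_exp_independent_coords:
  assumes u: "integrable P u" "u \<in> borel_measurable (F K)" and J: "J \<subseteq> K" and H: "H \<inter> K = {}"
  shows "AE \<omega> in P. real_cond_exp P (F (J \<union> H)) u \<omega> = real_cond_exp P (F J) u \<omega>"
proof -
  interpret FJ: sigma_finite_subalgebra P "F J" by (rule sigma_finite_subalgebra_F)
  interpret FJH: sigma_finite_subalgebra P "F (J \<union> H)" by (rule sigma_finite_subalgebra_F)
  define w where "w = real_cond_exp P (F J) u"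
  have w: "integrable P w" unfolding w_def by (rule FJ.real_cond_exp_int(1)[OF u(1)])
  have wJ: "w \<in> borel_measurable (F J)" unfolding w_def by simp
  have wK: "w \<in> borel_measurable (F K)" using measurable_F_mono[OF J wJ] .
  define E where "E = {B \<inter> C | B C. B \<in> sets (F J) \<and> C \<in> sets (F H)}"
  have E_sub: "E \<subseteq> sets (F (J \<union> H))"
    unfolding E_def using sets_F_mono[of J "J \<union> H"] sets_F_mono[of H "J \<union> H"] by auto
  have E_Pow: "E \<subseteq> Pow (space P)" using E_sub sets.sets_into_space[of _ "F (J \<union> H)"] by auto
  have E_gen: "sets (F (J \<union> H)) = sigma_sets (space P) E"
  proof
    show "sigma_sets (space P) E \<subseteq> sets (F (J \<union> H))"
      using sets.sigma_sets_subset[OF E_sub] by simp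
    show "sets (F (J \<union> H)) \<subseteq> sigma_sets (space P) E"
      unfolding sets_F[of "J \<union> H"]
    proof (rule sigma_sets_mono, rule subsetI)
      fix Y assume "Y \<in> {coord k -` A \<inter> space P | k A. k \<in> J \<union> H \<and> A \<in> sets M}"
      then obtain k X where Y: "Y = coord k -` X \<inter> space P" and k: "k \<in> J \<union> H" "X \<in> sets M" by auto
      have top: "space P \<in> sets (F L)" for L using sets.top[of "F L"] by simp
      have m: "coord k -` X \<inter> space P \<in> sets (F L)" if "k \<in> L" for L
        using measurable_sets[OF coord_measurable_F[OF that] k(2)] by simp
      have "coord k -` X \<inter> space P \<in> E"
      proof (cases "k \<in> J")
        case True
        then show ?thesis unfolding E_def using m[of J] top[of H] by blast
      next
        case False
        then show ?thesis unfolding E_def using m[of H] top[of J] k by blast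
      qed
      then show "Y \<in> sigma_sets (space P) E" unfolding Y by blast
    qed
  qed
  have Int: "Int_stable E"
    unfolding Int_stable_def E_def
  proof safe
    fix B C B' C' assume "B \<in> sets (F J)" "C \<in> sets (F H)" "B' \<in> sets (F J)" "C' \<in> sets (F H)"
    then show "\<exists>D D'. B \<inter> C \<inter> (B' \<inter> C') = D \<inter> D' \<and> D \<in> sets (F J) \<and> D' \<in> sets (F H)"
      by (intro exI[of _ "B \<inter> B'"] exI[of _ "C \<inter> C'"]) auto
  qed
  have sint: "integrable P (\<lambda>\<omega>. indicator A \<omega> *\<^sub>R q \<omega>)" if "integrable P q" "A \<in> sets P" for q :: "_ \<Rightarrow> real" and A
    by (rule integrable_mult_indicator[OF that(2,1)])
  have prod: "(\<integral>\<omega>\<in>B \<inter> C. q \<omega> \<partial>P) = (\<integral>\<omega>\<in>B. q \<omega> \<partial>P) * P.prob C"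
    if q: "integrable P q" "q \<in> borel_measurable (F K)" and B: "B \<in> sets (F J)" and C: "C \<in> sets (F H)" for q B C
  proof -
    have BK: "B \<in> sets (F K)" using B sets_F_mono[OF J] by blast
    have CP: "C \<in> sets P" and BP: "B \<in> sets P" using B C sets_F_P by auto
    have "P.indep_var borel (\<lambda>\<omega>. indicator B \<omega> *\<^sub>R q \<omega>) borel (indicator C :: _ \<Rightarrow> real)"
    proof (rule indep_var_F)
      show "(\<lambda>\<omega>. indicator B \<omega> *\<^sub>R q \<omega>) \<in> borel_measurable (F K)"
        using q(2) BK by measurable
      show "(indicator C :: _ \<Rightarrow> real) \<in> borel_measurable (F H)" using C by measurable
    qed (use H in auto)
    from P.indep_var_lebesgue_integral[OF this sint[OF q(1) BP]]
    have "(\<integral>\<omega>. indicator B \<omega> *\<^sub>R q \<omega> * indicator C \<omega> \<partial>P) = (\<integral>\<omega>. indicator B \<omega> *\<^sub>R q \<omega> \<partial>P) * P.prob C"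
      using CP by (simp add: less_top[symmetric])
    moreover have "(\<integral>\<omega>. indicator B \<omega> *\<^sub>R q \<omega> * indicator C \<omega> \<partial>P) = (\<integral>\<omega>. indicator (B \<inter> C) \<omega> *\<^sub>R q \<omega> \<partial>P)"
      by (rule Bochner_Integration.integral_cong) (auto simp: indicator_def)
    ultimately show ?thesis unfolding set_lebesgue_integral_def by simp
  qed
  have "AE \<omega> in P. real_cond_exp P (F (J \<union> H)) u \<omega> = w \<omega>"
  proof (rule FJH.real_cond_exp_charact)
    show "w \<in> borel_measurable (F (J \<union> H))" using measurable_F_mono[OF _ wJ] by simp
    fix A assume "A \<in> sets (F (J \<union> H))"
    then have "A \<in> sigma_sets (space P) E" unfolding E_gen .
    with Int E_Pow show "(\<integral>\<omega>\<in>A. u \<omega> \<partial>P) = (\<integral>\<omega>\<in>A. w \<omega> \<partial>P)"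
    proof (induction rule: sigma_sets_induct_disjoint)
      case (basic A)
      then obtain B C where A: "A = B \<inter> C" "B \<in> sets (F J)" "C \<in> sets (F H)" unfolding E_def by auto
      show ?case unfolding A(1) prod[OF u A(2,3)] prod[OF w wK A(2,3)]
        using FJ.real_cond_exp_intA[OF u(1) A(2)] unfolding w_def by simp
    next
      case empty
      then show ?case by (simp add: set_lebesgue_integral_def)
    next
      case (compl A)
      have A: "A \<in> sets P" using compl(1) E_gen sets_F_P by blast
      have split: "(\<integral>\<omega>\<in>space P - A. q \<omega> \<partial>P) = (\<integral>\<omega>. q \<omega> \<partial>P) - (\<integral>\<omega>\<in>A. q \<omega> \<partial>P)" if "integrable P q" for q :: "_ \<Rightarrow> real"
      proof -
        have "(\<integral>\<omega>\<in>space P - A. q \<omega> \<partial>P) = (\<integral>\<omega>. q \<omega> - indicator A \<omega> *\<^sub>R q \<omega> \<partial>P)"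
          unfolding set_lebesgue_integral_def by (rule Bochner_Integration.integral_cong) (auto simp: indicator_def)
        also have "\<dots> = (\<integral>\<omega>. q \<omega> \<partial>P) - (\<integral>\<omega>. indicator A \<omega> *\<^sub>R q \<omega> \<partial>P)"
          by (rule Bochner_Integration.integral_diff[OF that sint[OF that A]])
        finally show ?thesis unfolding set_lebesgue_integral_def .
      qed
      have "(\<integral>\<omega>. u \<omega> \<partial>P) = (\<integral>\<omega>. w \<omega> \<partial>P)" unfolding w_def using FJ.real_cond_exp_int(2)[OF u(1)] by simp
      with compl(2) show ?case unfolding split[OF u(1)] split[OF w] by simp
    next
      case (union A)
      have A: "A i \<in> sets P" for i using union(2) E_gen sets_F_P by blast
      have add: "(\<integral>\<omega>\<in>(\<Union>i. A i). q \<omega> \<partial>P) = (\<Sum>i. \<integral>\<omega>\<in>A i. q \<omega> \<partial>P)" if "integrable P q" for q :: "_ \<Rightarrow> real"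
        by (rule lebesgue_integral_countable_add[OF A])
          (use union(1) A sint[OF that, of "\<Union>i. A i"] in \<open>auto simp: disjoint_family_on_def set_integrable_def\<close>)
      show ?case unfolding add[OF u(1)] add[OF w] by (simp add: union(3))
    qed
  qed (rule u, rule w)
  then show ?thesis unfolding w_def .
qed

text \<open>Approximate first by a simple function and then each of its level sets by an event in finitely many
coordinates.\<close>

lemma L2_approx_by_bounded_window:
  fixes W :: "nat \<Rightarrow> int set" and f :: "(int \<Rightarrow> 'e) \<Rightarrow> real"
  assumes W: "K \<subseteq> (\<Union>m. W m)" "\<And>m. W m \<subseteq> W (Suc m)"
    and f: "f \<in> borel_measurable (F K)" "integrable P (\<lambda>\<omega>. (f \<omega>)\<^sup>2)" and e: "0 < e"
  shows "\<exists>m u B. u \<in> borel_measurable (F (W m)) \<and> (\<forall>\<omega>. \<bar>u \<omega>\<bar> \<le> B) \<and> (\<integral>\<omega>. (f \<omega> - u \<omega>)\<^sup>2 \<partial>P) < e"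
proof -
  have W_mono: "W i \<subseteq> W j" if "i \<le> j" for i j using W(2) that by (rule lift_Suc_mono_le)
  have fP[measurable]: "f \<in> borel_measurable P" using f(1) by (rule measurable_F_P)
  from borel_measurable_implies_sequence_metric[OF f(1), of 0] obtain s where
    "\<forall>i. simple_function (F K) (s i)" "\<forall>x\<in>space P. (\<lambda>i. s i x) \<longlonglongrightarrow> f x"
    "\<forall>i. \<forall>x\<in>space P. \<bar>s i x\<bar> \<le> 2 * \<bar>f x\<bar>"
    unfolding dist_real_def diff_0_right space_F by blast
  then have s: "\<And>i. simple_function (F K) (s i)"
    and lim: "\<And>x. x \<in> space P \<Longrightarrow> (\<lambda>i. s i x) \<longlonglongrightarrow> f x"
    and bound: "\<And>i x. x \<in> space P \<Longrightarrow> \<bar>s i x\<bar> \<le> 2 * \<bar>f x\<bar>"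
    by blast+
  have sK: "s i \<in> borel_measurable (F K)" for i using s by (rule borel_measurable_simple_function)
  have sP[measurable]: "s i \<in> borel_measurable P" for i using sK by (rule measurable_F_P)
  have bound2: "(f x - s i x)\<^sup>2 \<le> 9 * (f x)\<^sup>2" if "x \<in> space P" for x i
  proof -
    have "\<bar>f x - s i x\<bar> \<le> 3 * \<bar>f x\<bar>" using bound[OF that, of i] by linarith
    then have "\<bar>f x - s i x\<bar>\<^sup>2 \<le> (3 * \<bar>f x\<bar>)\<^sup>2" by (rule power_mono) simp
    then show ?thesis by (simp add: power_mult_distrib)
  qed
  have "(\<lambda>i. \<integral>x. (f x - s i x)\<^sup>2 \<partial>P) \<longlonglongrightarrow> (\<integral>x. 0 \<partial>P)"
  proof (rule integral_dominated_convergence[where w="\<lambda>x. 9 * (f x)\<^sup>2"])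
    show "AE x in P. (\<lambda>i. (f x - s i x)\<^sup>2) \<longlonglongrightarrow> 0"
    proof (rule AE_I2)
      fix x assume "x \<in> space P"
      from tendsto_power[OF tendsto_diff[OF tendsto_const lim[OF this]], of "f x" 2]
      show "(\<lambda>i. (f x - s i x)\<^sup>2) \<longlonglongrightarrow> 0" by simp
    qed
    show "AE x in P. norm ((f x - s i x)\<^sup>2) \<le> 9 * (f x)\<^sup>2" for i
      using bound2 by (intro AE_I2) auto
  qed (use f in auto)
  then have "\<forall>\<^sub>F i in sequentially. (\<integral>x. (f x - s i x)\<^sup>2 \<partial>P) < e / 4"
    using e by (intro order_tendstoD(2)[of _ "\<integral>x. 0 \<partial>P"]) auto
  then obtain i where i: "(\<integral>x. (f x - s i x)\<^sup>2 \<partial>P) < e / 4" by (auto simp: eventually_sequentially)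
  define t where "t = s i"
  have t: "simple_function (F K) t" unfolding t_def by (rule s)
  define R where "R = t ` space P"
  have R: "finite R" using simple_functionD(1)[OF t] unfolding R_def by simp
  define A where "A y = t -` {y} \<inter> space P" for y
  have A: "A y \<in> sets (F K)" for y using simple_functionD(2)[OF t, of "{y}"] unfolding A_def by simp
  define c where "c = (\<Sum>y\<in>R. y\<^sup>2)"
  have c0: "0 \<le> c" unfolding c_def by (intro sum_nonneg) auto
  define d where "d = e / (4 * (c + 1) * (real (card R) + 1))"
  have d: "0 < d" unfolding d_def using e c0 by (intro divide_pos_pos mult_pos_pos) auto
  have "\<forall>y. \<exists>m B. B \<in> sets (F (W m)) \<and> P.prob ((A y - B) \<union> (B - A y)) < d"
    using generated_by_finite_windows[OF W A d] by blast
  then obtain m B where B: "\<And>y. B y \<in> sets (F (W (m y)))" "\<And>y. P.prob ((A y - B y) \<union> (B y - A y)) < d"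
    by metis
  define k where "k = Max (insert 0 (m ` R))"
  have Bk: "B y \<in> sets (F (W k))" if "y \<in> R" for y
    using B(1)[of y] sets_F_mono[OF W_mono[of "m y" k]] that R unfolding k_def by (auto intro: Max_ge)
  have AP[measurable]: "A y \<in> sets P" and BP[measurable]: "B y \<in> sets P" for y
    using A B(1) sets_F_P by auto
  define u where "u \<omega> = (\<Sum>y\<in>R. y * indicator (B y) \<omega>)" for \<omega>
  have u: "u \<in> borel_measurable (F (W k))"
    unfolding u_def[abs_def] using Bk by (intro borel_measurable_sum borel_measurable_times borel_measurable_indicator) auto
  have uP[measurable]: "u \<in> borel_measurable P" using u by (rule measurable_F_P)
  have u_bd: "\<bar>u \<omega>\<bar> \<le> (\<Sum>y\<in>R. \<bar>y\<bar>)" for \<omega>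
    unfolding u_def by (rule order_trans[OF sum_abs]) (auto intro!: sum_mono simp: indicator_def)
  have t_eq: "t \<omega> = (\<Sum>y\<in>R. y * indicator (A y) \<omega>)" if "\<omega> \<in> space P" for \<omega>
  proof -
    have "(\<Sum>y\<in>R. y * indicator (A y) \<omega>) = (\<Sum>y\<in>R. if t \<omega> = y then y else 0)"
      using that by (intro sum.cong) (auto simp: A_def indicator_def)
    also have "\<dots> = t \<omega>" using that R by (simp add: R_def)
    finally show ?thesis ..
  qed
  \<comment> \<open>Cauchy--Schwarz for the finite sum of the differences of the indicators.\<close>
  have tu: "(t \<omega> - u \<omega>)\<^sup>2 \<le> c * (\<Sum>y\<in>R. indicator ((A y - B y) \<union> (B y - A y)) \<omega>)" if "\<omega> \<in> space P" for \<omega>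
  proof -
    have "t \<omega> - u \<omega> = (\<Sum>y\<in>R. y * (indicator (A y) \<omega> - indicator (B y) \<omega>))"
      unfolding t_eq[OF that] u_def sum_subtractf[symmetric] by (simp add: algebra_simps)
    then have "(t \<omega> - u \<omega>)\<^sup>2 \<le> (\<Sum>y\<in>R. y\<^sup>2) * (\<Sum>y\<in>R. (indicator (A y) \<omega> - indicator (B y) \<omega>)\<^sup>2)"
      using Cauchy_Schwarz_ineq_sum[of "\<lambda>y. y" "\<lambda>y. indicator (A y) \<omega> - indicator (B y) \<omega>" R] by simp
    also have "(\<Sum>y\<in>R. (indicator (A y) \<omega> - indicator (B y) \<omega>)\<^sup>2)
        = (\<Sum>y\<in>R. indicator ((A y - B y) \<union> (B y - A y)) \<omega> :: real)"
      by (intro sum.cong) (auto simp: indicator_def)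
    finally show ?thesis unfolding c_def .
  qed
  have tu_int: "(\<integral>\<omega>. (t \<omega> - u \<omega>)\<^sup>2 \<partial>P) \<le> e / 4"
  proof -
    have ii: "integrable P (\<lambda>\<omega>. c * (\<Sum>y\<in>R. indicator ((A y - B y) \<union> (B y - A y)) \<omega> :: real))"
      by (intro integrable_mult_right Bochner_Integration.integrable_sum integrable_real_indicator) (auto simp: less_top[symmetric])
    have "(\<integral>\<omega>. (t \<omega> - u \<omega>)\<^sup>2 \<partial>P) \<le> (\<integral>\<omega>. c * (\<Sum>y\<in>R. indicator ((A y - B y) \<union> (B y - A y)) \<omega>) \<partial>P)"
    proof (rule integral_mono_AE')
      show "AE \<omega> in P. (t \<omega> - u \<omega>)\<^sup>2 \<le> c * (\<Sum>y\<in>R. indicator ((A y - B y) \<union> (B y - A y)) \<omega>)"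
        using tu by (rule AE_I2)
    qed (use ii c0 in \<open>auto intro!: AE_I2 mult_nonneg_nonneg sum_nonneg\<close>)
    also have "\<dots> = c * (\<Sum>y\<in>R. P.prob ((A y - B y) \<union> (B y - A y)))"
      by (subst integral_mult_right_zero, subst Bochner_Integration.integral_sum)
        (auto intro!: integrable_real_indicator simp: less_top[symmetric])
    also have "\<dots> \<le> (c + 1) * (\<Sum>y\<in>R. d)"
    proof (rule mult_mono)
      show "(\<Sum>y\<in>R. P.prob ((A y - B y) \<union> (B y - A y))) \<le> (\<Sum>y\<in>R. d)"
        by (rule sum_mono) (rule less_imp_le[OF B(2)])
    qed (use c0 in \<open>auto intro!: sum_nonneg\<close>)
    also have "\<dots> = (c + 1) * (real (card R) * d)" by simp
    also have "\<dots> \<le> (c + 1) * ((real (card R) + 1) * d)" using c0 d by (intro mult_left_mono mult_right_mono) auto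
    also have "\<dots> = e / 4" 
    proof -
      have "a * (b * (e / (4 * a * b))) = e / 4" if "0 < a" "0 < b" for a b :: real
        using that by simp
      from this[of "c + 1" "real (card R) + 1"] show ?thesis unfolding d_def using c0 by linarith
    qed
    finally show ?thesis .
  qed
  have int1: "integrable P (\<lambda>x. (f x - t x)\<^sup>2)"
    by (rule Bochner_Integration.integrable_bound[OF integrable_mult_right[OF f(2), of 9]])
      (use bound2 in \<open>auto simp: t_def\<close>)
  have int2: "integrable P (\<lambda>x. (t x - u x)\<^sup>2)"
  proof (rule Bochner_Integration.integrable_bound)
    show "integrable P (\<lambda>\<omega>. c * (\<Sum>y\<in>R. indicator ((A y - B y) \<union> (B y - A y)) \<omega> :: real))"
      by (intro integrable_mult_right Bochner_Integration.integrable_sum integrable_real_indicator) (auto simp: less_top[symmetric])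
    show "AE \<omega> in P. norm ((t \<omega> - u \<omega>)\<^sup>2) \<le> norm (c * (\<Sum>y\<in>R. indicator ((A y - B y) \<union> (B y - A y)) \<omega> :: real))"
      using tu by (intro AE_I2) (simp add: order_trans[OF _ abs_ge_self])
  qed (auto simp: t_def)
  have "(\<integral>\<omega>. (f \<omega> - u \<omega>)\<^sup>2 \<partial>P) \<le> (\<integral>\<omega>. 2 * (f \<omega> - t \<omega>)\<^sup>2 + 2 * (t \<omega> - u \<omega>)\<^sup>2 \<partial>P)"
  proof (rule integral_mono_AE')
    have "(a - c)\<^sup>2 \<le> 2 * (a - b)\<^sup>2 + 2 * (b - c)\<^sup>2" for a b c :: real
      using zero_le_power2[of "(a - b) - (b - c)"] by (simp add: power2_eq_square algebra_simps)
    then show "AE \<omega> in P. (f \<omega> - u \<omega>)\<^sup>2 \<le> 2 * (f \<omega> - t \<omega>)\<^sup>2 + 2 * (t \<omega> - u \<omega>)\<^sup>2" by auto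
  qed (use int1 int2 in auto)
  also have "\<dots> = 2 * (\<integral>\<omega>. (f \<omega> - t \<omega>)\<^sup>2 \<partial>P) + 2 * (\<integral>\<omega>. (t \<omega> - u \<omega>)\<^sup>2 \<partial>P)"
    using int1 int2 by simp
  also have "\<dots> < e" using i tu_int unfolding t_def by simp
  finally show ?thesis using u u_bd by blast
qed

end

section \<open>Stationary martingale differences\<close>

lemma square_sum_le: "(a + b)\<^sup>2 \<le> 2 * a\<^sup>2 + 2 * (b::real)\<^sup>2"
  using zero_le_power2[of "a - b"] by (simp add: power2_eq_square algebra_simps)

lemma integrable_square_add:
  fixes u v :: "'a \<Rightarrow> real"
  assumes [measurable]: "u \<in> borel_measurable N" "v \<in> borel_measurable N"
    and "integrable N (\<lambda>\<omega>. (u \<omega>)\<^sup>2)" "integrable N (\<lambda>\<omega>. (v \<omega>)\<^sup>2)"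
  shows "integrable N (\<lambda>\<omega>. (u \<omega> + v \<omega>)\<^sup>2)"
proof (rule Bochner_Integration.integrable_bound)
  show "integrable N (\<lambda>\<omega>. 2 * (u \<omega>)\<^sup>2 + 2 * (v \<omega>)\<^sup>2)" using assms by auto
  show "AE \<omega> in N. norm ((u \<omega> + v \<omega>)\<^sup>2) \<le> norm (2 * (u \<omega>)\<^sup>2 + 2 * (v \<omega>)\<^sup>2)"
    using square_sum_le[of "u _" "v _"] by auto
qed measurable

lemma (in prob_space) integrable_square_bounded:
  fixes u :: "'a \<Rightarrow> real"
  assumes [measurable]: "u \<in> borel_measurable M" and "\<And>\<omega>. \<bar>u \<omega>\<bar> \<le> B"
  shows "integrable M (\<lambda>\<omega>. (u \<omega>)\<^sup>2)"
proof (rule integrable_const_bound[where B = "B\<^sup>2"])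
  show "AE \<omega> in M. norm ((u \<omega>)\<^sup>2) \<le> B\<^sup>2"
    using power_mono[OF assms(2), where n = 2] by (intro AE_I2) auto
qed measurable

context bernoulli_shift
begin

text \<open>The condition says that the translates of \<open>g\<close> are martingale differences: the \<open>n\<close>-th one depends on the
coordinates from \<open>- n\<close> on and has conditional mean zero given those from \<open>1 - n\<close> on, so the
information increases with \<open>n\<close>.\<close>

definition mart_diff_class :: "((int \<Rightarrow> 'e) \<Rightarrow> real) set"
  where "mart_diff_class = {g \<in> L2 P (F {0..}). AE \<omega> in P. real_cond_exp P (F {1..}) g \<omega> = 0}"

lemma L2_measurable: "g \<in> L2 P (F K) \<Longrightarrow> g \<in> borel_measurable P"
  unfolding L2_def using measurable_F_P by blast

lemma L2_square_integrable: "g \<in> L2 P (F K) \<Longrightarrow> integrable P (\<lambda>\<omega>. (g \<omega>)\<^sup>2)"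
  unfolding L2_def by blast

lemma L2_integrable: "g \<in> L2 P (F K) \<Longrightarrow> integrable P g"
  by (rule P.square_integrable_imp_integrable) (auto intro: L2_measurable L2_square_integrable)

lemma mart_diff_class_L2: "g \<in> mart_diff_class \<Longrightarrow> g \<in> L2 P (F {0..})"
  unfolding mart_diff_class_def by simp

lemma mart_diff_shift:
  assumes g: "g \<in> mart_diff_class"
  shows "mart_diff P (\<lambda>n. F {1 - int n..}) (\<lambda>n \<omega>. g (int_shift (int n) \<omega>))"
proof
  fix n
  have g0: "g \<in> borel_measurable (F {0..})" "integrable P (\<lambda>\<omega>. (g \<omega>)\<^sup>2)"
    using mart_diff_class_L2[OF g] unfolding L2_def by auto
  show "subalgebra P (F {1 - int n..})" by (rule subalgebra_F)
  show "sets (F {1 - int n..}) \<subseteq> sets (F {1 - int (Suc n)..})" by (rule sets_F_mono) auto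
  have "int_shift (int n) \<in> measurable (F {1 - int (Suc n)..}) (F {0..})"
    by (rule int_shift_measurable_F) auto
  then show "(\<lambda>\<omega>. g (int_shift (int n) \<omega>)) \<in> borel_measurable (F {1 - int (Suc n)..})"
    by (rule measurable_compose) (rule g0)
  show "integrable P (\<lambda>\<omega>. (g (int_shift (int n) \<omega>))\<^sup>2)" by (rule integrable_int_shift[OF g0(2)])
  have "AE \<omega> in P. real_cond_exp P (F {1 - int n..}) (\<lambda>\<omega>. g (int_shift (int n) \<omega>)) \<omega>
      = real_cond_exp P (F {1..}) g (int_shift (int n) \<omega>)"
    by (rule cond_exp_int_shift[OF L2_integrable[OF mart_diff_class_L2[OF g]]]) auto
  moreover have "AE \<omega> in P. real_cond_exp P (F {1..}) g (int_shift (int n) \<omega>) = 0"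
    by (rule AE_int_shift) (use g in \<open>simp add: mart_diff_class_def\<close>)
  ultimately show "AE \<omega> in P. real_cond_exp P (F {1 - int n..}) (\<lambda>\<omega>. g (int_shift (int n) \<omega>)) \<omega> = 0"
    by eventually_elim simp
qed

text \<open>The conditional variances of the translates are the translates of one function with integral
\<open>(L2_seminorm P g)\<^sup>2\<close>, so the ergodic theorem bounds their averages.\<close>

lemma LIL_upper_shift:
  assumes g: "g \<in> mart_diff_class" and c: "L2_seminorm P g < c"
  shows "AE \<omega> in P. \<forall>\<^sub>F n in sequentially. (\<Sum>i<n. g (int_shift (int i) \<omega>)) \<le> c * lil_scale (real n)"
proof -
  interpret Y: mart_diff P "\<lambda>n. F {1 - int n..}" "\<lambda>n \<omega>. g (int_shift (int n) \<omega>)"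
    by (rule mart_diff_shift[OF g])
  interpret F1: sigma_finite_subalgebra P "F {1..}" by (rule sigma_finite_subalgebra_F)
  have g0: "g \<in> borel_measurable P" "integrable P (\<lambda>\<omega>. (g \<omega>)\<^sup>2)"
    using mart_diff_class_L2[OF g] by (auto intro: L2_measurable L2_square_integrable)
  define V where "V = real_cond_exp P (F {1..}) (\<lambda>\<omega>. (g \<omega>)\<^sup>2)"
  have V: "integrable P V" "(\<integral>\<omega>. V \<omega> \<partial>P) = (\<integral>\<omega>. (g \<omega>)\<^sup>2 \<partial>P)"
    unfolding V_def using F1.real_cond_exp_int[OF g0(2)] by auto
  have "AE \<omega> in P. Y.cond_var n \<omega> = V (int_shift (int n) \<omega>)" for n
    unfolding Y.cond_var_def V_def by (rule cond_exp_int_shift[OF g0(2)]) auto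
  then have cv: "AE \<omega> in P. \<forall>n. Y.cond_var n \<omega> = V (int_shift (int n) \<omega>)" by (simp add: AE_all_countable)
  show ?thesis
  proof (rule Y.LIL_upper[OF _ _ c])
    show "distr P borel (\<lambda>\<omega>. g (int_shift (int n) \<omega>)) = distr P borel (\<lambda>\<omega>. g (int_shift (int 0) \<omega>))" for n
      using distr_comp_int_shift[OF g0(1), of "int n"] by simp
    show "0 \<le> L2_seminorm P g" unfolding L2_seminorm_def by (intro real_sqrt_ge_zero) simp
    fix v assume "(L2_seminorm P g)\<^sup>2 < v"
    then have "(\<integral>\<omega>. V \<omega> \<partial>P) < v" unfolding V(2) L2_seminorm_def by simp
    from ergodic_averages_le[OF V(1) this] cv
    show "AE \<omega> in P. \<forall>\<^sub>F n in sequentially. (\<Sum>i<n. Y.cond_var i \<omega>) \<le> v * real n"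
      by eventually_elim simp
  qed
qed

lemma uminus_mart_diff_class:
  assumes g: "g \<in> mart_diff_class" shows "(\<lambda>\<omega>. - g \<omega>) \<in> mart_diff_class"
proof -
  interpret F1: sigma_finite_subalgebra P "F {1..}" by (rule sigma_finite_subalgebra_F)
  have "AE \<omega> in P. real_cond_exp P (F {1..}) (\<lambda>\<omega>. (- 1) * g \<omega>) \<omega> = (- 1) * real_cond_exp P (F {1..}) g \<omega>"
    by (rule F1.real_cond_exp_cmult[OF L2_integrable[OF mart_diff_class_L2[OF g]]])
  then show ?thesis using g unfolding mart_diff_class_def L2_def by auto
qed

lemma L2_seminorm_uminus: "L2_seminorm P (\<lambda>\<omega>. - g \<omega>) = L2_seminorm P g"
  unfolding L2_seminorm_def by simp

lemma LIL_upper_shift_abs: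
  assumes g: "g \<in> mart_diff_class" and c: "L2_seminorm P g < c"
  shows "AE \<omega> in P. \<forall>\<^sub>F n in sequentially. \<bar>\<Sum>i<n. g (int_shift (int i) \<omega>)\<bar> \<le> c * lil_scale (real n)"
proof -
  have "AE \<omega> in P. \<forall>\<^sub>F n in sequentially. (\<Sum>i<n. - g (int_shift (int i) \<omega>)) \<le> c * lil_scale (real n)"
    using LIL_upper_shift[OF uminus_mart_diff_class[OF g]] c by (simp add: L2_seminorm_uminus)
  with LIL_upper_shift[OF g c] show ?thesis
  proof eventually_elim
    case (elim \<omega>)
    then show ?case by eventually_elim (auto simp: sum_negf abs_le_iff)
  qed
qed

lemma mart_diff_class_diff:
  assumes "g \<in> mart_diff_class" "g' \<in> mart_diff_class"
  shows "(\<lambda>\<omega>. g \<omega> - g' \<omega>) \<in> mart_diff_class"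
proof -
  interpret F1: sigma_finite_subalgebra P "F {1..}" by (rule sigma_finite_subalgebra_F)
  have m: "g \<in> borel_measurable (F {0..})" "g' \<in> borel_measurable (F {0..})"
    and s: "integrable P (\<lambda>\<omega>. (g \<omega>)\<^sup>2)" "integrable P (\<lambda>\<omega>. (g' \<omega>)\<^sup>2)"
    using assms unfolding mart_diff_class_def L2_def by auto
  have [measurable]: "g \<in> borel_measurable P" "g' \<in> borel_measurable P" using m measurable_F_P by auto
  have "integrable P (\<lambda>\<omega>. (g \<omega> - g' \<omega>)\<^sup>2)"
    using integrable_square_add[of g P "\<lambda>\<omega>. - g' \<omega>"] s by simp
  moreover have "AE \<omega> in P. real_cond_exp P (F {1..}) (\<lambda>\<omega>. g \<omega> - g' \<omega>) \<omega> = 0"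
    using F1.real_cond_exp_diff[OF assms[THEN mart_diff_class_L2, THEN L2_integrable]] assms
    unfolding mart_diff_class_def by auto
  moreover have "(\<lambda>\<omega>. g \<omega> - g' \<omega>) \<in> borel_measurable (F {0..})" using m by measurable
  ultimately show ?thesis unfolding mart_diff_class_def L2_def by simp
qed

text \<open>Approximate \<open>g\<close> by a bounded function \<open>u\<close> of finitely many coordinates and subtract its conditional
expectation.  The error made by the subtraction is, up to sign, the conditional expectation of
\<open>g - u\<close>, because that of \<open>g\<close> vanishes; so it is no larger in norm than \<open>g - u\<close>.\<close>

lemma bounded_window_mart_diff_dense:
  assumes g: "g \<in> mart_diff_class" and e: "0 < e"
  shows "\<exists>m B g'. g' \<in> mart_diff_class \<and> g' \<in> borel_measurable (F {0..int m}) \<and> (\<forall>\<omega>. \<bar>g' \<omega>\<bar> \<le> B)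
    \<and> L2_seminorm P (\<lambda>\<omega>. g \<omega> - g' \<omega>) < e"
proof -
  interpret F1: sigma_finite_subalgebra P "F {1..}" by (rule sigma_finite_subalgebra_F)
  have gm: "g \<in> borel_measurable (F {0..})" "integrable P (\<lambda>\<omega>. (g \<omega>)\<^sup>2)"
    using mart_diff_class_L2[OF g] unfolding L2_def by auto
  have gi: "integrable P g" using L2_integrable[OF mart_diff_class_L2[OF g]] .
  have [measurable]: "g \<in> borel_measurable P" using gi by simp
  have "x \<in> {0..int (nat x)}" if "x \<in> {0..}" for x :: int using that by auto
  then have "{0..} \<subseteq> (\<Union>m. {0..int m})" by blast
  from L2_approx_by_bounded_window[OF this _ gm, of "e\<^sup>2 / 4"] e
  obtain m u B where u: "u \<in> borel_measurable (F {0..int m})" and uB: "\<And>\<omega>. \<bar>u \<omega>\<bar> \<le> B"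
    and gu: "(\<integral>\<omega>. (g \<omega> - u \<omega>)\<^sup>2 \<partial>P) < e\<^sup>2 / 4" by auto
  have [measurable]: "u \<in> borel_measurable P" using u by (rule measurable_F_P)
  have ui: "integrable P u" by (rule P.integrable_const_bound[where B=B]) (use uB in auto)
  have B0: "0 \<le> B" using uB[of undefined] by linarith
  interpret F1m: sigma_finite_subalgebra P "F {1..int m}" by (rule sigma_finite_subalgebra_F)
  define w where "w = real_cond_exp P (F {1..int m}) u"
  have w_F: "w \<in> borel_measurable (F {1..int m})" unfolding w_def by simp
  have cB: "AE \<omega> in P. real_cond_exp P (F {1..int m}) (\<lambda>\<omega>. b) \<omega> = b" for b :: real
    by (rule F1m.real_cond_exp_F_meas) auto
  have w_B: "AE \<omega> in P. \<bar>w \<omega>\<bar> \<le> B"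
  proof -
    have "AE \<omega> in P. w \<omega> \<le> real_cond_exp P (F {1..int m}) (\<lambda>\<omega>. B) \<omega>"
      unfolding w_def by (rule F1m.real_cond_exp_mono) (use uB ui in \<open>auto simp: abs_le_iff\<close>)
    moreover have "AE \<omega> in P. real_cond_exp P (F {1..int m}) (\<lambda>\<omega>. - B) \<omega> \<le> w \<omega>"
      unfolding w_def
    proof (rule F1m.real_cond_exp_mono)
      show "AE \<omega> in P. - B \<le> u \<omega>" using uB by (intro AE_I2) (metis abs_le_iff minus_le_iff)
    qed (use ui in auto)
    ultimately show ?thesis using cB[of B] cB[of "- B"] by eventually_elim auto
  qed
  \<comment> \<open>Clipping changes \<open>w\<close> on a null set only and makes the bound hold everywhere.\<close>
  define w' where "w' \<omega> = max (- B) (min B (w \<omega>))" for \<omega>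
  have w'_B: "\<bar>w' \<omega>\<bar> \<le> B" for \<omega> unfolding w'_def using B0 by auto
  have w'_F: "w' \<in> borel_measurable (F {1..int m})" unfolding w'_def[abs_def] using w_F by measurable
  have [measurable]: "w' \<in> borel_measurable P" using w'_F by (rule measurable_F_P)
  have w'_w: "AE \<omega> in P. w' \<omega> = w \<omega>" using w_B by eventually_elim (auto simp: w'_def)
  have w'i: "integrable P w'" by (rule P.integrable_const_bound[where B=B]) (use w'_B in auto)
  have un: "{1..int m} \<union> {int m + 1..} = {1..}" by auto
  have Eu: "AE \<omega> in P. real_cond_exp P (F {1..}) u \<omega> = w \<omega>"
    using cond_exp_independent_coords[OF ui u, of "{1..int m}" "{int m + 1..}"] unfolding un w_def by auto
  have Ew': "AE \<omega> in P. real_cond_exp P (F {1..}) w' \<omega> = w' \<omega>"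
    by (rule F1.real_cond_exp_F_meas[OF w'i]) (rule measurable_F_mono[OF _ w'_F], auto)
  define g' where "g' \<omega> = u \<omega> - w' \<omega>" for \<omega>
  have Eg': "AE \<omega> in P. real_cond_exp P (F {1..}) g' \<omega> = 0"
    unfolding g'_def[abs_def] using F1.real_cond_exp_diff[OF ui w'i] Eu Ew' w'_w by eventually_elim simp
  have g'_B: "\<bar>g' \<omega>\<bar> \<le> 2 * B" for \<omega> unfolding g'_def using uB[of \<omega>] w'_B[of \<omega>] by linarith
  have g'_F: "g' \<in> borel_measurable (F {0..int m})"
    unfolding g'_def[abs_def] using u measurable_F_mono[OF _ w'_F, of "{0..int m}"] by (intro borel_measurable_diff) auto
  have g'P[measurable]: "g' \<in> borel_measurable P" using g'_F by (rule measurable_F_P)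
  have g'_sq: "integrable P (\<lambda>\<omega>. (g' \<omega>)\<^sup>2)" by (rule P.integrable_square_bounded[OF g'P g'_B])
  have g'_class: "g' \<in> mart_diff_class"
    unfolding mart_diff_class_def L2_def using Eg' g'_sq measurable_F_mono[OF _ g'_F, of "{0..}"] by auto
  have int_gu: "integrable P (\<lambda>\<omega>. (g \<omega> - u \<omega>)\<^sup>2)"
    using integrable_square_add[of g P "\<lambda>\<omega>. - u \<omega>"] gm P.integrable_square_bounded[of u B] uB by simp
  define D where "D \<omega> = g \<omega> - u \<omega>" for \<omega>
  have Di: "integrable P D" unfolding D_def[abs_def] using gi ui by auto
  have D2: "integrable P (\<lambda>\<omega>. (D \<omega>)\<^sup>2)" unfolding D_def by (rule int_gu)
  have ED: "AE \<omega> in P. real_cond_exp P (F {1..}) D \<omega> = - w' \<omega>"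
    unfolding D_def[abs_def] using F1.real_cond_exp_diff[OF gi ui] Eu w'_w g unfolding mart_diff_class_def by auto
  have jens: "AE \<omega> in P. (real_cond_exp P (F {1..}) D \<omega>)\<^sup>2 \<le> real_cond_exp P (F {1..}) (\<lambda>\<omega>. (D \<omega>)\<^sup>2) \<omega>"
    by (rule F1.real_cond_exp_jensens_inequality(2)[where X = D and I = UNIV and q = "\<lambda>x. x\<^sup>2"]) (use Di D2 convex_power2 in auto)
  have w'2i: "integrable P (\<lambda>\<omega>. (w' \<omega>)\<^sup>2)"
    by (rule P.integrable_square_bounded[OF _ w'_B]) measurable
  have "(\<integral>\<omega>. (w' \<omega>)\<^sup>2 \<partial>P) \<le> (\<integral>\<omega>. real_cond_exp P (F {1..}) (\<lambda>\<omega>. (D \<omega>)\<^sup>2) \<omega> \<partial>P)"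
  proof (rule integral_mono_AE)
    show "integrable P (\<lambda>\<omega>. (w' \<omega>)\<^sup>2)" by (rule w'2i)
    show "integrable P (real_cond_exp P (F {1..}) (\<lambda>\<omega>. (D \<omega>)\<^sup>2))" by (rule F1.real_cond_exp_int(1)[OF D2])
    show "AE \<omega> in P. (w' \<omega>)\<^sup>2 \<le> real_cond_exp P (F {1..}) (\<lambda>\<omega>. (D \<omega>)\<^sup>2) \<omega>"
      using jens ED by eventually_elim simp
  qed
  also have "\<dots> = (\<integral>\<omega>. (D \<omega>)\<^sup>2 \<partial>P)" by (rule F1.real_cond_exp_int(2)[OF D2])
  finally have w'2: "(\<integral>\<omega>. (w' \<omega>)\<^sup>2 \<partial>P) \<le> (\<integral>\<omega>. (D \<omega>)\<^sup>2 \<partial>P)" .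
  have "(\<integral>\<omega>. (g \<omega> - g' \<omega>)\<^sup>2 \<partial>P) \<le> (\<integral>\<omega>. 2 * (D \<omega>)\<^sup>2 + 2 * (w' \<omega>)\<^sup>2 \<partial>P)"
  proof (rule integral_mono_AE')
    have "(g \<omega> - g' \<omega>)\<^sup>2 \<le> 2 * (D \<omega>)\<^sup>2 + 2 * (w' \<omega>)\<^sup>2" for \<omega>
    proof -
      have "g \<omega> - g' \<omega> = D \<omega> + w' \<omega>" unfolding D_def g'_def by simp
      then show ?thesis using square_sum_le[of "D \<omega>" "w' \<omega>"] by simp
    qed
    then show "AE \<omega> in P. (g \<omega> - g' \<omega>)\<^sup>2 \<le> 2 * (D \<omega>)\<^sup>2 + 2 * (w' \<omega>)\<^sup>2" by auto
  qed (use D2 w'2i in auto)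
  also have "\<dots> = 2 * (\<integral>\<omega>. (D \<omega>)\<^sup>2 \<partial>P) + 2 * (\<integral>\<omega>. (w' \<omega>)\<^sup>2 \<partial>P)" using D2 w'2i by simp
  also have "\<dots> < e\<^sup>2" using w'2 gu unfolding D_def by simp
  finally have "sqrt (\<integral>\<omega>. (g \<omega> - g' \<omega>)\<^sup>2 \<partial>P) < sqrt (e\<^sup>2)" by (rule real_sqrt_less_mono)
  then have "L2_seminorm P (\<lambda>\<omega>. g \<omega> - g' \<omega>) < e" unfolding L2_seminorm_def using e by simp
  then show ?thesis using g'_class g'_F g'_B by blast
qed

lemma mart_diff_orthogonal:
  assumes g: "g \<in> mart_diff_class" and ij: "i \<noteq> j"
  shows "integrable P (\<lambda>\<omega>. g (int_shift (int i) \<omega>) * g (int_shift (int j) \<omega>))"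
    and "(\<integral>\<omega>. g (int_shift (int i) \<omega>) * g (int_shift (int j) \<omega>) \<partial>P) = 0"
proof -
  interpret Y: mart_diff P "\<lambda>n. F {1 - int n..}" "\<lambda>n \<omega>. g (int_shift (int n) \<omega>)"
    by (rule mart_diff_shift[OF g])
  have int: "integrable P (\<lambda>\<omega>. g (int_shift (int i) \<omega>) * g (int_shift (int j) \<omega>))" for i j
  proof (rule Bochner_Integration.integrable_bound)
    show "integrable P (\<lambda>\<omega>. (g (int_shift (int i) \<omega>))\<^sup>2 + (g (int_shift (int j) \<omega>))\<^sup>2)"
      using Y.square_integrable by auto
    have "\<bar>a * b\<bar> \<le> a\<^sup>2 + b\<^sup>2" for a b :: real
      using zero_le_power2[of "\<bar>a\<bar> - \<bar>b\<bar>"] zero_le_power2[of a] zero_le_power2[of b]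
      unfolding power2_diff abs_mult power2_abs by linarith
    then show "AE \<omega> in P. norm (g (int_shift (int i) \<omega>) * g (int_shift (int j) \<omega>))
      \<le> norm ((g (int_shift (int i) \<omega>))\<^sup>2 + (g (int_shift (int j) \<omega>))\<^sup>2)"
      by (intro AE_I2) (simp add: order_trans[OF _ abs_ge_self])
  qed (use Y.Y_measurable in measurable)
  then show "integrable P (\<lambda>\<omega>. g (int_shift (int i) \<omega>) * g (int_shift (int j) \<omega>))" .
  have lt: "(\<integral>\<omega>. g (int_shift (int i) \<omega>) * g (int_shift (int j) \<omega>) \<partial>P) = 0" if "i < j" for i j
  proof -
    interpret S: sigma_finite_subalgebra P "F {1 - int j..}" by (rule sigma_finite_subalgebra_F)
    have "(\<integral>\<omega>. g (int_shift (int i) \<omega>) * g (int_shift (int j) \<omega>) \<partial>P)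
      = (\<integral>\<omega>. g (int_shift (int i) \<omega>) * real_cond_exp P (F {1 - int j..}) (\<lambda>\<omega>. g (int_shift (int j) \<omega>)) \<omega> \<partial>P)"
    proof (rule S.real_cond_exp_intg(2)[symmetric, OF int])
      show "(\<lambda>\<omega>. g (int_shift (int i) \<omega>)) \<in> borel_measurable (F {1 - int j..})"
        using Y.measurable_G_mono[OF _ Y.adapted[of i], of j] that by simp
    qed (rule Y.Y_measurable)
    also have "\<dots> = (\<integral>\<omega>. 0 \<partial>P)"
      by (rule integral_cong_AE) (use Y.mean_zero[of j] Y.Y_measurable in auto)
    finally show ?thesis by simp
  qed
  show "(\<integral>\<omega>. g (int_shift (int i) \<omega>) * g (int_shift (int j) \<omega>) \<partial>P) = 0"
    using lt[of i j] lt[of j i] ij by (cases "i < j") (auto simp: mult.commute)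
qed

lemma mart_diff_sum_square:
  assumes g: "g \<in> mart_diff_class" and S: "finite S"
  shows "integrable P (\<lambda>\<omega>. (\<Sum>i\<in>S. g (int_shift (int i) \<omega>))\<^sup>2)"
    and "(\<integral>\<omega>. (\<Sum>i\<in>S. g (int_shift (int i) \<omega>))\<^sup>2 \<partial>P) = real (card S) * (L2_seminorm P g)\<^sup>2"
proof -
  have g2: "integrable P (\<lambda>\<omega>. (g \<omega>)\<^sup>2)" and gm: "g \<in> borel_measurable P"
    using mart_diff_class_L2[OF g] by (auto intro: L2_square_integrable L2_measurable)
  have eq: "(\<Sum>i\<in>S. g (int_shift (int i) \<omega>))\<^sup>2 = (\<Sum>i\<in>S. \<Sum>j\<in>S. g (int_shift (int i) \<omega>) * g (int_shift (int j) \<omega>))" for \<omega>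
    by (simp add: power2_eq_square sum_product)
  have sq: "integrable P (\<lambda>\<omega>. g (int_shift (int i) \<omega>) * g (int_shift (int i) \<omega>))" for i
    using integrable_int_shift[OF g2, of "int i"] by (simp add: power2_eq_square)
  have int: "integrable P (\<lambda>\<omega>. g (int_shift (int i) \<omega>) * g (int_shift (int j) \<omega>))" for i j
    using mart_diff_orthogonal(1)[OF g, of i j] sq[of i] by (cases "i = j") auto
  show "integrable P (\<lambda>\<omega>. (\<Sum>i\<in>S. g (int_shift (int i) \<omega>))\<^sup>2)"
    unfolding eq using int by auto
  have "(\<integral>\<omega>. g (int_shift (int i) \<omega>) * g (int_shift (int j) \<omega>) \<partial>P) = (if i = j then (L2_seminorm P g)\<^sup>2 else 0)" for i j
    using mart_diff_orthogonal(2)[OF g, of i j] integral_int_shift[of "\<lambda>\<omega>. (g \<omega>)\<^sup>2" "int i"] gm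
    by (auto simp: L2_seminorm_def power2_eq_square)
  then have "(\<integral>\<omega>. (\<Sum>i\<in>S. g (int_shift (int i) \<omega>))\<^sup>2 \<partial>P) = (\<Sum>i\<in>S. \<Sum>j\<in>S. if i = j then (L2_seminorm P g)\<^sup>2 else 0)"
    unfolding eq using int by simp
  also have "\<dots> = real (card S) * (L2_seminorm P g)\<^sup>2" using S by simp
  finally show "(\<integral>\<omega>. (\<Sum>i\<in>S. g (int_shift (int i) \<omega>))\<^sup>2 \<partial>P) = real (card S) * (L2_seminorm P g)\<^sup>2" .
qed

end

section \<open>Independent events and Gaussian tails\<close>

text \<open>The probability that no event from \<open>n\<close> on occurs is at most the product of the \<open>1 - prob (A k)\<close>, hence
at most the exponential of minus a divergent sum.\<close>

lemma (in prob_space) borel_cantelli_independent: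
  assumes ind: "indep_sets G UNIV" and A: "\<And>k::nat. A k \<in> G k" "\<And>k. space M - A k \<in> G k"
    and div: "\<not> summable (\<lambda>k. prob (A k))"
  shows "AE \<omega> in M. \<exists>\<^sub>F k in sequentially. \<omega> \<in> A k"
proof -
  have ev[measurable]: "A k \<in> events" for k using ind A(1) unfolding indep_sets_def by blast
  have null: "AE \<omega> in M. \<exists>k\<ge>n. \<omega> \<in> A k" for n
  proof -
    define S where "S N = (\<Sum>k=n..<N. prob (A k))" for N
    have "prob {\<omega> \<in> space M. \<forall>k\<ge>n. \<omega> \<notin> A k} \<le> exp (- S N)" if N: "n < N" for N
    proof -
      have "prob {\<omega> \<in> space M. \<forall>k\<ge>n. \<omega> \<notin> A k} \<le> prob (\<Inter>k\<in>{n..<N}. space M - A k)"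
        using N by (intro finite_measure_mono) auto
      also have "\<dots> = (\<Prod>k\<in>{n..<N}. prob (space M - A k))"
        by (rule indep_setsD[OF ind]) (use N A(2) in auto)
      also have "\<dots> = (\<Prod>k\<in>{n..<N}. 1 - prob (A k))" by (intro prod.cong) (auto simp: prob_compl)
      also have "\<dots> \<le> (\<Prod>k\<in>{n..<N}. exp (- prob (A k)))"
      proof (intro prod_mono conjI)
        show "1 - prob (A k) \<le> exp (- prob (A k))" for k
          using exp_ge_add_one_self[of "- prob (A k)"] by simp
      qed simp
      also have "\<dots> = exp (- S N)" unfolding S_def by (simp add: exp_sum[symmetric] sum_negf)
      finally show ?thesis .
    qed
    note bd = this
    have "\<exists>N>n. - ln e \<le> S N" if "0 < e" for e
    proof (rule ccontr)
      assume "\<not> (\<exists>N>n. - ln e \<le> S N)"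
      then have le: "S N \<le> - ln e" if "n < N" for N using that by force
      have "summable (\<lambda>k. prob (A (k + n)))"
      proof (rule bounded_imp_summable)
        show "sum (\<lambda>k. prob (A (k + n))) {..N} \<le> - ln e" for N
        proof -
          have "sum (\<lambda>k. prob (A (k + n))) {..N} = S (Suc (N + n))"
            unfolding S_def using sum.shift_bounds_nat_ivl[of "\<lambda>k. prob (A k)" 0 n "Suc N"]
            by (simp add: atLeast0LessThan lessThan_Suc_atMost)
          then show ?thesis using le[of "Suc (N + n)"] by simp
        qed
      qed simp
      then show False using div summable_iff_shift[of "\<lambda>k. prob (A k)" n] by simp
    qed
    then have "prob {\<omega> \<in> space M. \<forall>k\<ge>n. \<omega> \<notin> A k} \<le> 0 + e" if e: "0 < e" for e
    proof -
      obtain N where N: "n < N" "- ln e \<le> S N" using \<open>\<And>e. 0 < e \<Longrightarrow> \<exists>N>n. - ln e \<le> S N\<close> e by blast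
      have "exp (- S N) \<le> exp (ln e)" using N by simp
      with bd[OF N(1)] e show ?thesis by simp
    qed
    then have "prob {\<omega> \<in> space M. \<forall>k\<ge>n. \<omega> \<notin> A k} \<le> 0" by (rule field_le_epsilon)
    then have "prob {\<omega> \<in> space M. \<forall>k\<ge>n. \<omega> \<notin> A k} = 0" by (simp add: measure_le_0_iff)
    moreover have "{\<omega> \<in> space M. \<forall>k\<ge>n. \<omega> \<notin> A k} \<in> events" by measurable
    ultimately have "AE \<omega> in M. \<omega> \<notin> {\<omega> \<in> space M. \<forall>k\<ge>n. \<omega> \<notin> A k}" by (simp add: prob_eq_0)
    then show ?thesis using AE_space by eventually_elim auto
  qed
  then have "AE \<omega> in M. \<forall>n. \<exists>k\<ge>n. \<omega> \<in> A k" by (simp add: AE_all_countable)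
  then show ?thesis by (simp add: frequently_sequentially)
qed

definition normal_tail :: "real \<Rightarrow> real"
  where "normal_tail y = 1 - cdf std_normal_distribution y"

text \<open>The density at the right end of \<open>{z<..z + 1}\<close> bounds the mass of this interval from below.\<close>

lemma normal_tail_ge:
  assumes "0 \<le> z" shows "exp (- (z + 1)\<^sup>2 / 2) / sqrt (2 * pi) \<le> normal_tail z"
proof -
  interpret N: prob_space std_normal_distribution by (rule prob_space_normal_density) simp
  interpret N: real_distribution std_normal_distribution by (rule real_dist_normal_dist)
  let ?c = "exp (- (z + 1)\<^sup>2 / 2) / sqrt (2 * pi)"
  have "ennreal ?c = (\<integral>\<^sup>+x. ennreal ?c * indicator {z<..z+1} x \<partial>lborel)"
    by (simp add: nn_integral_cmult)
  also have "\<dots> \<le> (\<integral>\<^sup>+x. ennreal (std_normal_density x) * indicator {z<..} x \<partial>lborel)"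
  proof (intro nn_integral_mono)
    fix x
    have "?c \<le> std_normal_density x" if "x \<in> {z<..z+1}"
    proof -
      have "x\<^sup>2 \<le> (z + 1)\<^sup>2" using that assms by (intro power_mono) auto
      then show ?thesis unfolding std_normal_density_def by (simp add: field_simps)
    qed
    then show "ennreal ?c * indicator {z<..z+1} x \<le> ennreal (std_normal_density x) * indicator {z<..} x"
      by (auto simp: indicator_def intro: ennreal_leI)
  qed
  also have "\<dots> = emeasure std_normal_distribution {z<..}" by (simp add: emeasure_density)
  also have "\<dots> = ennreal (N.prob {z<..})" by (simp add: N.emeasure_eq_measure)
  finally have "?c \<le> N.prob {z<..}" by simp
  also have "N.prob {z<..} = normal_tail z"
  proof -
    have sp: "{z<..} = space std_normal_distribution - {..z}" by auto
    show ?thesis unfolding normal_tail_def cdf_def sp by (rule N.prob_compl) simp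
  qed
  finally show ?thesis .
qed

lemma normal_tail_pos: "0 \<le> z \<Longrightarrow> 0 < normal_tail z"
proof -
  assume "0 \<le> z"
  have "0 < exp (- (z + 1)\<^sup>2 / 2) / sqrt (2 * pi)" using pi_gt_zero by (intro divide_pos_pos) auto
  with normal_tail_ge[OF \<open>0 \<le> z\<close>] show ?thesis by linarith
qed

lemma isCont_cdf_normal: "isCont (cdf std_normal_distribution) x"
proof -
  interpret N: real_distribution std_normal_distribution by (rule real_dist_normal_dist)
  have "emeasure std_normal_distribution {x} = (\<integral>\<^sup>+t. ennreal (std_normal_density t) * indicator {x} t \<partial>lborel)"
    by (simp add: emeasure_density)
  also have "\<dots> = 0"
    by (subst nn_integral_0_iff_AE) (auto intro!: AE_I[where N="{x}"] simp: indicator_def)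
  finally have "emeasure std_normal_distribution {x} = 0" .
  then have "measure std_normal_distribution {x} = 0" by (simp add: measure_def)
  then show ?thesis by (simp add: N.isCont_cdf)
qed

lemma (in prob_space) clt_tail:
  assumes X: "indep_vars (\<lambda>i. borel) X UNIV" "\<And>n. expectation (X n) = 0" "0 < s"
    "\<And>n. integrable M (\<lambda>x. (X n x)\<^sup>2)" "\<And>n. expectation (\<lambda>x. (X n x)\<^sup>2) = s\<^sup>2" "\<And>n. distr M borel (X n) = \<mu>"
  shows "(\<lambda>n. prob {\<omega> \<in> space M. y * sqrt (real n) * s < (\<Sum>i<n. X i \<omega>)}) \<longlonglongrightarrow> normal_tail y"
proof -
  have [measurable]: "X i \<in> borel_measurable M" for i using X(1) unfolding indep_vars_def by auto
  have "weak_conv_m (\<lambda>n. distr M borel (\<lambda>x. (\<Sum>i<n. X i x) / sqrt (real n * s\<^sup>2))) std_normal_distribution"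
    by (rule central_limit_theorem_zero_mean[OF X(1,2,3,4) _ X(6)]) (simp add: X(2,5))
  then have lim: "(\<lambda>n. cdf (distr M borel (\<lambda>x. (\<Sum>i<n. X i x) / sqrt (real n * s\<^sup>2))) y) \<longlonglongrightarrow> cdf std_normal_distribution y"
    unfolding weak_conv_m_def weak_conv_def using isCont_cdf_normal by blast
  have "\<forall>\<^sub>F n in sequentially. 1 - cdf (distr M borel (\<lambda>x. (\<Sum>i<n. X i x) / sqrt (real n * s\<^sup>2))) y
     = prob {\<omega> \<in> space M. y * sqrt (real n) * s < (\<Sum>i<n. X i \<omega>)}"
    using eventually_gt_at_top[of 0]
  proof eventually_elim
    case (elim n)
    have "(\<Sum>i<n. X i \<omega>) / sqrt (real n * s\<^sup>2) \<le> y \<longleftrightarrow> \<not> y * sqrt (real n) * s < (\<Sum>i<n. X i \<omega>)" for \<omega>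
      using elim X(3) by (simp add: real_sqrt_mult field_simps not_less)
    then have "cdf (distr M borel (\<lambda>x. (\<Sum>i<n. X i x) / sqrt (real n * s\<^sup>2))) y
        = prob (space M - {\<omega> \<in> space M. y * sqrt (real n) * s < (\<Sum>i<n. X i \<omega>)})"
      unfolding cdf_def by (subst measure_distr) (auto intro!: arg_cong[where f=prob])
    also have "\<dots> = 1 - prob {\<omega> \<in> space M. y * sqrt (real n) * s < (\<Sum>i<n. X i \<omega>)}"
      by (rule prob_compl) measurable
    finally show ?case by simp
  qed
  with tendsto_diff[OF tendsto_const[of 1] lim] show ?thesis
    unfolding normal_tail_def by (rule Lim_transform_eventually)
qed

section \<open>The lower half for bounded functions of finitely many coordinates\<close>

lemma (in prob_space) second_moment_tail:
  assumes X: "X \<in> borel_measurable M" "integrable M (\<lambda>\<omega>. (X \<omega>)\<^sup>2)" and a: "0 < (a::real)"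
  shows "prob {\<omega> \<in> space M. a \<le> \<bar>X \<omega>\<bar>} \<le> expectation (\<lambda>\<omega>. (X \<omega>)\<^sup>2) / a\<^sup>2"
proof -
  have "{\<omega> \<in> space M. a \<le> \<bar>X \<omega>\<bar>} = {\<omega> \<in> space M. a\<^sup>2 \<le> (X \<omega>)\<^sup>2}"
    using a by (auto simp: abs_le_square_iff[symmetric])
  then show ?thesis
    using integral_Markov_inequality_measure[OF X(2), of "{}" "a\<^sup>2"] a by simp
qed

text \<open>If \<open>g\<close> depends on the coordinates \<open>0, \<dots>, m\<close> only, then sums of its translates over blocks of times
separated by gaps of length \<open>m\<close> are independent.  Boundedness of \<open>g\<close> bounds the contribution of the gaps.\<close>

locale window_mart_diff = bernoulli_shift M for M :: "'e measure" +
  fixes g :: "(int \<Rightarrow> 'e) \<Rightarrow> real" and m :: nat and B :: real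
  assumes g_class: "g \<in> mart_diff_class" and g_window: "g \<in> borel_measurable (F {0..int m})"
    and g_bounded: "\<And>\<omega>. \<bar>g \<omega>\<bar> \<le> B" and g_pos: "0 < L2_seminorm P g"
begin

definition \<sigma> where "\<sigma> = L2_seminorm P g"

definition Y :: "nat \<Rightarrow> (int \<Rightarrow> 'e) \<Rightarrow> real"
  where "Y i \<omega> = g (int_shift (int i) \<omega>)"

definition S :: "nat \<Rightarrow> (int \<Rightarrow> 'e) \<Rightarrow> real"
  where "S n \<omega> = (\<Sum>i<n. Y i \<omega>)"

lemma sigma_pos: "0 < \<sigma>" unfolding \<sigma>_def by (rule g_pos)

lemma B_nonneg: "0 \<le> B" using g_bounded[of undefined] by linarith

lemma Y_bounded: "\<bar>Y i \<omega>\<bar> \<le> B" unfolding Y_def by (rule g_bounded)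

lemma Y_shift: "Y (i + j) \<omega> = Y i (int_shift (int j) \<omega>)"
  unfolding Y_def by simp

lemma g_P[measurable]: "g \<in> borel_measurable P"
  using g_window by (rule measurable_F_P)

lemma Y_P[measurable]: "Y i \<in> borel_measurable P"
  unfolding Y_def[abs_def] by measurable

lemma S_P[measurable]: "S n \<in> borel_measurable P"
  unfolding S_def[abs_def] by measurable

lemma Y_F: "{- int i..int m - int i} \<subseteq> K \<Longrightarrow> Y i \<in> borel_measurable (F K)"
proof -
  assume K: "{- int i..int m - int i} \<subseteq> K"
  have "int_shift (int i) \<in> measurable (F K) (F {0..int m})"
    by (rule int_shift_measurable_F) (use K in auto)
  then show ?thesis unfolding Y_def[abs_def] by (rule measurable_compose[OF _ g_window])
qed

lemma sum_Y_F:
  assumes "{1 - int (c + l)..int m - int c} \<subseteq> K"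
  shows "(\<lambda>\<omega>. \<Sum>i=c..<c+l. Y i \<omega>) \<in> borel_measurable (F K)"
proof (rule borel_measurable_sum)
  fix i assume "i \<in> {c..<c + l}"
  then show "Y i \<in> borel_measurable (F K)" using assms by (intro Y_F) auto
qed

lemma sum_Y_shift: "(\<Sum>i=c..<c+l. Y i \<omega>) = S l (int_shift (int c) \<omega>)"
  unfolding S_def using sum.shift_bounds_nat_ivl[of "\<lambda>i. Y i \<omega>" 0 c l]
  by (simp add: atLeast0LessThan add.commute Y_shift)

lemma sum_bounded: "\<bar>\<Sum>i\<in>A. Y i \<omega>\<bar> \<le> real (card A) * B"
proof -
  have "(\<Sum>i\<in>A. \<bar>Y i \<omega>\<bar>) \<le> real (card A) * B" by (rule sum_bounded_above) (rule Y_bounded)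
  with sum_abs[of "\<lambda>i. Y i \<omega>" A] show ?thesis by linarith
qed

lemma expectation_Y: "P.expectation (Y i) = 0"
proof -
  interpret F1: sigma_finite_subalgebra P "F {1..}" by (rule sigma_finite_subalgebra_F)
  have gi: "integrable P g" using L2_integrable[OF mart_diff_class_L2[OF g_class]] .
  have "(\<integral>\<omega>. g \<omega> \<partial>P) = (\<integral>\<omega>. real_cond_exp P (F {1..}) g \<omega> \<partial>P)"
    using F1.real_cond_exp_int(2)[OF gi] by simp
  also have "\<dots> = (\<integral>\<omega>. 0 \<partial>P)"
    by (rule integral_cong_AE) (use g_class in \<open>auto simp: mart_diff_class_def\<close>)
  finally show ?thesis unfolding Y_def using integral_int_shift[OF g_P] by simp
qed

lemma sum_square:
  assumes "finite A"
  shows "integrable P (\<lambda>\<omega>. (\<Sum>i\<in>A. Y i \<omega>)\<^sup>2)" "P.expectation (\<lambda>\<omega>. (\<Sum>i\<in>A. Y i \<omega>)\<^sup>2) = real (card A) * \<sigma>\<^sup>2"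
  using mart_diff_sum_square[OF g_class assms] unfolding Y_def \<sigma>_def by auto

lemma Y_integrable: "integrable P (Y i)"
  by (rule P.integrable_const_bound[where B=B]) (use Y_bounded in auto)

text \<open>Omitting the last \<open>m\<close> terms of each block of length \<open>L\<close> leaves independent, identically
distributed sums, to which the central limit theorem applies; by orthogonality their variance is
\<open>(L - m) * \<sigma>\<^sup>2\<close>.\<close>

lemma block_tail:
  assumes L: "m < L"
  shows "(\<lambda>n. P.prob {\<omega> \<in> space P. y * sqrt (real n) * (\<sigma> * sqrt (real (L - m))) < (\<Sum>j<n. \<Sum>i=j*L..<j*L+(L-m). Y i \<omega>)})
    \<longlonglongrightarrow> normal_tail y"
proof -
  define Z where "Z j \<omega> = (\<Sum>i=j*L..<j*L+(L-m). Y i \<omega>)" for j \<omega>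
  define K where "K j = {1 - int (j*L+(L-m))..int m - int (j*L)}" for j
  have Z_F: "Z j \<in> borel_measurable (F (K j))" for j
    unfolding Z_def[abs_def] K_def by (rule sum_Y_F) simp
  have Z_P[measurable]: "Z j \<in> borel_measurable P" for j using Z_F by (rule measurable_F_P)
  have disj: "disjoint_family_on K UNIV"
  proof -
    have "K i \<inter> K j = {}" if "i < j" for i j
    proof -
      have "i * L + L \<le> j * L" using that mult_le_mono1[of "Suc i" j L] by simp
      then have "int m - int (j * L) < 1 - int (i * L + (L - m))" using L by linarith
      then show ?thesis unfolding K_def by auto
    qed
    then show ?thesis unfolding disjoint_family_on_def by (metis Int_commute linorder_neqE_nat)
  qed
  have "P.indep_vars (\<lambda>_. borel) Z UNIV"
    unfolding P.indep_vars_def2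
  proof (intro conjI ballI)
    show "P.indep_sets (\<lambda>j. {Z j -` A \<inter> space P | A. A \<in> sets borel}) UNIV"
    proof (rule P.indep_sets_mono_sets[OF indep_coord_algebras[OF disj]])
      show "{Z j -` A \<inter> space P | A. A \<in> sets borel} \<subseteq> sets (F (K j))" for j
        using measurable_sets[OF Z_F[of j]] by auto
    qed
  qed simp
  then have "(\<lambda>n. P.prob {\<omega> \<in> space P. y * sqrt (real n) * (\<sigma> * sqrt (real (L - m))) < (\<Sum>j<n. Z j \<omega>)}) \<longlonglongrightarrow> normal_tail y"
  proof (rule P.clt_tail)
    show "P.expectation (Z j) = 0" for j
      unfolding Z_def[abs_def] using Y_integrable expectation_Y by simp
    show "0 < \<sigma> * sqrt (real (L - m))" using sigma_pos L by simp
    show "integrable P (\<lambda>\<omega>. (Z j \<omega>)\<^sup>2)" for j unfolding Z_def by (rule sum_square) simp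
    show "P.expectation (\<lambda>\<omega>. (Z j \<omega>)\<^sup>2) = (\<sigma> * sqrt (real (L - m)))\<^sup>2" for j
      unfolding Z_def by (subst sum_square) (auto simp: power_mult_distrib)
    show "distr P borel (Z j) = distr P borel (S (L - m))" for j
      unfolding Z_def[abs_def] sum_Y_shift by (rule distr_comp_int_shift) simp
  qed
  then show ?thesis unfolding Z_def .
qed

text \<open>This is the lower half of a central limit theorem, with a loss that is harmless for large \<open>y\<close>.  The
omitted terms of the blocks form a proportion \<open>m / L\<close> of all terms, so for large \<open>L\<close> their sum is small
with high probability by Chebyshev's inequality; the terms of an incomplete last block are bounded.\<close>

lemma sum_tail_ge:
  assumes y: "0 < y"
  shows "\<forall>\<^sub>F l in sequentially. normal_tail (y + 1) / 2 \<le> P.prob {\<omega> \<in> space P. y * \<sigma> * sqrt (real l) \<le> S l \<omega>}"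
proof -
  define q where "q = normal_tail (y + 1)"
  have q: "0 < q" unfolding q_def using y by (intro normal_tail_pos) simp
  have "\<forall>\<^sub>F L in sequentially. real m < real L \<and> (y + 1/2) / (y + 1) \<le> sqrt ((real L - real m) / real L) \<and> 16 * real m / real L \<le> q / 4"
  proof (intro eventually_conj)
    show "\<forall>\<^sub>F L in sequentially. real m < real L" by real_asymp
    have "(\<lambda>L. sqrt ((real L - real m) / real L)) \<longlonglongrightarrow> 1" by real_asymp
    moreover have "(y + 1/2) / (y + 1) < 1" using y by (simp add: field_simps)
    ultimately have "\<forall>\<^sub>F L in sequentially. (y + 1/2) / (y + 1) < sqrt ((real L - real m) / real L)"
      by (rule order_tendstoD(1))
    then show "\<forall>\<^sub>F L in sequentially. (y + 1/2) / (y + 1) \<le> sqrt ((real L - real m) / real L)"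
      by eventually_elim simp
    have "(\<lambda>L. 16 * real m / real L) \<longlonglongrightarrow> 0" by real_asymp
    then have "\<forall>\<^sub>F L in sequentially. 16 * real m / real L < q / 4"
      by (rule order_tendstoD(2)) (use q in simp)
    then show "\<forall>\<^sub>F L in sequentially. 16 * real m / real L \<le> q / 4" by eventually_elim simp
  qed
  then obtain L :: nat where L: "m < L" "(y + 1/2) / (y + 1) \<le> sqrt ((real L - real m) / real L)" "16 * real m / real L \<le> q / 4"
    by (auto simp: eventually_sequentially)
  have L': "(y + 1/2) * sqrt (real L) \<le> (y + 1) * sqrt (real (L - m))"
  proof -
    have "sqrt (real (L - m)) = sqrt ((real L - real m) / real L) * sqrt (real L)"
      unfolding real_sqrt_mult[symmetric] using L(1) by (simp add: of_nat_diff)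
    moreover have "(y + 1/2) \<le> (y + 1) * sqrt ((real L - real m) / real L)"
      using L(2) y by (simp add: field_simps)
    ultimately show ?thesis by (simp add: mult_right_mono mult.assoc[symmetric])
  qed
  define T where "T n \<omega> = (\<Sum>j<n. \<Sum>i=j*L..<j*L+(L-m). Y i \<omega>)" for n \<omega>
  define G where "G n = (\<Union>j<n. {j*L+(L-m)..<j*L+L})" for n
  have [measurable]: "T n \<in> borel_measurable P" for n unfolding T_def[abs_def] by measurable
  have decomp: "S (n * L) \<omega> = T n \<omega> + (\<Sum>i\<in>G n. Y i \<omega>)" for n \<omega>
  proof -
    have "S (n * L) \<omega> = (\<Sum>j<n. \<Sum>i=j*L..<j*L+L. Y i \<omega>)"
      unfolding S_def by (simp add: sum.nat_group)
    also have "\<dots> = (\<Sum>j<n. (\<Sum>i=j*L..<j*L+(L-m). Y i \<omega>) + (\<Sum>i=j*L+(L-m)..<j*L+L. Y i \<omega>))"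
      using L(1) by (intro sum.cong refl sum.atLeastLessThan_concat[symmetric]) auto
    also have "\<dots> = T n \<omega> + (\<Sum>j<n. \<Sum>i=j*L+(L-m)..<j*L+L. Y i \<omega>)"
      unfolding T_def by (simp add: sum.distrib)
    also have "(\<Sum>j<n. \<Sum>i=j*L+(L-m)..<j*L+L. Y i \<omega>) = (\<Sum>i\<in>G n. Y i \<omega>)"
      unfolding G_def
    proof (rule sum.UNION_disjoint[symmetric])
      show "\<forall>i\<in>{..<n}. \<forall>j\<in>{..<n}. i \<noteq> j \<longrightarrow> {i*L+(L-m)..<i*L+L} \<inter> {j*L+(L-m)..<j*L+L} = {}"
      proof (intro ballI impI)
        fix i j :: nat assume "i \<noteq> j"
        then have "i * L + L \<le> j * L \<or> j * L + L \<le> i * L"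
          using mult_le_mono1[of "Suc i" j L] mult_le_mono1[of "Suc j" i L] by (cases "i < j") auto
        then show "{i*L+(L-m)..<i*L+L} \<inter> {j*L+(L-m)..<j*L+L} = {}" by auto
      qed
    qed auto
    finally show ?thesis .
  qed
  have G_fin: "finite (G n)" for n unfolding G_def by auto
  have G_card: "card (G n) \<le> n * m" for n
  proof -
    have "card (G n) \<le> (\<Sum>j<n. card {j*L+(L-m)..<j*L+L})" unfolding G_def by (rule card_UN_le) simp
    also have "\<dots> = n * m" using L(1) by simp
    finally show ?thesis .
  qed
  have gap: "P.prob {\<omega> \<in> space P. \<sigma> * sqrt (real l) / 4 \<le> \<bar>\<Sum>i\<in>G (l div L). Y i \<omega>\<bar>} \<le> q / 4" if l: "0 < l" for l
  proof -
    have pos: "0 < \<sigma> * sqrt (real l) / 4" using sigma_pos l by simp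
    have "P.prob {\<omega> \<in> space P. \<sigma> * sqrt (real l) / 4 \<le> \<bar>\<Sum>i\<in>G (l div L). Y i \<omega>\<bar>}
      \<le> real (card (G (l div L))) * \<sigma>\<^sup>2 / (\<sigma> * sqrt (real l) / 4)\<^sup>2"
      using P.second_moment_tail[OF _ sum_square(1)[OF G_fin] pos] unfolding sum_square(2)[OF G_fin] by simp
    also have "\<dots> = 16 * real (card (G (l div L))) / real l"
      using sigma_pos l by (simp add: power_mult_distrib power_divide)
    also have "\<dots> \<le> 16 * (real l / real L * real m) / real l"
    proof (intro divide_right_mono mult_left_mono)
      have "real (card (G (l div L))) \<le> real (l div L) * real m" using G_card[of "l div L"] of_nat_mono by fastforce
      also have "\<dots> \<le> real l / real L * real m" 
      proof (rule mult_right_mono)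
        have "real (l div L) * real L \<le> real l"
          by (metis of_nat_mult of_nat_mono div_times_less_eq_dividend)
        then show "real (l div L) \<le> real l / real L" using L(1) by (simp add: pos_le_divide_eq)
      qed simp
      finally show "real (card (G (l div L))) \<le> real l / real L * real m" .
    qed auto
    also have "\<dots> = 16 * real m / real L" using l by simp
    finally show ?thesis using L(3) by simp
  qed
  have "\<forall>\<^sub>F n in sequentially. 3 / 4 * q < P.prob {\<omega> \<in> space P. (y + 1) * sqrt (real n) * (\<sigma> * sqrt (real (L - m))) < T n \<omega>}"
    unfolding T_def by (rule order_tendstoD(1)[OF block_tail[OF L(1)]]) (use q in \<open>simp add: q_def\<close>)
  then have ev1: "\<forall>\<^sub>F l in sequentially. 3 / 4 * q < P.prob {\<omega> \<in> space P. (y + 1) * sqrt (real (l div L)) * (\<sigma> * sqrt (real (L - m))) < T (l div L) \<omega>}"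
  proof -
    assume "\<forall>\<^sub>F n in sequentially. 3 / 4 * q < P.prob {\<omega> \<in> space P. (y + 1) * sqrt (real n) * (\<sigma> * sqrt (real (L - m))) < T n \<omega>}"
    then obtain n0 where n0: "\<And>n. n0 \<le> n \<Longrightarrow> 3 / 4 * q < P.prob {\<omega> \<in> space P. (y + 1) * sqrt (real n) * (\<sigma> * sqrt (real (L - m))) < T n \<omega>}"
      by (auto simp: eventually_sequentially)
    have "n0 \<le> l div L" if "n0 * L \<le> l" for l
      using div_le_mono[OF that, of L] L(1) by simp
    then show ?thesis unfolding eventually_sequentially using n0 by blast
  qed
  have "filterlim (\<lambda>l. sqrt (real l)) at_top sequentially" by real_asymp
  then have ev2: "\<forall>\<^sub>F l in sequentially. 4 * ((y + 1/2) * sqrt (real L) + real L * B / \<sigma>) \<le> sqrt (real l)"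
    by (simp add: filterlim_at_top)
  show ?thesis
    using ev1 ev2 eventually_gt_at_top[of 0]
  proof eventually_elim
    case (elim l)
    define n where "n = l div L"
    define E1 where "E1 = {\<omega> \<in> space P. (y + 1) * sqrt (real n) * (\<sigma> * sqrt (real (L - m))) < T n \<omega>}"
    define E2 where "E2 = {\<omega> \<in> space P. \<sigma> * sqrt (real l) / 4 \<le> \<bar>\<Sum>i\<in>G n. Y i \<omega>\<bar>}"
    have [measurable]: "E1 \<in> sets P" "E2 \<in> sets P" unfolding E1_def E2_def by measurable
    have "E1 - E2 \<subseteq> {\<omega> \<in> space P. y * \<sigma> * sqrt (real l) \<le> S l \<omega>}"
    proof
      fix \<omega> assume \<omega>: "\<omega> \<in> E1 - E2"
      have sp: "\<omega> \<in> space P" using \<omega> unfolding E1_def by simp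
      have T: "(y + 1) * sqrt (real n) * (\<sigma> * sqrt (real (L - m))) < T n \<omega>" using \<omega> unfolding E1_def by simp
      have Gb: "\<bar>\<Sum>i\<in>G n. Y i \<omega>\<bar> < \<sigma> * sqrt (real l) / 4" using \<omega> sp unfolding E2_def by auto
      have nl: "n * L \<le> l" unfolding n_def by simp
      have "l - n * L \<le> L" unfolding n_def using L(1) by (simp add: minus_div_mult_eq_mod less_imp_le)
      then have lnL: "real l \<le> real (n * L) + real L" using nl by linarith
      have rest: "S (n * L) \<omega> - real L * B \<le> S l \<omega>"
      proof -
        have "S l \<omega> = S (n * L) \<omega> + (\<Sum>i=n*L..<l. Y i \<omega>)"
          unfolding S_def using nl sum.atLeastLessThan_concat[of 0 "n * L" l "\<lambda>i. Y i \<omega>"] by (simp add: atLeast0LessThan)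
        moreover have "\<bar>\<Sum>i=n*L..<l. Y i \<omega>\<bar> \<le> real L * B"
        proof -
          have "\<bar>\<Sum>i=n*L..<l. Y i \<omega>\<bar> \<le> real (card {n*L..<l}) * B" by (rule sum_bounded)
          also have "\<dots> \<le> real L * B" using \<open>l - n * L \<le> L\<close> B_nonneg by (intro mult_right_mono) auto
          finally show ?thesis .
        qed
        ultimately show ?thesis by linarith
      qed
      have "\<sigma> * ((y + 1/2) * (sqrt (real l) - sqrt (real L))) \<le> \<sigma> * ((y + 1/2) * (sqrt (real n) * sqrt (real L)))"
      proof (intro mult_left_mono)
        have "sqrt (real l) \<le> sqrt (real (n * L) + real L)" using lnL by simp
        also have "\<dots> \<le> sqrt (real (n * L)) + sqrt (real L)" by (rule sqrt_add_le_add_sqrt) auto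
        finally show "sqrt (real l) - sqrt (real L) \<le> sqrt (real n) * sqrt (real L)" by (simp add: real_sqrt_mult)
      qed (use sigma_pos y in auto)
      also have "\<dots> = sqrt (real n) * \<sigma> * ((y + 1/2) * sqrt (real L))" by simp
      also have "\<dots> \<le> sqrt (real n) * \<sigma> * ((y + 1) * sqrt (real (L - m)))"
        using L' sigma_pos by (intro mult_left_mono) auto
      also have "\<dots> = (y + 1) * sqrt (real n) * (\<sigma> * sqrt (real (L - m)))" by simp
      finally have T': "\<sigma> * ((y + 1/2) * (sqrt (real l) - sqrt (real L))) \<le> T n \<omega>" using T by simp
      have "S l \<omega> \<ge> T n \<omega> - \<bar>\<Sum>i\<in>G n. Y i \<omega>\<bar> - real L * B" using rest decomp[of n \<omega>] by linarith
      then have "S l \<omega> \<ge> \<sigma> * ((y + 1/2) * (sqrt (real l) - sqrt (real L))) - \<sigma> * sqrt (real l) / 4 - real L * B"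
        using T' Gb by linarith
      moreover have "\<sigma> * (4 * ((y + 1/2) * sqrt (real L) + real L * B / \<sigma>)) \<le> \<sigma> * sqrt (real l)"
        using elim(2) sigma_pos by (intro mult_left_mono) auto
      then have "4 * (\<sigma> * ((y + 1/2) * sqrt (real L))) + 4 * (real L * B) \<le> \<sigma> * sqrt (real l)"
        using sigma_pos by (simp add: distrib_left)
      moreover have "\<sigma> * ((y + 1/2) * (sqrt (real l) - sqrt (real L)))
          = y * \<sigma> * sqrt (real l) + \<sigma> * sqrt (real l) / 2 - \<sigma> * ((y + 1/2) * sqrt (real L))"
        by (simp add: algebra_simps)
      ultimately have "y * \<sigma> * sqrt (real l) \<le> S l \<omega>" by linarith
      then show "\<omega> \<in> {\<omega> \<in> space P. y * \<sigma> * sqrt (real l) \<le> S l \<omega>}" using sp by simp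
    qed
    then have "P.prob (E1 - E2) \<le> P.prob {\<omega> \<in> space P. y * \<sigma> * sqrt (real l) \<le> S l \<omega>}"
      by (intro P.finite_measure_mono) auto
    moreover have "P.prob E1 \<le> P.prob (E1 - E2) + P.prob E2"
    proof -
      have "P.prob E1 \<le> P.prob ((E1 - E2) \<union> E2)" by (intro P.finite_measure_mono) auto
      also have "\<dots> \<le> P.prob (E1 - E2) + P.prob E2" by (rule measure_Un_le) auto
      finally show ?thesis .
    qed
    moreover have "P.prob E2 \<le> q / 4" using gap[OF elim(3)] unfolding E2_def n_def .
    moreover have "3 / 4 * q < P.prob E1" using elim(1) unfolding E1_def n_def .
    ultimately show ?case unfolding q_def by linarith
  qed
qed

end

text \<open>For large \<open>y\<close> the shift of the argument by \<open>1\<close>, the factor \<open>1 / 2\<close> and the polynomial corrections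
are all absorbed by an arbitrarily small increase of the exponent.\<close>

lemma normal_tail_eventually_ge:
  assumes d: "0 < (\<delta>::real)"
  shows "\<forall>\<^sub>F y in at_top. exp (- (1 + \<delta>) * y\<^sup>2 / 2) \<le> normal_tail (y + 1) / 2"
proof -
  define C where "C = 2 * sqrt (2 * pi)"
  have C: "0 < C" unfolding C_def using pi_gt_zero by simp
  have "\<forall>\<^sub>F y in at_top. ln C \<le> \<delta> * y\<^sup>2 / 2 - 2 * y - 2"
    using d by real_asymp
  then show ?thesis using eventually_ge_at_top[of 0]
  proof eventually_elim
    case (elim y)
    have "exp (- (1 + \<delta>) * y\<^sup>2 / 2) \<le> exp (- (y + 2)\<^sup>2 / 2 - ln C)"
    proof -
      have "- (1 + \<delta>) * y\<^sup>2 / 2 = - (y + 2)\<^sup>2 / 2 - (\<delta> * y\<^sup>2 / 2 - 2 * y - 2)"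
        by (simp add: power2_eq_square field_simps)
      with elim(1) show ?thesis by simp
    qed
    also have "\<dots> = exp (- (y + 2)\<^sup>2 / 2) / sqrt (2 * pi) / 2"
      unfolding exp_diff using C by (simp add: C_def)
    finally have "exp (- (1 + \<delta>) * y\<^sup>2 / 2) \<le> exp (- (y + 2)\<^sup>2 / 2) / sqrt (2 * pi) / 2" .
    note le1 = this
    have le2: "exp (- (y + 2)\<^sup>2 / 2) / sqrt (2 * pi) \<le> normal_tail (y + 1)"
      using normal_tail_ge[of "y + 1"] elim by (simp add: add.assoc)
    from le1 divide_right_mono[OF le2 zero_le_numeral] show ?case by (rule order_trans)
  qed
qed

lemma not_summable_log_powr:
  assumes C: "0 < (C::real)" and r: "1 < (r::real)" and b: "b < 1"
    and f: "\<forall>\<^sub>F k in sequentially. C * exp (- b * ln (ln (r ^ Suc k))) \<le> f k"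
  shows "\<not> summable f"
proof
  assume s: "summable f"
  have "\<forall>\<^sub>F k in sequentially. norm (C * ln r powr (- b) * real (Suc k) powr (- b)) \<le> f k"
    using f
  proof eventually_elim
    case (elim k)
    have "ln (r ^ Suc k) = real (Suc k) * ln r" using r by (simp add: ln_realpow del: power_Suc)
    then have "exp (- b * ln (ln (r ^ Suc k))) = (real (Suc k) * ln r) powr (- b)"
      unfolding powr_def using r by (simp del: of_nat_Suc power_Suc)
    also have "\<dots> = ln r powr (- b) * real (Suc k) powr (- b)" using r by (simp add: powr_mult)
    finally show ?case using elim C by (simp del: of_nat_Suc power_Suc)
  qed
  from summable_comparison_test_ev[OF this s]
  have "summable (\<lambda>k. C * ln r powr (- b) * real (Suc k) powr (- b))" .
  then have "summable (\<lambda>k. real (Suc k) powr (- b))" using C r by (simp add: summable_cmult_iff)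
  then have "summable (\<lambda>k. real k powr (- b))" by (subst (asm) summable_Suc_iff)
  then show False using b by (simp add: summable_real_powr_iff)
qed

context window_mart_diff
begin

text \<open>The constants come from the last step of the lower bound: \<open>a\<close> is the fraction of the scale gained by the
blocks, the factor \<open>1 - 1 / r\<close> and the term \<open>1 / r\<close> account for the length of the range and for the
gaps, and the last term accounts for the sum before the range begins.\<close>

lemma exists_ratio:
  assumes c: "c < \<sigma>"
  shows "\<exists>a r. 0 < a \<and> a < 1 \<and> 2 \<le> r \<and> c < \<sigma> * (a * (1 - 1 / real r) - 1 / real r - 2 * sqrt (2 / real r))"
proof -
  define a where "a = max (1/2) ((c / \<sigma> + 1) / 2)"
  have "c / \<sigma> < 1" using c sigma_pos by simp
  moreover have "z < (z + 1) / 2" if "z < 1" for z :: real using that by simp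
  ultimately have "c / \<sigma> < (c / \<sigma> + 1) / 2" by blast
  also have "\<dots> \<le> a" unfolding a_def by simp
  finally have a: "0 < a" "a < 1" "c / \<sigma> < a" using \<open>c / \<sigma> < 1\<close> unfolding a_def by auto
  have "(\<lambda>r. a * (1 - 1 / real r) - 1 / real r - 2 * sqrt (2 / real r)) \<longlonglongrightarrow> a" by real_asymp
  then have "\<forall>\<^sub>F r in sequentially. c / \<sigma> < a * (1 - 1 / real r) - 1 / real r - 2 * sqrt (2 / real r)"
    by (rule order_tendstoD) (rule a)
  with eventually_ge_at_top[of 2]
  have "\<forall>\<^sub>F r in sequentially. 2 \<le> r \<and> c / \<sigma> < a * (1 - 1 / real r) - 1 / real r - 2 * sqrt (2 / real r)"
    by eventually_elim simp
  then obtain r :: nat where "2 \<le> r" "c / \<sigma> < a * (1 - 1 / real r) - 1 / real r - 2 * sqrt (2 / real r)"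
    unfolding eventually_sequentially by blast
  then show ?thesis using a sigma_pos by (intro exI[of _ a] exI[of _ r]) (simp add: pos_divide_less_eq mult.commute)
qed

text \<open>Cut the times between \<open>r ^ k\<close> and \<open>r ^ Suc k\<close> into about \<open>2 * a\<^sup>2 * ln (ln (r ^ Suc k)) / y\<^sup>2\<close> blocks and
require each block sum to exceed \<open>y\<close> times its standard deviation.  Then the blocks together contribute
about \<open>a * \<sigma>\<close> times the scale.  A single block succeeds with probability at least about \<open>exp (- y\<^sup>2 / 2)\<close>, so
by independence all of them do with probability about \<open>k powr - a\<^sup>2\<close>, whose sum diverges.  By the second
Borel--Cantelli lemma this happens for infinitely many \<open>k\<close>.  The sum up to the beginning of the range is
controlled by the upper half of the law of the iterated logarithm and is a small fraction of the scale
if \<open>r\<close> is large.\<close>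

proposition LIL_lower_window:
  assumes c0: "0 \<le> c" and c: "c < \<sigma>"
  shows "AE \<omega> in P. \<exists>\<^sub>F n in sequentially. c * lil_scale (real n) < S n \<omega>"
proof -
  obtain a r where a: "0 < a" "a < 1" and r: "2 \<le> r"
    and ar: "c < \<sigma> * (a * (1 - 1 / real r) - 1 / real r - 2 * sqrt (2 / real r))"
    using exists_ratio[OF c] by blast
  \<comment> \<open>With this loss in the exponent, the probabilities below are of order \<open>k powr - b\<close>, still with \<open>b < 1\<close>.\<close>
  define \<delta> where "\<delta> = (1 / a\<^sup>2 - 1) / 2"
  have a2: "a\<^sup>2 < 1" using a by (simp add: power_less_one_iff)
  then have d: "0 < \<delta>" unfolding \<delta>_def using a by (simp add: field_simps)
  define b where "b = (1 + \<delta>) * a\<^sup>2"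
  have b: "b < 1" unfolding b_def \<delta>_def using a a2 by (simp add: field_simps)
  have "\<forall>\<^sub>F y in at_top. 1 \<le> y \<and> exp (- (1 + \<delta>) * y\<^sup>2 / 2) \<le> normal_tail (y + 1) / 2"
    using eventually_ge_at_top[of 1] normal_tail_eventually_ge[OF d] by (rule eventually_conj)
  then obtain y :: real where y: "1 \<le> y" "exp (- (1 + \<delta>) * y\<^sup>2 / 2) \<le> normal_tail (y + 1) / 2"
    unfolding eventually_at_top_linorder by blast
  define q where "q = exp (- (1 + \<delta>) * y\<^sup>2 / 2)"
  have "\<forall>\<^sub>F l in sequentially. q \<le> P.prob {\<omega> \<in> space P. y * \<sigma> * sqrt (real l) \<le> S l \<omega>}"
    using sum_tail_ge[of y] y unfolding q_def by (auto elim: eventually_mono)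
  then obtain l0 where l0: "\<And>l. l0 \<le> l \<Longrightarrow> q \<le> P.prob {\<omega> \<in> space P. y * \<sigma> * sqrt (real l) \<le> S l \<omega>}"
    by (auto simp: eventually_sequentially)

  \<comment> \<open>The \<open>k\<close>-th range of times is cut into \<open>p k\<close> blocks of length \<open>l k\<close> separated by gaps of \<open>m\<close>.\<close>
  define x where "x k = real r ^ Suc k" for k
  define L where "L k = ln (ln (x k))" for k
  define p where "p k = nat \<lceil>2 * a\<^sup>2 * L k / y\<^sup>2\<rceil>" for k
  define l where "l k = (r ^ Suc k - r ^ k - m) div p k - m" for k
  define t where "t k s = r ^ k + m + s * (l k + m)" for k s
  define e where "e k = t k (p k)" for k
  define good where "good k \<longleftrightarrow> 0 < p k \<and> 0 < l k \<and> e k \<le> r ^ Suc k" for k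
  define H where "H k s = {\<omega> \<in> space P. y * \<sigma> * sqrt (real (l k)) \<le> (\<Sum>i=t k s..<t k s + l k. Y i \<omega>)}" for k s
  define A where "A k = (if good k then \<Inter>s\<in>{..<p k}. H k s else {})" for k
  define K where "K k = {1 - int (r ^ Suc k)..- int (r ^ k)}" for k

  have tsum: "(\<lambda>\<omega>. \<Sum>i=t k s..<t k s + l k. Y i \<omega>) \<in> borel_measurable (F {1 - int (t k s + l k)..int m - int (t k s)})" for k s
    by (rule sum_Y_F) simp
  have H_F: "H k s \<in> sets (F {1 - int (t k s + l k)..int m - int (t k s)})" for k s
  proof -
    have "H k s = {\<omega> \<in> space (F {1 - int (t k s + l k)..int m - int (t k s)}). y * \<sigma> * sqrt (real (l k)) \<le> (\<Sum>i=t k s..<t k s + l k. Y i \<omega>)}"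
      unfolding H_def by simp
    also have "\<dots> \<in> sets (F {1 - int (t k s + l k)..int m - int (t k s)})"
      by (rule borel_measurable_le) (use tsum[of k s] in auto)
    finally show ?thesis .
  qed
  have A_F: "A k \<in> sets (F (K k))" for k
  proof (cases "good k")
    case True
    have "H k s \<in> sets (F (K k))" if s: "s < p k" for s
    proof -
      have "Suc s * (l k + m) \<le> p k * (l k + m)" using s by (intro mult_le_mono1) simp
      then have "t k s + l k \<le> r ^ Suc k" using True unfolding good_def e_def t_def by simp
      then have "{1 - int (t k s + l k)..int m - int (t k s)} \<subseteq> K k"
      proof -
        assume le: "t k s + l k \<le> r ^ Suc k"
        have "int (t k s + l k) \<le> int (r ^ Suc k)" using le by (simp only: of_nat_le_iff)
        moreover have "int (r ^ k) + int m \<le> int (t k s)"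
          unfolding t_def by (simp only: of_nat_add[symmetric] of_nat_le_iff)
        ultimately show ?thesis unfolding K_def by auto
      qed
      then show ?thesis using H_F[of k s] sets_F_mono by blast
    qed
    then show ?thesis using True unfolding A_def good_def by (auto intro!: sets.finite_INT)
  next
    case False
    then show ?thesis unfolding A_def by simp
  qed
  have K_disj: "disjoint_family_on K UNIV"
  proof -
    have "K i \<inter> K j = {}" if "i < j" for i j
    proof -
      have "r ^ Suc i \<le> r ^ j" using that r by (intro power_increasing) auto
      then show ?thesis unfolding K_def by (auto simp del: power_Suc of_nat_power)
    qed
    then show ?thesis unfolding disjoint_family_on_def by (metis Int_commute linorder_neqE_nat)
  qed
  have PH: "P.prob (H k s) = P.prob {\<omega> \<in> space P. y * \<sigma> * sqrt (real (l k)) \<le> S (l k) \<omega>}" for k s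
  proof -
    have "H k s = int_shift (int (t k s)) -` {\<omega> \<in> space P. y * \<sigma> * sqrt (real (l k)) \<le> S (l k) \<omega>} \<inter> space P"
      unfolding H_def sum_Y_shift by (auto simp: int_shift_space)
    moreover have "{\<omega> \<in> space P. y * \<sigma> * sqrt (real (l k)) \<le> S (l k) \<omega>} \<in> sets P" by measurable
    ultimately show ?thesis by (simp only: prob_int_shift)
  qed
  have PA: "P.prob (A k) = (P.prob {\<omega> \<in> space P. y * \<sigma> * sqrt (real (l k)) \<le> S (l k) \<omega>}) ^ p k" if gk: "good k" for k
  proof -
    have disj: "disjoint_family_on (\<lambda>s. {1 - int (t k s + l k)..int m - int (t k s)}) UNIV"
    proof -
      have "{1 - int (t k i + l k)..int m - int (t k i)} \<inter> {1 - int (t k j + l k)..int m - int (t k j)} = {}" if "i < j" for i j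
      proof -
        have "Suc i * (l k + m) \<le> j * (l k + m)" using that by (intro mult_le_mono1) simp
        then have "t k i + l k + m \<le> t k j" unfolding t_def by simp
        then have "int (t k i + l k) + int m \<le> int (t k j)" by linarith
        then show ?thesis by auto
      qed
      then show ?thesis unfolding disjoint_family_on_def by (metis Int_commute linorder_neqE_nat)
    qed
    have "P.prob (\<Inter>s\<in>{..<p k}. H k s) = (\<Prod>s\<in>{..<p k}. P.prob (H k s))"
      by (rule P.indep_setsD[OF indep_coord_algebras[OF disj]]) (use H_F gk in \<open>auto simp: good_def\<close>)
    then show ?thesis using gk unfolding A_def PH by simp
  qed

  have xlim: "filterlim x at_top sequentially"
  proof -
    have "1 < real r" using r by simp
    then show ?thesis unfolding x_def[abs_def] by real_asymp
  qed
  have r': "2 \<le> real r" using r by simp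
  define D where "D z = z * (1 - 1 / real r)" for z
  have D_pos: "0 < 1 - 1 / real r" using r' by (simp add: field_simps)
  \<comment> \<open>The number of blocks will be at most \<open>2 * ln (ln z) + 1\<close>.  The last three conditions then say that
    the blocks are long, that gaps and roundings use up a small part of the range, and that the terms in the
    gaps add up to little.\<close>
  have growth: "\<forall>\<^sub>F z in at_top. 27 * real r \<le> z \<and> real m \<le> z / real r
      \<and> (real l0 + 2 * real m + 2) * (2 * ln (ln z) + 1) + real m \<le> z * (1 - 1 / real r)
      \<and> real m + (2 * ln (ln z) + 1) * (1 + real m) \<le> z * (1 - 1 / real r) * (1 / real r)
      \<and> (2 * ln (ln z) + 1) * real m * B \<le> \<sigma> / real r * lil_scale z"
  proof (intro eventually_conj)
    define w where "w = 1 - 1 / real r"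
    define v where "v = 1 / real r"
    have wv: "0 < w" "0 < v" unfolding w_def v_def using D_pos r' by auto
    define n1 n2 where "n1 = real l0 + 2 * real m + 2" and "n2 = real m"
    show "\<forall>\<^sub>F z in at_top. 27 * real r \<le> z" by (rule eventually_ge_at_top)
    have "\<forall>\<^sub>F z in at_top. n2 \<le> z * v" using wv by real_asymp
    then show "\<forall>\<^sub>F z in at_top. real m \<le> z / real r" unfolding n2_def v_def by simp
    have "\<forall>\<^sub>F z in at_top. n1 * (2 * ln (ln z) + 1) + n2 \<le> z * w" using wv by real_asymp
    then show "\<forall>\<^sub>F z in at_top. (real l0 + 2 * real m + 2) * (2 * ln (ln z) + 1) + real m \<le> z * (1 - 1 / real r)"
      unfolding n1_def n2_def w_def .
    have "\<forall>\<^sub>F z in at_top. n2 + (2 * ln (ln z) + 1) * (1 + n2) \<le> z * (w * v)"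
      using mult_pos_pos[OF wv] by real_asymp
    then show "\<forall>\<^sub>F z in at_top. real m + (2 * ln (ln z) + 1) * (1 + real m) \<le> z * (1 - 1 / real r) * (1 / real r)"
      unfolding n2_def w_def v_def by (simp only: mult.assoc)
    define u n3 where "u = \<sigma> / real r" and "n3 = real m * B"
    have u: "0 < u" unfolding u_def using sigma_pos r' by simp
    have "\<forall>\<^sub>F z in at_top. (2 * ln (ln z) + 1) * n3 \<le> u * sqrt (2 * z * ln (ln z))"
      using u by real_asymp
    then show "\<forall>\<^sub>F z in at_top. (2 * ln (ln z) + 1) * real m * B \<le> \<sigma> / real r * lil_scale z"
      unfolding u_def n3_def lil_scale_def by (simp only: mult.assoc)
  qed
  have growth_k: "\<forall>\<^sub>F k in sequentially. 27 * real r \<le> x k \<and> real m \<le> x k / real r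
      \<and> (real l0 + 2 * real m + 2) * (2 * L k + 1) + real m \<le> D (x k)
      \<and> real m + (2 * L k + 1) * (1 + real m) \<le> D (x k) * (1 / real r)
      \<and> (2 * L k + 1) * real m * B \<le> \<sigma> / real r * lil_scale (x k)"
    using filterlim_iff[THEN iffD1, OF xlim, rule_format, OF growth] unfolding L_def D_def .
  have facts: "good k" "l0 \<le> l k" "1 \<le> L k" "real (p k) \<le> 2 * a\<^sup>2 * L k / y\<^sup>2 + 1" "2 * a\<^sup>2 * L k / y\<^sup>2 \<le> real (p k)"
      "real (p k) \<le> 2 * L k + 1" "D (x k) * (1 - 1 / real r) \<le> real (p k) * real (l k)"
    if k: "27 * real r \<le> x k" "real m \<le> x k / real r"
      "(real l0 + 2 * real m + 2) * (2 * L k + 1) + real m \<le> D (x k)"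
      "real m + (2 * L k + 1) * (1 + real m) \<le> D (x k) * (1 / real r)" for k
  proof -
    have "27 * 1 \<le> 27 * real r" using r' by (intro mult_left_mono) auto
    then have x27: "27 \<le> x k" using k(1) by linarith
    show L1: "1 \<le> L k" unfolding L_def using ln_ln_ge_1[OF x27] by simp
    have y2: "1 \<le> y\<^sup>2" using y(1) by (simp add: one_le_power)
    have pos: "0 < 2 * a\<^sup>2 * L k / y\<^sup>2" using L1 a y2 by (intro divide_pos_pos mult_pos_pos) auto
    show p_le: "real (p k) \<le> 2 * a\<^sup>2 * L k / y\<^sup>2 + 1" unfolding p_def using pos by linarith
    show p_ge: "2 * a\<^sup>2 * L k / y\<^sup>2 \<le> real (p k)" unfolding p_def using pos by linarith
    have p0: "0 < p k" using p_ge pos by (intro gr0I) auto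
    have "2 * a\<^sup>2 * L k / y\<^sup>2 \<le> 2 * 1 * L k / 1"
      using L1 a2 y2 by (intro frac_le mult_right_mono mult_left_mono) auto
    then show p_L: "real (p k) \<le> 2 * L k + 1" using p_le by linarith
    define d where "d = r ^ Suc k - r ^ k"
    have rk: "r ^ k \<le> r ^ Suc k" using r by (intro power_increasing) auto
    have dD: "real d = D (x k)"
      unfolding d_def D_def x_def using rk r by (simp add: of_nat_diff field_simps)
    have "(real l0 + 2 * real m + 2) * real (p k) + real m \<le> real d"
      using k(3) p_L mult_left_mono[OF p_L, of "real l0 + 2 * real m + 2"] unfolding dD by linarith
    then have dn: "(l0 + 2 * m + 2) * p k + m \<le> d"
      by (metis (no_types, lifting) of_nat_add of_nat_le_iff of_nat_mult of_nat_numeral)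
    then have "(l0 + 2 * m + 2) * p k \<le> d - m" by linarith
    then have ge: "l0 + 2 * m + 2 \<le> (d - m) div p k"
      using p0 by (simp add: less_eq_div_iff_mult_less_eq)
    have lk: "l k + m = (d - m) div p k" unfolding l_def d_def[symmetric] using ge by linarith
    show "l0 \<le> l k" using lk ge by linarith
    have "p k * (l k + m) \<le> d - m" unfolding lk by simp
    then have "e k \<le> r ^ k + m + (d - m)" unfolding e_def t_def by simp
    also have "\<dots> = r ^ Suc k" unfolding d_def using dn rk unfolding d_def by linarith
    finally have ek: "e k \<le> r ^ Suc k" .
    show "good k" unfolding good_def using p0 lk ge ek by linarith
    have "d - m < p k * (l k + m) + p k"
      unfolding lk using p0 by (metis add.commute dividend_less_times_div mult.commute)
    then have "real d - real m < real (p k) * (real (l k) + real m) + real (p k)"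
      using of_nat_less_iff[of "d - m" "p k * (l k + m) + p k", where ?'a=real] dn by (simp add: of_nat_diff)
    then have "D (x k) - (real m + real (p k) * (1 + real m)) \<le> real (p k) * real (l k)"
      unfolding dD by (simp add: algebra_simps)
    moreover have "real (p k) * (1 + real m) \<le> (2 * L k + 1) * (1 + real m)"
      using p_L by (intro mult_right_mono) auto
    moreover have "D (x k) * (1 - 1 / real r) = D (x k) - D (x k) * (1 / real r)" by (simp add: algebra_simps)
    ultimately show "D (x k) * (1 - 1 / real r) \<le> real (p k) * real (l k)" using k(4) by linarith
  qed

  have "\<not> summable (\<lambda>k. P.prob (A k))"
  proof (rule not_summable_log_powr[where r = "real r" and b = b and C = q])
    show "0 < q" unfolding q_def by simp
    show "1 < real r" using r by simp
    show "\<forall>\<^sub>F k in sequentially. q * exp (- b * ln (ln (real r ^ Suc k))) \<le> P.prob (A k)"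
      using growth_k
    proof eventually_elim
      case (elim k)
      then have gk: "good k" and lk: "l0 \<le> l k" and p_le: "real (p k) \<le> 2 * a\<^sup>2 * L k / y\<^sup>2 + 1"
        using facts[of k] by auto
      have "q * exp (- b * L k) = exp (- (1 + \<delta>) * y\<^sup>2 / 2 * (2 * a\<^sup>2 * L k / y\<^sup>2 + 1))"
        unfolding q_def b_def exp_add[symmetric] using y(1) by (simp add: field_simps)
      also have "\<dots> \<le> exp (- (1 + \<delta>) * y\<^sup>2 / 2 * real (p k))"
        using mult_left_mono[OF p_le, of "(1 + \<delta>) * y\<^sup>2 / 2"] d by simp
      also have "\<dots> = q ^ p k" unfolding q_def by (simp add: exp_of_nat_mult[symmetric] mult.commute)
      also have "\<dots> \<le> P.prob {\<omega> \<in> space P. y * \<sigma> * sqrt (real (l k)) \<le> S (l k) \<omega>} ^ p k"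
        by (rule power_mono[OF l0[OF lk]]) (simp add: q_def)
      also have "\<dots> = P.prob (A k)" using PA[OF gk] by simp
      finally show ?case unfolding L_def x_def .
    qed
  qed (rule b)
  from P.borel_cantelli_independent[OF indep_coord_algebras[OF K_disj] A_F _ this]
  have io: "AE \<omega> in P. \<exists>\<^sub>F k in sequentially. \<omega> \<in> A k"
    using A_F sets.compl_sets[OF A_F] by simp

  have two: "L2_seminorm P g < 2 * \<sigma>" using sigma_pos unfolding \<sigma>_def by simp
  have up: "AE \<omega> in P. \<forall>\<^sub>F n in sequentially. \<bar>S n \<omega>\<bar> \<le> 2 * \<sigma> * lil_scale (real n)"
    using LIL_upper_shift_abs[OF g_class two] unfolding S_def Y_def .
  define Z where "Z = \<sigma> * (a * (1 - 1 / real r) - 1 / real r - 2 * sqrt (2 / real r))"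
  show ?thesis
    using io up
  proof eventually_elim
    case (elim \<omega>)
    obtain n0 where n0: "\<And>n. n0 \<le> n \<Longrightarrow> \<bar>S n \<omega>\<bar> \<le> 2 * \<sigma> * lil_scale (real n)"
      using elim(2) by (auto simp: eventually_sequentially)
    have rlim: "filterlim (\<lambda>k. r ^ k) at_top sequentially"
      by (rule filterlim_subseq) (use r in \<open>auto simp: strict_mono_def intro!: power_strict_increasing\<close>)
    have "\<exists>n\<ge>N. c * lil_scale (real n) < S n \<omega>" for N
    proof -
      have "\<forall>\<^sub>F k in sequentially. max N n0 \<le> r ^ k"
        using rlim unfolding filterlim_at_top by blast
      from frequently_eventually_frequently[OF elim(1) eventually_conj[OF this growth_k]]
      obtain k where A: "\<omega> \<in> A k" and N: "N \<le> r ^ k" "n0 \<le> r ^ k" and k: "27 * real r \<le> x k" "real m \<le> x k / real r"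
        "(real l0 + 2 * real m + 2) * (2 * L k + 1) + real m \<le> D (x k)"
        "real m + (2 * L k + 1) * (1 + real m) \<le> D (x k) * (1 / real r)"
        and gapk: "(2 * L k + 1) * real m * B \<le> \<sigma> / real r * lil_scale (x k)"
        by (auto dest!: frequently_ex)
      note f = facts[OF k]
      have "27 * 1 \<le> 27 * real r" using r' by (intro mult_left_mono) auto
      then have x27: "27 \<le> x k" using k(1) by linarith
      have lil: "lil_scale (x k) = sqrt (2 * x k * L k)" unfolding lil_scale_def L_def ..
      have blocks: "y * \<sigma> * sqrt (real (l k)) \<le> (\<Sum>i=t k s..<t k s + l k. Y i \<omega>)" if "s < p k" for s
        using A f(1) that unfolding A_def H_def by auto
      have step: "S (t k s) \<omega> + real s * (y * \<sigma> * sqrt (real (l k)) - real m * B) \<le> S (t k s) \<omega> + (S (t k s) \<omega> - S (t k 0) \<omega>)" if "s \<le> p k" for s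
        using that
      proof (induction s)
        case 0
        then show ?case by simp
      next
        case (Suc s)
        have "S (t k (Suc s)) \<omega> = S (t k s) \<omega> + (\<Sum>i=t k s..<t k s + l k. Y i \<omega>) + (\<Sum>i=t k s + l k..<t k s + l k + m. Y i \<omega>)"
        proof -
          have "t k (Suc s) = t k s + l k + m" unfolding t_def by simp
          then show ?thesis unfolding S_def
            using sum.atLeastLessThan_concat[of 0 "t k s" "t k s + l k" "\<lambda>i. Y i \<omega>"]
              sum.atLeastLessThan_concat[of 0 "t k s + l k" "t k s + l k + m" "\<lambda>i. Y i \<omega>"]
            by (simp add: atLeast0LessThan)
        qed
        moreover have "\<bar>\<Sum>i=t k s + l k..<t k s + l k + m. Y i \<omega>\<bar> \<le> real m * B"
          using sum_bounded[of \<omega> "{t k s + l k..<t k s + l k + m}"] by simp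
        moreover have "real (Suc s) * (y * \<sigma> * sqrt (real (l k)) - real m * B)
          = real s * (y * \<sigma> * sqrt (real (l k)) - real m * B) + (y * \<sigma> * sqrt (real (l k)) - real m * B)"
          by (simp add: algebra_simps)
        ultimately show ?case using Suc blocks[of s] by linarith
      qed
      have main: "S (t k 0) \<omega> + real (p k) * (y * \<sigma> * sqrt (real (l k))) - real (p k) * (real m * B) \<le> S (e k) \<omega>"
        using step[of "p k"] unfolding e_def by (simp add: algebra_simps)
      have gap: "real (p k) * (real m * B) \<le> \<sigma> / real r * lil_scale (x k)"
      proof -
        have "real (p k) * (real m * B) \<le> (2 * L k + 1) * (real m * B)"
          using f(6) B_nonneg by (intro mult_right_mono) auto
        then show ?thesis using gapk by (simp only: mult.assoc)
      qed
      have blk: "\<sigma> * (a * (1 - 1 / real r)) * lil_scale (x k) \<le> real (p k) * (y * \<sigma> * sqrt (real (l k)))"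
      proof -
        have ypos: "0 < y" using y by simp
        have "sqrt (2 * a\<^sup>2 * L k / y\<^sup>2) * sqrt (D (x k) * (1 - 1 / real r)) \<le> sqrt (real (p k)) * sqrt (real (p k) * real (l k))"
        proof (rule mult_mono[OF real_sqrt_le_mono[OF f(5)] real_sqrt_le_mono[OF f(7)]])
          show "0 \<le> sqrt (D (x k) * (1 - 1 / real r))"
            unfolding D_def using x27 D_pos by (intro real_sqrt_ge_zero mult_nonneg_nonneg) auto
        qed simp
        also have "\<dots> = real (p k) * sqrt (real (l k))" by (simp add: real_sqrt_mult)
        also have "sqrt (2 * a\<^sup>2 * L k / y\<^sup>2) * sqrt (D (x k) * (1 - 1 / real r)) = a * (1 - 1 / real r) / y * lil_scale (x k)"
        proof -
          have "sqrt (2 * a\<^sup>2 * L k / y\<^sup>2) * sqrt (D (x k) * (1 - 1 / real r))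
            = sqrt ((a * (1 - 1 / real r) / y)\<^sup>2 * (2 * x k * L k))"
            unfolding real_sqrt_mult[symmetric] D_def by (simp add: power2_eq_square)
          also have "\<dots> = a * (1 - 1 / real r) / y * lil_scale (x k)"
            unfolding lil real_sqrt_mult[of "_\<^sup>2"] using a ypos D_pos by simp
          finally show ?thesis .
        qed
        finally have "y * \<sigma> * (a * (1 - 1 / real r) / y * lil_scale (x k)) \<le> y * \<sigma> * (real (p k) * sqrt (real (l k)))"
          using ypos sigma_pos by (intro mult_left_mono) auto
        then show ?thesis using ypos by (simp add: ac_simps)
      qed
      have start: "- (2 * \<sigma> * (sqrt (2 / real r) * lil_scale (x k))) \<le> S (t k 0) \<omega>"
      proof -
        have t0: "t k 0 = r ^ k + m" unfolding t_def by simp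
        have xr: "real (r ^ k) = x k / real r" unfolding x_def using r by simp
        have le: "real (t k 0) \<le> 2 * x k / real r" unfolding t0 using k(2) xr by simp
        have ge: "27 \<le> real (t k 0)"
        proof -
          have "27 \<le> x k / real r" using k(1) r' by (simp add: pos_le_divide_eq)
          then show ?thesis unfolding t0 using xr by simp
        qed
        have "real (t k 0) \<le> x k"
        proof -
          have "2 * x k / real r \<le> 2 * x k / 2" using r' x27 by (intro divide_left_mono) auto
          then show ?thesis using le by simp
        qed
        then have LL: "ln (ln (real (t k 0))) \<le> L k" unfolding L_def using ge by (intro ln_ln_mono) auto
        have "lil_scale (real (t k 0)) \<le> sqrt (2 * (2 * x k / real r) * L k)"
          unfolding lil_scale_def using le LL ge order_trans[OF _ ln_ln_ge_1(1)[OF ge], of 1] ln_ln_ge_1(2)[OF ge] x27 r'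
          by (intro real_sqrt_le_mono mult_mono) auto
        also have "\<dots> = sqrt (2 / real r) * lil_scale (x k)"
          unfolding lil real_sqrt_mult[symmetric] by (simp add: field_simps)
        finally have "2 * \<sigma> * lil_scale (real (t k 0)) \<le> 2 * \<sigma> * (sqrt (2 / real r) * lil_scale (x k))"
          using sigma_pos by (intro mult_left_mono) auto
        moreover have "\<bar>S (t k 0) \<omega>\<bar> \<le> 2 * \<sigma> * lil_scale (real (t k 0))"
          by (rule n0) (use N in \<open>simp add: t0\<close>)
        ultimately show ?thesis by linarith
      qed
      have "Z * lil_scale (x k) = \<sigma> * (a * (1 - 1 / real r)) * lil_scale (x k) - \<sigma> / real r * lil_scale (x k)
          - 2 * \<sigma> * (sqrt (2 / real r) * lil_scale (x k))"
        unfolding Z_def by (simp add: algebra_simps)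
      then have Zle: "Z * lil_scale (x k) \<le> S (e k) \<omega>" using main gap blk start by linarith
      have ek: "real (e k) \<le> x k"
      proof -
        have "e k \<le> r ^ Suc k" using f(1) unfolding good_def by simp
        then have "real (e k) \<le> real (r ^ Suc k)" by (rule of_nat_mono)
        then show ?thesis unfolding x_def by simp
      qed
      have rk_e: "r ^ k \<le> e k" unfolding e_def t_def by simp
      have e27: "27 \<le> real (e k)"
      proof -
        have "27 \<le> x k / real r" using k(1) r' by (simp add: pos_le_divide_eq)
        also have "\<dots> = real (r ^ k)" unfolding x_def using r by simp
        also have "\<dots> \<le> real (e k)" using rk_e by (rule of_nat_mono)
        finally show ?thesis .
      qed
      have "c * lil_scale (real (e k)) < S (e k) \<omega>"
      proof -
        have "c * lil_scale (real (e k)) \<le> c * lil_scale (x k)"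
          using c0 by (intro mult_left_mono lil_scale_mono e27 ek)
        also have "\<dots> < Z * lil_scale (x k)"
          using ar lil_scale_pos[OF x27] unfolding Z_def by (intro mult_strict_right_mono) auto
        finally show ?thesis using Zle by simp
      qed
      then show ?thesis using rk_e N by (intro exI[of _ "e k"]) auto
    qed
    then show ?case by (simp add: frequently_sequentially)
  qed
qed

end

section \<open>Coboundaries\<close>

lemma L2_seminorm_nonneg: "0 \<le> L2_seminorm N u"
  unfolding L2_seminorm_def by (intro real_sqrt_ge_zero) simp

lemma L2_seminorm_triangle:
  assumes u[measurable]: "u \<in> borel_measurable N" "v \<in> borel_measurable N"
    and sq: "integrable N (\<lambda>\<omega>. (u \<omega>)\<^sup>2)" "integrable N (\<lambda>\<omega>. (v \<omega>)\<^sup>2)"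
  shows "L2_seminorm N (\<lambda>\<omega>. u \<omega> + v \<omega>) \<le> L2_seminorm N u + L2_seminorm N v"
proof (rule field_le_epsilon)
  fix e :: real assume e: "0 < e"
  define a b where "a = L2_seminorm N u + e / 2" and "b = L2_seminorm N v + e / 2"
  have ab: "0 < a" "0 < b" unfolding a_def b_def using e L2_seminorm_nonneg[of N u] L2_seminorm_nonneg[of N v] by auto
  have ua: "(\<integral>\<omega>. (u \<omega>)\<^sup>2 \<partial>N) \<le> a\<^sup>2" and vb: "(\<integral>\<omega>. (v \<omega>)\<^sup>2 \<partial>N) \<le> b\<^sup>2"
  proof -
    have "(\<integral>\<omega>. (w \<omega>)\<^sup>2 \<partial>N) = (L2_seminorm N w)\<^sup>2" for w unfolding L2_seminorm_def by simp
    then show "(\<integral>\<omega>. (u \<omega>)\<^sup>2 \<partial>N) \<le> a\<^sup>2" "(\<integral>\<omega>. (v \<omega>)\<^sup>2 \<partial>N) \<le> b\<^sup>2"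
      unfolding a_def b_def using e L2_seminorm_nonneg[of N u] L2_seminorm_nonneg[of N v]
      by (auto intro!: power_mono)
  qed
  \<comment> \<open>With these weights the right-hand side integrates to at most \<open>(a + b)\<^sup>2\<close>.\<close>
  have pt: "(s + t)\<^sup>2 \<le> (1 + b / a) * s\<^sup>2 + (1 + a / b) * t\<^sup>2" for s t :: real
  proof -
    have "0 \<le> (b * s - a * t)\<^sup>2 / (a * b)" using ab by simp
    also have "\<dots> = b / a * s\<^sup>2 + a / b * t\<^sup>2 - 2 * s * t"
      using ab by (simp add: power2_eq_square field_simps)
    finally show ?thesis by (simp add: power2_eq_square algebra_simps)
  qed
  have "(\<integral>\<omega>. (u \<omega> + v \<omega>)\<^sup>2 \<partial>N) \<le> (\<integral>\<omega>. (1 + b / a) * (u \<omega>)\<^sup>2 + (1 + a / b) * (v \<omega>)\<^sup>2 \<partial>N)"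
    by (rule integral_mono_AE') (use sq pt ab in auto)
  also have "\<dots> = (1 + b / a) * (\<integral>\<omega>. (u \<omega>)\<^sup>2 \<partial>N) + (1 + a / b) * (\<integral>\<omega>. (v \<omega>)\<^sup>2 \<partial>N)"
    using sq by simp
  also have "\<dots> \<le> (1 + b / a) * a\<^sup>2 + (1 + a / b) * b\<^sup>2"
    using ua vb ab by (intro add_mono mult_left_mono) auto
  also have "\<dots> = (a + b)\<^sup>2" using ab by (simp add: power2_eq_square field_simps)
  finally have "L2_seminorm N (\<lambda>\<omega>. u \<omega> + v \<omega>) \<le> a + b"
    unfolding L2_seminorm_def using ab by (intro real_le_lsqrt) auto
  then show "L2_seminorm N (\<lambda>\<omega>. u \<omega> + v \<omega>) \<le> L2_seminorm N u + L2_seminorm N v + e"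
    unfolding a_def b_def by simp
qed

lemma limsup_eqI:
  fixes X :: "nat \<Rightarrow> real"
  assumes s: "0 \<le> s" and nonneg: "\<forall>\<^sub>F n in sequentially. 0 \<le> X n"
    and up: "\<And>c. s < c \<Longrightarrow> \<forall>\<^sub>F n in sequentially. X n \<le> c"
    and low: "\<And>c. 0 \<le> c \<Longrightarrow> c < s \<Longrightarrow> \<exists>\<^sub>F n in sequentially. c \<le> X n"
  shows "limsup (\<lambda>n. ereal (X n)) = ereal s"
proof (rule antisym)
  show "limsup (\<lambda>n. ereal (X n)) \<le> ereal s"
  proof (rule ereal_le_epsilon2)
    fix e :: real assume "0 < e"
    then have "\<forall>\<^sub>F n in sequentially. ereal (X n) \<le> ereal (s + e)" using up[of "s + e"] by simp
    then show "limsup (\<lambda>n. ereal (X n)) \<le> ereal s + ereal e" by (simp add: Limsup_bounded)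
  qed
  have ge: "ereal c \<le> limsup (\<lambda>n. ereal (X n))" if "\<exists>\<^sub>F n in sequentially. c \<le> X n" for c
  proof (rule ccontr)
    assume "\<not> ereal c \<le> limsup (\<lambda>n. ereal (X n))"
    then have "\<forall>\<^sub>F n in sequentially. ereal (X n) < ereal c" by (intro Limsup_lessD) simp
    then have "\<forall>\<^sub>F n in sequentially. \<not> c \<le> X n" by (simp add: not_le)
    with that show False by (simp add: frequently_def)
  qed
  show "ereal s \<le> limsup (\<lambda>n. ereal (X n))"
  proof (cases "s = 0")
    case True
    have "\<exists>\<^sub>F n in sequentially. 0 \<le> X n" using nonneg by (rule eventually_frequently[rotated]) simp
    from ge[OF this] True show ?thesis by simp
  next
    case False
    show ?thesis
    proof (rule ereal_le_epsilon2)
      fix e :: real assume e: "0 < e"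
      have "ereal (max 0 (s - e)) \<le> limsup (\<lambda>n. ereal (X n))"
        by (rule ge, rule low) (use e s False in auto)
      then have "ereal (s - e) \<le> limsup (\<lambda>n. ereal (X n))" by (rule order_trans[rotated]) simp
      then have "ereal (s - e) + ereal e \<le> limsup (\<lambda>n. ereal (X n)) + ereal e" by (rule add_right_mono)
      then show "ereal s \<le> limsup (\<lambda>n. ereal (X n)) + ereal e" by simp
    qed
  qed
qed

context bernoulli_shift
begin

text \<open>Replacing \<open>g\<close> by a nearby bounded function \<open>g'\<close> of finitely many coordinates changes the sums by at most
\<open>e\<close> times the scale, because the upper half of the law applies to the difference \<open>g - g'\<close>.\<close>

lemma LIL_lower_shift:
  assumes g: "g \<in> mart_diff_class" and c: "0 \<le> c" "c < L2_seminorm P g"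
  shows "AE \<omega> in P. \<exists>\<^sub>F n in sequentially. c * lil_scale (real n) \<le> (\<Sum>i<n. g (int_shift (int i) \<omega>))"
proof -
  define e where "e = (L2_seminorm P g - c) / 4"
  have e: "0 < e" unfolding e_def using c by simp
  obtain m B g' where g': "g' \<in> mart_diff_class" "g' \<in> borel_measurable (F {0..int m})" "\<And>\<omega>. \<bar>g' \<omega>\<bar> \<le> B"
    and close: "L2_seminorm P (\<lambda>\<omega>. g \<omega> - g' \<omega>) < e"
    using bounded_window_mart_diff_dense[OF g e] by blast
  note diff = mart_diff_class_diff[OF g g'(1)]
  have "L2_seminorm P (\<lambda>\<omega>. g' \<omega> + (g \<omega> - g' \<omega>)) \<le> L2_seminorm P g' + L2_seminorm P (\<lambda>\<omega>. g \<omega> - g' \<omega>)"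
    using mart_diff_class_L2[OF g'(1)] mart_diff_class_L2[OF diff]
    by (intro L2_seminorm_triangle) (auto intro: L2_measurable L2_square_integrable)
  then have s': "c + 2 * e < L2_seminorm P g'" 
  proof -
    assume "L2_seminorm P (\<lambda>\<omega>. g' \<omega> + (g \<omega> - g' \<omega>)) \<le> L2_seminorm P g' + L2_seminorm P (\<lambda>\<omega>. g \<omega> - g' \<omega>)"
    moreover have "4 * e = L2_seminorm P g - c" unfolding e_def by simp
    ultimately show ?thesis using close e by simp
  qed
  interpret W: window_mart_diff M g' m B
    by unfold_locales (use g' s' c e in auto)
  have "AE \<omega> in P. \<exists>\<^sub>F n in sequentially. (c + 2 * e) * lil_scale (real n) < W.S n \<omega>"
    by (rule W.LIL_lower_window) (use c e s' in \<open>auto simp: W.\<sigma>_def\<close>)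
  then show ?thesis using LIL_upper_shift_abs[OF diff close]
  proof eventually_elim
    case (elim \<omega>)
    have "\<forall>\<^sub>F n in sequentially. 27 \<le> real n" by real_asymp
    from frequently_eventually_frequently[OF elim(1) eventually_conj[OF elim(2) this]]
    show ?case
    proof (rule frequently_elim1)
      fix n assume n: "(c + 2 * e) * lil_scale (real n) < W.S n \<omega>
        \<and> \<bar>\<Sum>i<n. g (int_shift (int i) \<omega>) - g' (int_shift (int i) \<omega>)\<bar> \<le> e * lil_scale (real n) \<and> 27 \<le> real n"
      have "(\<Sum>i<n. g (int_shift (int i) \<omega>)) = W.S n \<omega> + (\<Sum>i<n. g (int_shift (int i) \<omega>) - g' (int_shift (int i) \<omega>))"
        unfolding W.S_def W.Y_def by (simp add: sum_subtractf)
      moreover have "0 \<le> e * lil_scale (real n)" using e lil_scale_pos[of "real n"] n by simp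
      moreover have "(c + 2 * e) * lil_scale (real n) = c * lil_scale (real n) + 2 * (e * lil_scale (real n))"
        by (simp add: algebra_simps)
      ultimately show "c * lil_scale (real n) \<le> (\<Sum>i<n. g (int_shift (int i) \<omega>))" using n by linarith
    qed
  qed
qed

text \<open>A square integrable stationary sequence exceeds the truncation level, which is of smaller order than the
scale, by at most the accumulated excess, which is negligible too.\<close>

lemma stationary_negligible:
  assumes h: "h \<in> L2 P (F K)"
  shows "AE \<omega> in P. (\<lambda>n. h (int_shift (int n) \<omega>) / lil_scale (real n)) \<longlonglongrightarrow> 0"
proof -
  have hm[measurable]: "h \<in> borel_measurable P" using L2_measurable[OF h] .
  have "AE \<omega> in P. (\<lambda>n. (\<Sum>i<n. max 0 (\<bar>h (int_shift (int i) \<omega>)\<bar> - 1 * trunc_level (real i + 28))) / lil_scale (real n + 28)) \<longlonglongrightarrow> 0"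
  proof (rule P.excess_negligible)
    have "distr P borel (\<lambda>\<omega>. (\<lambda>\<omega>. \<bar>h \<omega>\<bar>) (int_shift (int n) \<omega>)) = distr P borel (\<lambda>\<omega>. \<bar>h \<omega>\<bar>)" for n
      by (rule distr_comp_int_shift) measurable
    then show "distr P borel (\<lambda>\<omega>. \<bar>h (int_shift (int n) \<omega>)\<bar>) = distr P borel (\<lambda>\<omega>. \<bar>h (int_shift (int 0) \<omega>)\<bar>)" for n
      by simp
    show "integrable P (\<lambda>\<omega>. \<bar>h (int_shift (int 0) \<omega>)\<bar>\<^sup>2)" using L2_square_integrable[OF h] by simp
  qed auto
  then show ?thesis
  proof eventually_elim
    case (elim \<omega>)
    define X where "X n = (\<Sum>i<n. max 0 (\<bar>h (int_shift (int i) \<omega>)\<bar> - 1 * trunc_level (real i + 28)))" for n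
    have lims: "(\<lambda>n. trunc_level (real n + 28) / lil_scale (real n)) \<longlonglongrightarrow> 0"
      "(\<lambda>n. lil_scale (real (Suc n) + 28) / lil_scale (real n)) \<longlonglongrightarrow> 1"
      unfolding trunc_level_def lil_scale_def by real_asymp+
    have XSuc: "(\<lambda>n. X (Suc n) / lil_scale (real (Suc n) + 28)) \<longlonglongrightarrow> 0"
      using LIMSEQ_Suc[OF elim] unfolding X_def .
    have b0: "(\<lambda>n. trunc_level (real n + 28) / lil_scale (real n)
        + X (Suc n) / lil_scale (real (Suc n) + 28) * (lil_scale (real (Suc n) + 28) / lil_scale (real n))) \<longlonglongrightarrow> 0"
      using tendsto_add[OF lims(1) tendsto_mult[OF XSuc lims(2)]] by simp
    show ?case
    proof (rule Lim_null_comparison[OF _ b0])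
      have "\<forall>\<^sub>F n in sequentially. 27 \<le> real n" by real_asymp
      then show "\<forall>\<^sub>F n in sequentially. norm (h (int_shift (int n) \<omega>) / lil_scale (real n))
        \<le> trunc_level (real n + 28) / lil_scale (real n)
        + X (Suc n) / lil_scale (real (Suc n) + 28) * (lil_scale (real (Suc n) + 28) / lil_scale (real n))"
      proof eventually_elim
        case (elim n)
        have pos: "0 < lil_scale (real n)" "0 < lil_scale (real (Suc n) + 28)"
          using elim by (auto intro: lil_scale_pos)
        have "max 0 (\<bar>h (int_shift (int n) \<omega>)\<bar> - 1 * trunc_level (real n + 28)) \<le> X (Suc n)"
          unfolding X_def by (rule member_le_sum) auto
        then have "\<bar>h (int_shift (int n) \<omega>)\<bar> \<le> trunc_level (real n + 28) + X (Suc n)" by linarith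
        then have "\<bar>h (int_shift (int n) \<omega>)\<bar> / lil_scale (real n) \<le> (trunc_level (real n + 28) + X (Suc n)) / lil_scale (real n)"
          using pos by (intro divide_right_mono) auto
        then show ?case using pos by (simp add: add_divide_distrib)
      qed
    qed
  qed
qed

text \<open>The coboundary part of the decomposition telescopes.\<close>

lemma birkhoff_sum_eq:
  assumes "AE \<omega> in P. centered P f \<omega> = g \<omega> + h (inv right_shift \<omega>) - h \<omega>"
  shows "AE \<omega> in P. \<forall>N. birkhoff_sum M f N \<omega>
    = (\<Sum>i<Suc N. g (int_shift (int i) \<omega>)) + h (int_shift (- 1) \<omega>) - h (int_shift (int N) \<omega>)"
proof -
  have "AE \<omega> in P. \<forall>n::nat. centered P f (int_shift (int n) \<omega>)
    = g (int_shift (int n) \<omega>) + h (int_shift (int n - 1) \<omega>) - h (int_shift (int n) \<omega>)"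
    unfolding AE_all_countable
  proof
    fix n :: nat
    show "AE \<omega> in P. centered P f (int_shift (int n) \<omega>)
      = g (int_shift (int n) \<omega>) + h (int_shift (int n - 1) \<omega>) - h (int_shift (int n) \<omega>)"
      using AE_int_shift[OF assms, of "int n"] by (simp add: inv_right_shift)
  qed
  then show ?thesis
  proof eventually_elim
    case (elim \<omega>)
    show ?case
    proof
      fix N
      show "birkhoff_sum M f N \<omega>
        = (\<Sum>i<Suc N. g (int_shift (int i) \<omega>)) + h (int_shift (- 1) \<omega>) - h (int_shift (int N) \<omega>)"
      proof (induction N)
        case 0
        then show ?case using elim[rule_format, of 0] by (simp add: birkhoff_sum_def)
      next
        case (Suc N)
        then show ?case using elim[rule_format, of "Suc N"]
          by (simp add: birkhoff_sum_def right_shift_power del: funpow.simps)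
      qed
    qed
  qed
qed

text \<open>By orthogonality the martingale part has norm \<open>sqrt (N + 1)\<close> times that of \<open>g\<close>, and the coboundary part
stays bounded.\<close>

lemma L2_norm_growth:
  assumes g: "g \<in> mart_diff_class" and h: "h \<in> L2 P (F K)"
    and b: "\<And>N. AE \<omega> in P. b N \<omega>
      = (\<Sum>i<Suc N. g (int_shift (int i) \<omega>)) + h (int_shift (- 1) \<omega>) - h (int_shift (int N) \<omega>)"
    and bm: "\<And>N. b N \<in> borel_measurable P"
  shows "(\<lambda>N. 1 / sqrt (real N) * L2_seminorm P (b N)) \<longlonglongrightarrow> L2_seminorm P g"
proof -
  define s where "s = L2_seminorm P g"
  define k where "k = L2_seminorm P h"
  have [measurable]: "g \<in> borel_measurable P" "h \<in> borel_measurable P"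
    using L2_measurable[OF mart_diff_class_L2[OF g]] L2_measurable[OF h] .
  note bm[measurable]
  have hsq: "integrable P (\<lambda>\<omega>. (h (int_shift j \<omega>))\<^sup>2)" for j
    by (rule integrable_int_shift[OF L2_square_integrable[OF h]])
  define G where "G N \<omega> = (\<Sum>i<Suc N. g (int_shift (int i) \<omega>))" for N \<omega>
  have [measurable]: "G N \<in> borel_measurable P" for N unfolding G_def[abs_def] by measurable
  have Gsq: "integrable P (\<lambda>\<omega>. (G N \<omega>)\<^sup>2)" for N
    unfolding G_def by (rule mart_diff_sum_square[OF g]) simp
  have Gn: "L2_seminorm P (G N) = sqrt (real N + 1) * s" for N
    unfolding L2_seminorm_def G_def using mart_diff_sum_square(2)[OF g, of "{..<Suc N}"] L2_seminorm_nonneg[of P g]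
    by (simp add: real_sqrt_mult s_def add.commute)
  have hn: "L2_seminorm P (\<lambda>\<omega>. h (int_shift j \<omega>)) = k" for j
    unfolding L2_seminorm_def k_def using integral_int_shift[of "\<lambda>\<omega>. (h \<omega>)\<^sup>2" j] by simp
  define H where "H N \<omega> = h (int_shift (- 1) \<omega>) + - h (int_shift (int N) \<omega>)" for N \<omega>
  have [measurable]: "H N \<in> borel_measurable P" for N unfolding H_def[abs_def] by measurable
  have Hsq: "integrable P (\<lambda>\<omega>. (H N \<omega>)\<^sup>2)" for N
    unfolding H_def by (rule integrable_square_add) (use hsq in auto)
  have Hn: "L2_seminorm P (H N) \<le> 2 * k" for N
  proof -
    have "L2_seminorm P (H N) \<le> L2_seminorm P (\<lambda>\<omega>. h (int_shift (- 1) \<omega>)) + L2_seminorm P (\<lambda>\<omega>. - h (int_shift (int N) \<omega>))"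
      unfolding H_def[abs_def] by (rule L2_seminorm_triangle) (use hsq in auto)
    then show ?thesis using L2_seminorm_uminus[of "\<lambda>\<omega>. h (int_shift (int N) \<omega>)"] hn by simp
  qed
  have bn: "L2_seminorm P (b N) = L2_seminorm P (\<lambda>\<omega>. G N \<omega> + H N \<omega>)" for N
    unfolding L2_seminorm_def
  proof (rule arg_cong[where f = sqrt], rule integral_cong_AE)
    show "AE \<omega> in P. (b N \<omega>)\<^sup>2 = (G N \<omega> + H N \<omega>)\<^sup>2"
      using b[of N]
    proof eventually_elim
      case (elim \<omega>)
      then have "b N \<omega> = G N \<omega> + H N \<omega>" unfolding G_def H_def by linarith
      then show ?case by simp
    qed
  qed measurable
  have up: "L2_seminorm P (b N) \<le> sqrt (real N + 1) * s + 2 * k" for N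
    using L2_seminorm_triangle[of "G N" P "H N"] Gsq Hsq Hn[of N] unfolding bn Gn by simp
  have lo: "sqrt (real N + 1) * s - 2 * k \<le> L2_seminorm P (b N)" for N
  proof -
    have i1: "integrable P (\<lambda>\<omega>. (G N \<omega> + H N \<omega>)\<^sup>2)"
      by (rule integrable_square_add) (use Gsq Hsq in auto)
    have "L2_seminorm P (\<lambda>\<omega>. (G N \<omega> + H N \<omega>) + - H N \<omega>) \<le> L2_seminorm P (\<lambda>\<omega>. G N \<omega> + H N \<omega>) + L2_seminorm P (\<lambda>\<omega>. - H N \<omega>)"
      by (rule L2_seminorm_triangle) (use i1 Hsq in auto)
    then show ?thesis using Hn[of N] Gn[of N] unfolding bn L2_seminorm_uminus by simp
  qed
  show ?thesis
    unfolding s_def[symmetric]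
  proof (rule tendsto_sandwich)
    show "\<forall>\<^sub>F N in sequentially. 1 / sqrt (real N) * (sqrt (real N + 1) * s - 2 * k) \<le> 1 / sqrt (real N) * L2_seminorm P (b N)"
      by (intro always_eventually allI mult_left_mono lo) simp
    show "\<forall>\<^sub>F N in sequentially. 1 / sqrt (real N) * L2_seminorm P (b N) \<le> 1 / sqrt (real N) * (sqrt (real N + 1) * s + 2 * k)"
      by (intro always_eventually allI mult_left_mono up) simp
    have "(\<lambda>N. sqrt (real N + 1) / sqrt (real N)) \<longlonglongrightarrow> 1" "(\<lambda>N. 1 / sqrt (real N)) \<longlonglongrightarrow> 0" by real_asymp+
    from tendsto_diff[OF tendsto_mult[OF this(1) tendsto_const[of s]] tendsto_mult[OF this(2) tendsto_const[of "2 * k"]]]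
      tendsto_add[OF tendsto_mult[OF this(1) tendsto_const[of s]] tendsto_mult[OF this(2) tendsto_const[of "2 * k"]]]
    show "(\<lambda>N. 1 / sqrt (real N) * (sqrt (real N + 1) * s - 2 * k)) \<longlonglongrightarrow> s"
      "(\<lambda>N. 1 / sqrt (real N) * (sqrt (real N + 1) * s + 2 * k)) \<longlonglongrightarrow> s"
      by (simp_all add: algebra_simps)
  qed
qed

text \<open>On the scale of the law the coboundary terms vanish, and passing from \<open>Suc N\<close> summands to the scale at
\<open>N\<close> costs a factor tending to \<open>1\<close>.\<close>

lemma LIL_coboundary_perturbation:
  assumes g: "g \<in> mart_diff_class" and h: "h \<in> L2 P (F K)"
    and b: "AE \<omega> in P. \<forall>N. b N \<omega>
      = (\<Sum>i<Suc N. g (int_shift (int i) \<omega>)) + h (int_shift (- 1) \<omega>) - h (int_shift (int N) \<omega>)"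
  shows "AE \<omega> in P. limsup (\<lambda>N. ereal (\<bar>b N \<omega>\<bar> / lil_scale (real N))) = ereal (L2_seminorm P g)"
proof -
  define s where "s = L2_seminorm P g"
  have s0: "0 \<le> s" unfolding s_def by (rule L2_seminorm_nonneg)
  define G where "G n \<omega> = (\<Sum>i<n. g (int_shift (int i) \<omega>))" for n \<omega>
  have upper: "AE \<omega> in P. \<forall>k::nat. \<forall>\<^sub>F n in sequentially. \<bar>G n \<omega>\<bar> \<le> (s + 1 / (real k + 1)) * lil_scale (real n)"
    unfolding AE_all_countable G_def
    by (intro allI LIL_upper_shift_abs[OF g]) (simp add: s_def)
  have lower: "AE \<omega> in P. \<forall>k::nat. 0 \<le> s - 1 / (real k + 1) \<longrightarrow>
    (\<exists>\<^sub>F n in sequentially. (s - 1 / (real k + 1)) * lil_scale (real n) \<le> G n \<omega>)"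
    unfolding AE_all_countable
  proof
    fix k :: nat
    show "AE \<omega> in P. 0 \<le> s - 1 / (real k + 1) \<longrightarrow>
      (\<exists>\<^sub>F n in sequentially. (s - 1 / (real k + 1)) * lil_scale (real n) \<le> G n \<omega>)"
    proof (cases "0 \<le> s - 1 / (real k + 1)")
      case True
      have "s - 1 / (real k + 1) < L2_seminorm P g" unfolding s_def by simp
      from LIL_lower_shift[OF g True this] show ?thesis unfolding G_def by eventually_elim simp
    qed simp
  qed
  have ratio: "(\<lambda>N. lil_scale (real (Suc N)) / lil_scale (real N)) \<longlonglongrightarrow> 1"
    unfolding lil_scale_def by real_asymp
  have big: "\<forall>\<^sub>F N in sequentially. 27 \<le> real N" by real_asymp
  show ?thesis
    using b upper lower stationary_negligible[OF h]
  proof eventually_elim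
    case (elim \<omega>)
    define R where "R N = (h (int_shift (- 1) \<omega>) - h (int_shift (int N) \<omega>)) / lil_scale (real N)" for N
    have inv0: "(\<lambda>N. 1 / lil_scale (real N)) \<longlonglongrightarrow> 0" unfolding lil_scale_def by real_asymp
    have "R \<longlonglongrightarrow> 0"
      using tendsto_diff[OF tendsto_mult[OF tendsto_const[of "h (int_shift (- 1) \<omega>)"] inv0] elim(4)]
      unfolding R_def by (simp add: diff_divide_distrib)
    then have R: "(\<lambda>N. \<bar>R N\<bar>) \<longlonglongrightarrow> 0" by (simp add: tendsto_rabs_zero)
    have bR: "b N \<omega> / lil_scale (real N) = G (Suc N) \<omega> / lil_scale (real N) + R N" for N
      using elim(1) unfolding R_def G_def by (simp add: add_divide_distrib diff_divide_distrib)
    show ?case unfolding s_def[symmetric]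
    proof (rule limsup_eqI[OF s0])
      show "\<forall>\<^sub>F N in sequentially. 0 \<le> \<bar>b N \<omega>\<bar> / lil_scale (real N)"
        using big by eventually_elim (simp add: less_imp_le lil_scale_pos)
    next
      fix c assume c: "s < c"
      obtain k :: nat where k: "1 / (real k + 1) < c - s"
        using c reals_Archimedean[of "c - s"] by (auto simp: inverse_eq_divide add.commute)
      define d where "d = s + 1 / (real k + 1)"
      have "(\<lambda>N. d * (lil_scale (real (Suc N)) / lil_scale (real N)) + \<bar>R N\<bar>) \<longlonglongrightarrow> d * 1 + 0"
        by (intro tendsto_intros ratio R)
      then have "\<forall>\<^sub>F N in sequentially. d * (lil_scale (real (Suc N)) / lil_scale (real N)) + \<bar>R N\<bar> < c"
        by (rule order_tendstoD) (use k in \<open>simp add: d_def\<close>)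
      moreover have "\<forall>\<^sub>F N in sequentially. \<bar>G (Suc N) \<omega>\<bar> \<le> d * lil_scale (real (Suc N))"
        using elim(2)[rule_format, of k] unfolding d_def
        by (subst eventually_sequentially_Suc[of "\<lambda>n. \<bar>G n \<omega>\<bar> \<le> (s + 1 / (real k + 1)) * lil_scale (real n)"])
      ultimately show "\<forall>\<^sub>F N in sequentially. \<bar>b N \<omega>\<bar> / lil_scale (real N) \<le> c"
        using big
      proof eventually_elim
        case (elim N)
        have pos: "0 < lil_scale (real N)" using elim by (auto intro: lil_scale_pos)
        have "\<bar>b N \<omega>\<bar> / lil_scale (real N) = \<bar>G (Suc N) \<omega> / lil_scale (real N) + R N\<bar>"
          unfolding bR[symmetric] using pos by simp
        also have "\<dots> \<le> \<bar>G (Suc N) \<omega>\<bar> / lil_scale (real N) + \<bar>R N\<bar>" using pos abs_triangle_ineq[of "G (Suc N) \<omega> / lil_scale (real N)" "R N"] by simp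
        also have "\<bar>G (Suc N) \<omega>\<bar> / lil_scale (real N) \<le> d * lil_scale (real (Suc N)) / lil_scale (real N)"
          using elim pos by (intro divide_right_mono) auto
        finally show ?case using elim by simp
      qed
    next
      fix c assume c: "0 \<le> c" "c < s"
      obtain k :: nat where k: "1 / (real k + 1) < s - c"
        using c reals_Archimedean[of "s - c"] by (auto simp: inverse_eq_divide add.commute)
      define d where "d = s - 1 / (real k + 1)"
      have d: "0 \<le> d" "c < d" unfolding d_def using k c by auto
      have "(\<lambda>N. d * (lil_scale (real (Suc N)) / lil_scale (real N)) - \<bar>R N\<bar>) \<longlonglongrightarrow> d * 1 - 0"
        by (intro tendsto_intros ratio R)
      then have ev: "\<forall>\<^sub>F N in sequentially. c < d * (lil_scale (real (Suc N)) / lil_scale (real N)) - \<bar>R N\<bar>"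
        by (rule order_tendstoD) (use d in simp)
      have "\<exists>\<^sub>F n in sequentially. d * lil_scale (real n) \<le> G n \<omega>"
        using elim(3) d unfolding d_def by blast
      then have "\<exists>\<^sub>F N in sequentially. d * lil_scale (real (Suc N)) \<le> G (Suc N) \<omega>"
        unfolding frequently_def by (simp only: eventually_sequentially_Suc[of "\<lambda>n. \<not> d * lil_scale (real n) \<le> G n \<omega>"] simp_thms)
      from frequently_eventually_frequently[OF this eventually_conj[OF ev big]]
      show "\<exists>\<^sub>F N in sequentially. c \<le> \<bar>b N \<omega>\<bar> / lil_scale (real N)"
      proof (rule frequently_elim1)
        fix N assume N: "d * lil_scale (real (Suc N)) \<le> G (Suc N) \<omega>
          \<and> c < d * (lil_scale (real (Suc N)) / lil_scale (real N)) - \<bar>R N\<bar> \<and> 27 \<le> real N"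
        have pos: "0 < lil_scale (real N)" using N by (auto intro: lil_scale_pos)
        have "d * lil_scale (real (Suc N)) / lil_scale (real N) \<le> G (Suc N) \<omega> / lil_scale (real N)"
          using N pos by (intro divide_right_mono) auto
        then have "c \<le> G (Suc N) \<omega> / lil_scale (real N) + R N" using N abs_ge_minus_self[of "R N"] by simp
        also have "\<dots> = b N \<omega> / lil_scale (real N)" by (rule bR[symmetric])
        also have "\<dots> \<le> \<bar>b N \<omega>\<bar> / lil_scale (real N)" using pos by (intro divide_right_mono) auto
        finally show "c \<le> \<bar>b N \<omega>\<bar> / lil_scale (real N)" .
      qed
    qed
  qed
qed

end

section \<open>The law of the iterated logarithm in the Gordin class\<close>

theorem theorem3:
  fixes M :: "'e measure" and f g h :: "(int \<Rightarrow> 'e) \<Rightarrow> real"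
  assumes "prob_space M"
    and "f \<in> gordin_class M"
    and "gordin_decomposition M f g h"
  shows "((\<lambda>N. 1 / sqrt (real N) * L2_seminorm (path_space M) (birkhoff_sum M f N))
            \<longlonglongrightarrow> L2_seminorm (path_space M) g)
       \<and> (AE \<omega> in path_space M.
            limsup (\<lambda>N. ereal (\<bar>birkhoff_sum M f N \<omega>\<bar> / sqrt (2 * real N * ln (ln (real N)))))
              = ereal (L2_seminorm (path_space M) g))"
proof -
  interpret bernoulli_shift M using assms(1) by (simp add: bernoulli_shift_def)
  have g: "g \<in> mart_diff_class" and h: "h \<in> L2 P (F {0..})"
    and dec: "AE \<omega> in P. centered P f \<omega> = g \<omega> + h (inv right_shift \<omega>) - h \<omega>"
    using assms(3) unfolding gordin_decomposition_def mart_diff_class_def future_eq by auto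
  note eq = birkhoff_sum_eq[OF dec]
  have "f \<in> borel_measurable P"
    using assms(2) unfolding gordin_class_def future_eq by (auto intro: L2_measurable)
  then have cm[measurable]: "centered P f \<in> borel_measurable P" unfolding centered_def[abs_def] by measurable
  have bm: "birkhoff_sum M f N \<in> borel_measurable P" for N
    unfolding birkhoff_sum_def[abs_def] right_shift_power by measurable
  have "(\<lambda>N. 1 / sqrt (real N) * L2_seminorm P (birkhoff_sum M f N)) \<longlonglongrightarrow> L2_seminorm P g"
    by (rule L2_norm_growth[OF g h _ bm]) (use eq in \<open>auto elim: AE_mp\<close>)
  moreover have "AE \<omega> in P. limsup (\<lambda>N. ereal (\<bar>birkhoff_sum M f N \<omega>\<bar> / lil_scale (real N))) = ereal (L2_seminorm P g)"
    by (rule LIL_coboundary_perturbation[OF g h eq])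
  ultimately show ?thesis unfolding lil_scale_def by blast
qed

end
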